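(* Let $N\geq 3$. Let $p\in C^{0,\alpha}_{\rm loc}(\mathbb{R}^N)$ (for some $0<\alpha<1$) be non-negative, and let $f:[0,\infty)\to[0,\infty)$ be a non-decreasing function with $f\in C^{0,\alpha}_{\rm loc}[0,\infty)$, $f(0)=0$, $f>0$ on $(0,\infty)$, and $\Lambda:=\sup_{s\geq 1} f(s)/s<\infty$. For $r\geq0$ set $\varphi(r)=\max_{|x|=r}p(x)$, $\psi(r)=\min_{|x|=r}p(x)$, $h(r)=\varphi(r)-\psi(r)$, $\Lambda_N=\Lambda/(N-2)$ and $\Psi(r)=\exp\left(\Lambda_N\int_0^r s\psi(s)\,ds\right)$. Assume $$\int_0^\infty r\,h(r)\,\Psi(r)\,dr<\infty.$$ Then the problem $$\Delta u+|\nabla u|=p(x)f(u)\ \text{ in }\mathbb{R}^N,\qquad u\geq 0\ \text{ in }\mathbb{R}^N,$$ has a positive entire large solution (i.e. a positive solution with $u(x)\to\infty$ as $|x|\to\infty$) if and only if $$\int_1^\infty e^{-t}t^{1-N}\int_0^t e^s s^{N-1}\psi(s)\,ds\,dt=\infty.$$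
   Context: An entire large solution is a solution defined on all of $\mathbb{R}^N$ with $u(x)\to\infty$ as $|x|\to\infty$. *)

theory Defs
  imports "HOL-Analysis.Analysis"
begin

definition loc_holder_on :: "real \<Rightarrow> ('a::metric_space) set \<Rightarrow> ('a \<Rightarrow> real) \<Rightarrow> bool" where
  "loc_holder_on a S g \<longleftrightarrow>
     (\<forall>K. compact K \<and> K \<subseteq> S \<longrightarrow>
        (\<exists>C. \<forall>x\<in>K. \<forall>y\<in>K. \<bar>g x - g y\<bar> \<le> C * dist x y powr a))"

definition classical_solution ::
  "(real^'n \<Rightarrow> real) \<Rightarrow> (real \<Rightarrow> real) \<Rightarrow> (real^'n \<Rightarrow> real) \<Rightarrow> bool" where
  "classical_solution p f u \<longleftrightarrow>
     (\<exists>g H. (\<forall>x. (u has_derivative (\<lambda>h. g x \<bullet> h)) (at x)) \<and>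
            (\<forall>x. (g has_derivative H x) (at x)) \<and>
            (\<forall>i j. continuous_on UNIV (\<lambda>x. H x (axis j 1) $ i)) \<and>
            (\<forall>x. (\<Sum>i\<in>UNIV. H x (axis i 1) $ i) + norm (g x) = p x * f (u x)))"

definition positive_entire_large_solution ::
  "(real^'n \<Rightarrow> real) \<Rightarrow> (real \<Rightarrow> real) \<Rightarrow> (real^'n \<Rightarrow> real) \<Rightarrow> bool" where
  "positive_entire_large_solution p f u \<longleftrightarrow>
     classical_solution p f u \<and> (\<forall>x. u x > 0) \<and> filterlim u at_top at_infinity"

end

theory Submission
  imports Defs "HOL-Probability.Probability" "HOL-Complex_Analysis.Great_Picard"
begin

text \<open>Write $K[q](t) = e^{-t} t^{1-N} \int_0^t e^s s^{N-1} q(s)\,ds$ and $G[q](r) = \int_0^r K[q]$, so that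
  $G[q](|x|)$ solves $\Delta u + |\nabla u| = q(|x|)$. The condition says that $G[\psi]$ is unbounded.

  If $G[\psi]$ is bounded, so is $G[\varphi + e^{-r}]$, because $\int r h(r)\,dr < \infty$. The radial solution $w$ of
  $\Delta w + |\nabla w| = (\varphi + e^{-r}) f(w)$ with $w(0) = \max(1, u(0))$ is then bounded, and the minimum
  of $u - w$ for a large solution $u$ contradicts the equation.

  If $G[\psi]$ is unbounded, let $v = 1 + G[\varphi f(v)]$ and $w = b + G[\psi f(v)]$. The integrability of
  $r h \Psi$ bounds $G[h f(v)]$, so $v \le w$ for a suitable constant $b$, and $v$ is a subsolution, $w$ a supersolution.
  With $p$ cut off and $f$ replaced by Lipschitz functions, monotone iteration yields solutions on
  the whole space between $v$ and $w$; each step is solved by a contraction built from the resolvent of the Laplacian,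
  that is from the heat semigroup. A doubling-of-variables argument bounds the gradients locally, resolvent estimates
  give Hoelder bounds of the gradients, and a limit of the solutions solves the original problem.\<close>

section \<open>Differentiation under the integral sign\<close>

text \<open>Three obstacles shape the existence part. \<open>f\<close> is only Hoelder continuous,
  so \<lambda> s - p f(s) need not be increasing for any \<lambda>; hence the Lipschitz
  approximations, and a gap of one between the barriers that leaves room for the shift 1/k these
  introduce. The barriers may be unbounded, while comparison on the whole space needs a bounded
  difference; cutting off p bounds them, and on each ball the resulting bounds do not depend on the
  cutoff. No boundary value problem is solved: Gaussian kernels on the whole space supply the second
  derivatives, and for large \<lambda> the gradient of the resolvent is small enough to absorb |grad
  u| into a contraction.

  The weight \<Psi> reflects the growth of v. Since f(s) \<le> \<Lambda> s, v is at most
  exp(\<Lambda> G[\<phi>]), and the bound G[q](r) \<le> (1/(N-2)) int_0^r s q(s) ds, which needs N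
  \<ge> 3, turns this into a constant times \<Psi>(r). Then G[h f(v)] is bounded by a constant times
  the integral of r h \<Psi>.\<close>

lemma has_derivative_local_lipschitz_bound:
  fixes f :: "'a::real_normed_vector \<Rightarrow> 'b::real_normed_vector"
  assumes d: "(f has_derivative D) (at x0)" and e: "0 < e"
    and lip: "\<And>x. dist x x0 < e \<Longrightarrow> norm (f x - f x0) \<le> B * norm (x - x0)"
  shows "norm (D h) \<le> B * norm h"
proof -
  have bl: "bounded_linear D" using d by (rule has_derivative_bounded_linear)
  interpret bounded_linear D by fact
  have "((\<lambda>t. f (x0 + t *\<^sub>R h)) has_vector_derivative D h) (at 0)"
  proof -
    have "((\<lambda>t. x0 + t *\<^sub>R h) has_derivative (\<lambda>t. t *\<^sub>R h)) (at 0)"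
      by (auto intro!: derivative_eq_intros)
    from has_derivative_compose[OF this, of f D] d
    show ?thesis by (simp add: has_vector_derivative_def scaleR)
  qed
  then have "((\<lambda>t. norm ((f (x0 + t *\<^sub>R h) - f x0) - t *\<^sub>R D h) / norm t) \<longlongrightarrow> 0) (at 0)"
    by (simp add: has_vector_derivative_def has_derivative_iff_norm)
  then have lim: "((\<lambda>t. B * norm h + norm ((f (x0 + t *\<^sub>R h) - f x0) - t *\<^sub>R D h) / norm t) \<longlongrightarrow> B * norm h + 0) (at 0)"
    by (intro tendsto_intros)
  have "eventually (\<lambda>t. t * norm h < e \<and> t > 0) (at_right (0::real))"
  proof -
    have "((\<lambda>t. t * norm h) \<longlongrightarrow> 0 * norm h) (at_right (0::real))" by (intro tendsto_intros)
    then have "eventually (\<lambda>t. t * norm h < e) (at_right (0::real))"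
      using e by (auto dest: order_tendstoD)
    then show ?thesis by (auto intro: eventually_conj simp: eventually_at_right_less)
  qed
  then have "eventually (\<lambda>t. norm (D h) \<le> B * norm h + norm ((f (x0 + t *\<^sub>R h) - f x0) - t *\<^sub>R D h) / norm t) (at_right 0)"
  proof eventually_elim
    case (elim t)
    have "norm (t *\<^sub>R D h) \<le> norm (f (x0 + t *\<^sub>R h) - f x0) + norm ((f (x0 + t *\<^sub>R h) - f x0) - t *\<^sub>R D h)"
      by (smt (verit) norm_triangle_ineq4 diff_diff_eq2 add_diff_cancel_left' norm_minus_commute norm_triangle_sub)
    also have "norm (f (x0 + t *\<^sub>R h) - f x0) \<le> B * norm (t *\<^sub>R h)"
      using lip[of "x0 + t *\<^sub>R h"] elim by (simp add: dist_norm)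
    finally have "t * norm (D h) \<le> t * (B * norm h) + norm ((f (x0 + t *\<^sub>R h) - f x0) - t *\<^sub>R D h)"
      using elim by (simp add: algebra_simps)
    then show ?case using elim by (simp add: field_simps)
  qed
  moreover have "((\<lambda>t. B * norm h + norm ((f (x0 + t *\<^sub>R h) - f x0) - t *\<^sub>R D h) / norm t) \<longlongrightarrow> B * norm h + 0) (at_right 0)"
    using lim by (rule tendsto_within_subset) auto
  ultimately have "norm (D h) \<le> B * norm h + 0"
    by (intro tendsto_lowerbound) (auto simp: trivial_limit_at_right_real)
  then show ?thesis by simp
qed

text \<open>The linearisation error divided by \<open>norm (y - x0)\<close> tends to 0 pointwise and
  is dominated by \<open>2 * B\<close>: one \<open>B\<close> from the Lipschitz bound of the
  increment, one from the derivative, which inherits that bound by the preceding lemma.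
  Differentiability is tested along sequences so that dominated convergence applies.\<close>

lemma has_derivative_integral:
  fixes F :: "'a::real_normed_vector \<Rightarrow> 'w \<Rightarrow> 'b::{banach, second_countable_topology}"
  assumes d: "\<And>w. w \<in> space M \<Longrightarrow> ((\<lambda>x. F x w) has_derivative D w) (at x0)"
    and e: "0 < e"
    and lip: "\<And>x w. w \<in> space M \<Longrightarrow> dist x x0 < e \<Longrightarrow> norm (F x w - F x0 w) \<le> B w * norm (x - x0)"
    and int: "\<And>x. dist x x0 < e \<Longrightarrow> integrable M (F x)" and B: "integrable M B"
    and meas: "\<And>h. (\<lambda>w. D w h) \<in> borel_measurable M"
  shows "((\<lambda>x. \<integral>w. F x w \<partial>M) has_derivative (\<lambda>h. \<integral>w. D w h \<partial>M)) (at x0)"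
    and "integrable M (\<lambda>w. D w h)"
proof -
  have Db: "norm (D w h) \<le> B w * norm h" if "w \<in> space M" for w h
    by (rule has_derivative_local_lipschitz_bound[OF d[OF that] e lip[OF that]])
  have bl: "bounded_linear (D w)" if "w \<in> space M" for w
    using d[OF that] by (rule has_derivative_bounded_linear)
  show Dint: "integrable M (\<lambda>w. D w h)" for h
    by (rule Bochner_Integration.integrable_bound[OF integrable_mult_left[OF B, of "norm h"]])
       (use Db meas in \<open>auto intro!: AE_I2 order_trans[OF Db]\<close>)
  have lin: "bounded_linear (\<lambda>h. \<integral>w. D w h \<partial>M)"
  proof (rule bounded_linear_intro)
    show "(\<integral>w. D w (x + y) \<partial>M) = (\<integral>w. D w x \<partial>M) + (\<integral>w. D w y \<partial>M)" for x y
    proof -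
      have "(\<integral>w. D w (x + y) \<partial>M) = (\<integral>w. D w x + D w y \<partial>M)"
        by (rule Bochner_Integration.integral_cong) (auto simp: linear_add[OF bounded_linear.linear[OF bl]])
      then show ?thesis using Dint by simp
    qed
    show "(\<integral>w. D w (r *\<^sub>R x) \<partial>M) = r *\<^sub>R (\<integral>w. D w x \<partial>M)" for r x
    proof -
      have "(\<integral>w. D w (r *\<^sub>R x) \<partial>M) = (\<integral>w. r *\<^sub>R D w x \<partial>M)"
        by (rule Bochner_Integration.integral_cong) (auto simp: linear_cmul[OF bounded_linear.linear[OF bl]])
      then show ?thesis by simp
    qed
    show "norm (\<integral>w. D w x \<partial>M) \<le> norm x * (\<integral>w. B w \<partial>M)" for x
    proof -
      have "norm (\<integral>w. D w x \<partial>M) \<le> (\<integral>w. norm (D w x) \<partial>M)"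
        by (rule integral_norm_bound)
      also have "\<dots> \<le> (\<integral>w. B w * norm x \<partial>M)"
        using Db B Dint by (intro integral_mono) auto
      finally have "norm (\<integral>w. D w x \<partial>M) \<le> (\<integral>w. B w * norm x \<partial>M)" .
      then show ?thesis by (simp add: mult.commute)
    qed
  qed
  have "((\<lambda>y. norm (((\<integral>w. F y w \<partial>M) - (\<integral>w. F x0 w \<partial>M)) - (\<integral>w. D w (y - x0) \<partial>M)) / norm (y - x0)) \<longlongrightarrow> 0) (at x0)"
  proof (unfold tendsto_at_iff_sequentially, intro allI impI)
    fix X assume X: "\<forall>i. X i \<in> UNIV - {x0}" "X \<longlonglongrightarrow> x0"
    obtain n0 where n0: "\<And>n. n \<ge> n0 \<Longrightarrow> dist (X n) x0 < e"
      using X(2) e by (meson lim_sequentially)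
    \<comment> \<open>Dropping finitely many terms keeps the sequence in the ball where the majorant
      holds.\<close>
    define Y where "Y n = X (n + n0)" for n
    have Y: "Y n \<noteq> x0" "dist (Y n) x0 < e" for n using X(1) n0 by (auto simp: Y_def)
    have Ylim: "filterlim Y (at x0) sequentially"
      using LIMSEQ_ignore_initial_segment[OF X(2), of n0] Y by (auto simp: filterlim_at Y_def[abs_def])
    define S where "S n w = norm ((F (Y n) w - F x0 w) - D w (Y n - x0)) / norm (Y n - x0)" for n w
    have iS: "integrable M (\<lambda>w. (F (Y n) w - F x0 w) - D w (Y n - x0))" for n
      using Dint int Y e by auto
    have "(\<lambda>n. \<integral>w. S n w \<partial>M) \<longlonglongrightarrow> (\<integral>w. 0 \<partial>M)"
    proof (rule integral_dominated_convergence[where w="\<lambda>w. 2 * B w"])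
      show "S n \<in> borel_measurable M" for n
        unfolding S_def using borel_measurable_integrable[OF iS[of n]] by simp
      show "AE w in M. (\<lambda>n. S n w) \<longlonglongrightarrow> 0"
      proof (rule AE_I2)
        fix w assume w: "w \<in> space M"
        have "((\<lambda>y. norm ((F y w - F x0 w) - D w (y - x0)) / norm (y - x0)) \<longlongrightarrow> 0) (at x0)"
          using d[OF w] by (simp add: has_derivative_iff_norm)
        from filterlim_compose[OF this Ylim] show "(\<lambda>n. S n w) \<longlonglongrightarrow> 0" by (simp add: S_def)
      qed
      show "AE w in M. norm (S n w) \<le> 2 * B w" for n
      proof (rule AE_I2)
        fix w assume w: "w \<in> space M"
        have "norm ((F (Y n) w - F x0 w) - D w (Y n - x0)) \<le> 2 * B w * norm (Y n - x0)"
          using norm_triangle_ineq4[of "F (Y n) w - F x0 w" "D w (Y n - x0)"] lip[OF w Y(2)[of n]] Db[OF w, of "Y n - x0"]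
          by simp
        then show "norm (S n w) \<le> 2 * B w" using Y(1)[of n] by (simp add: S_def field_simps)
      qed
    qed (use B in auto)
    then have S0: "(\<lambda>n. \<integral>w. S n w \<partial>M) \<longlonglongrightarrow> 0" by simp
    have "(\<lambda>n. norm (((\<integral>w. F (Y n) w \<partial>M) - (\<integral>w. F x0 w \<partial>M)) - (\<integral>w. D w (Y n - x0) \<partial>M)) / norm (Y n - x0)) \<longlonglongrightarrow> 0"
    proof (rule tendsto_sandwich[OF _ _ tendsto_const S0])
      show "\<forall>\<^sub>F n in sequentially. norm (((\<integral>w. F (Y n) w \<partial>M) - (\<integral>w. F x0 w \<partial>M)) - (\<integral>w. D w (Y n - x0) \<partial>M)) / norm (Y n - x0)
          \<le> (\<integral>w. S n w \<partial>M)"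
      proof (rule always_eventually, rule allI)
        fix n
        have "((\<integral>w. F (Y n) w \<partial>M) - (\<integral>w. F x0 w \<partial>M)) - (\<integral>w. D w (Y n - x0) \<partial>M)
            = (\<integral>w. (F (Y n) w - F x0 w) - D w (Y n - x0) \<partial>M)"
          using int[OF Y(2)[of n]] int[of x0] e Dint by simp
        moreover have "norm \<dots> \<le> (\<integral>w. norm ((F (Y n) w - F x0 w) - D w (Y n - x0)) \<partial>M)"
          by (rule integral_norm_bound)
        ultimately show "norm (((\<integral>w. F (Y n) w \<partial>M) - (\<integral>w. F x0 w \<partial>M)) - (\<integral>w. D w (Y n - x0) \<partial>M)) / norm (Y n - x0)
            \<le> (\<integral>w. S n w \<partial>M)"
          by (simp add: S_def divide_right_mono)
      qed
    qed auto
    then show "((\<lambda>y. norm (((\<integral>w. F y w \<partial>M) - (\<integral>w. F x0 w \<partial>M)) - (\<integral>w. D w (y - x0) \<partial>M)) / norm (y - x0)) \<circ> X) \<longlonglongrightarrow> 0"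
      unfolding Y_def o_def by (rule LIMSEQ_offset)
  qed
  then show "((\<lambda>x. \<integral>w. F x w \<partial>M) has_derivative (\<lambda>h. \<integral>w. D w h \<partial>M)) (at x0)"
    using lin by (simp add: has_derivative_iff_norm)
qed

section \<open>Gaussian integrability, translations and dilations\<close>

lemma integrable_exp_neg_square_real:
  assumes "0 < a"
  shows "integrable lborel (\<lambda>x::real. exp (- a * x\<^sup>2))"
proof -
  define \<sigma> where "\<sigma> = sqrt (1 / (2 * a))"
  have s: "\<sigma> > 0" "\<sigma>\<^sup>2 = 1 / (2 * a)" using assms by (auto simp: \<sigma>_def)
  have "integrable lborel (\<lambda>x. sqrt (2 * pi * \<sigma>\<^sup>2) * normal_density 0 \<sigma> x)"
    using s by (intro integrable_mult_right integrable_normal_density)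
  moreover have "sqrt (2 * pi * \<sigma>\<^sup>2) * normal_density 0 \<sigma> x = exp (- a * x\<^sup>2)" for x
    using s assms by (simp add: normal_density_def field_simps)
  ultimately show ?thesis by simp
qed

lemma integrable_exp_neg_norm_square:
  assumes "0 < a"
  shows "integrable lborel (\<lambda>z::'a::euclidean_space. exp (- a * (norm z)\<^sup>2))"
proof -
  interpret product_sigma_finite "\<lambda>_::'a. lborel :: real measure" ..
  have "integrable (\<Pi>\<^sub>M b\<in>(Basis::'a set). (lborel :: real measure)) (\<lambda>f. \<Prod>b\<in>(Basis::'a set). exp (- a * (f b)\<^sup>2))"
    by (rule product_integrable_prod) (use integrable_exp_neg_square_real[OF assms] in auto)
  moreover have "(\<Prod>b\<in>(Basis::'a set). exp (- a * (f b)\<^sup>2)) = exp (- a * (norm (\<Sum>b\<in>(Basis::'a set). f b *\<^sub>R b))\<^sup>2)" for f :: "'a \<Rightarrow> real"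
  proof -
    have "(norm (\<Sum>b\<in>(Basis::'a set). f b *\<^sub>R b))\<^sup>2 = (\<Sum>b\<in>Basis. (f b)\<^sup>2)"
      by (subst norm_sum_Pythagorean) (auto simp: pairwise_def orthogonal_def inner_not_same_Basis power_mult_distrib)
    then show ?thesis by (simp add: exp_sum[symmetric] sum_distrib_left)
  qed
  ultimately show ?thesis
    by (subst lborel_eq, subst integrable_distr_eq) auto
qed

text \<open>From 1 + r \<le> exp r and Young's inequality m r \<le> m^2/(2a) + a r^2/2: half of the
  Gaussian exponent absorbs any polynomial.\<close>

lemma poly_exp_neg_square_le:
  fixes r a :: real
  assumes "0 < a" "0 \<le> r"
  shows "(1 + r) ^ m * exp (- a * r\<^sup>2) \<le> exp ((real m)\<^sup>2 / (2 * a)) * exp (- (a / 2) * r\<^sup>2)"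
proof -
  have "(1 + r) ^ m \<le> exp r ^ m" using assms by (intro power_mono) (auto simp: exp_ge_add_one_self)
  also have "\<dots> = exp (real m * r)" by (simp add: exp_of_nat_mult)
  also have "real m * r \<le> (real m)\<^sup>2 / (2 * a) + a / 2 * r\<^sup>2"
  proof -
    have "0 \<le> (real m - a * r)\<^sup>2 / (2 * a)" using assms by simp
    also have "\<dots> = (real m)\<^sup>2 / (2 * a) + a / 2 * r\<^sup>2 - real m * r"
      using assms by (simp add: field_simps power2_eq_square)
    finally show ?thesis by simp
  qed
  finally have "(1 + r) ^ m \<le> exp ((real m)\<^sup>2 / (2 * a) + a / 2 * r\<^sup>2)" by simp
  then have "(1 + r) ^ m * exp (- a * r\<^sup>2) \<le> exp ((real m)\<^sup>2 / (2 * a) + a / 2 * r\<^sup>2) * exp (- a * r\<^sup>2)"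
    by (rule mult_right_mono) simp
  also have "\<dots> = exp ((real m)\<^sup>2 / (2 * a)) * exp (- (a / 2) * r\<^sup>2)"
    by (simp add: exp_add[symmetric] algebra_simps)
  finally show ?thesis .
qed

lemma integrable_poly_exp_neg_norm_square:
  assumes "0 < a"
  shows "integrable lborel (\<lambda>z::'a::euclidean_space. (1 + norm z) ^ m * exp (- a * (norm z)\<^sup>2))"
  by (rule Bochner_Integration.integrable_bound[OF integrable_mult_right[OF integrable_exp_neg_norm_square[of "a/2"], of "exp ((real m)\<^sup>2 / (2 * a))"]])
     (use assms poly_exp_neg_square_le[of a _ m] in \<open>auto simp: abs_mult\<close>)

lemma lborel_integral_translation:
  fixes F :: "'a::euclidean_space \<Rightarrow> 'b::{banach, second_countable_topology}"
  assumes "F \<in> borel_measurable borel"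
  shows "(\<integral>z. F (x + z) \<partial>lborel) = (\<integral>y. F y \<partial>lborel)"
  by (subst (2) lborel_distr_plus[symmetric, of x], subst integral_distr) (use assms in auto)

lemma lborel_integrable_translation:
  fixes F :: "'a::euclidean_space \<Rightarrow> 'b::{banach, second_countable_topology}"
  assumes "integrable lborel F"
  shows "integrable lborel (\<lambda>z. F (x + z))"
proof -
  have "integrable (distr lborel borel ((+) x)) F" using assms by (simp add: lborel_distr_plus)
  then show ?thesis by (subst (asm) integrable_distr_eq) (use assms in auto)
qed

lemma lborel_integral_scale:
  fixes F :: "'a::euclidean_space \<Rightarrow> 'b::{banach, second_countable_topology}"
  assumes F: "F \<in> borel_measurable borel" and s: "0 < s"
  shows "(\<integral>z. F (s *\<^sub>R z) \<partial>lborel) = (1 / s ^ DIM('a)) *\<^sub>R (\<integral>w. F w \<partial>lborel)"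
proof -
  have "(\<integral>w. F w \<partial>lborel) = (\<integral>w. F w \<partial>(density (distr lborel borel (\<lambda>x. 0 + s *\<^sub>R x)) (\<lambda>_. \<bar>s\<bar> ^ DIM('a))))"
    using s by (subst lborel_affine[of s 0]) auto
  also have "\<dots> = (\<integral>w. s ^ DIM('a) *\<^sub>R F w \<partial>(distr lborel borel (\<lambda>x. 0 + s *\<^sub>R x)))"
    using s F by (subst integral_density) (auto simp: ennreal_power[symmetric])
  also have "\<dots> = s ^ DIM('a) *\<^sub>R (\<integral>z. F (s *\<^sub>R z) \<partial>lborel)"
    using F by (subst integral_distr) auto
  finally show ?thesis using s by simp
qed

section \<open>The heat semigroup\<close>

text \<open>The standard Gaussian density. The normalising constant is left as an integral, because
  only its positivity and the total mass 1 are needed, not its value.\<close>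

definition gauss :: "'a::euclidean_space \<Rightarrow> real" where
  "gauss z = exp (- (norm z)\<^sup>2 / 2) / (\<integral>w. exp (- (norm (w::'a))\<^sup>2 / 2) \<partial>lborel)"

lemma gauss_mass_pos: "0 < (\<integral>w. exp (- (norm (w::'a::euclidean_space))\<^sup>2 / 2) \<partial>lborel)"
proof -
  have int: "integrable lborel (\<lambda>w::'a. exp (- (norm w)\<^sup>2 / 2))"
    using integrable_exp_neg_norm_square[of "1/2"] by simp
  have "(\<integral>w. exp (- (norm (w::'a))\<^sup>2 / 2) \<partial>lborel) \<noteq> 0"
  proof
    assume "(\<integral>w. exp (- (norm (w::'a))\<^sup>2 / 2) \<partial>lborel) = 0"
    then have "AE w in (lborel::'a measure). exp (- (norm w)\<^sup>2 / 2) = 0"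
      using integral_nonneg_eq_0_iff_AE[OF int] by simp
    then have "AE w in (lborel::'a measure). False" by simp
    then have "emeasure (lborel::'a measure) (space lborel) = 0"
      using AE_iff_measurable[of "space (lborel::'a measure)" lborel "\<lambda>_. False"] by auto
    then show False by simp
  qed
  moreover have "0 \<le> (\<integral>w. exp (- (norm (w::'a))\<^sup>2 / 2) \<partial>lborel)" by simp
  ultimately show ?thesis by linarith
qed

lemma gauss_nonneg [simp]: "0 \<le> gauss z"
  using gauss_mass_pos[where 'a='a] by (simp add: gauss_def)

lemma poly_gauss_le:
  obtains C where "0 \<le> C" "\<And>z::'a::euclidean_space. (1 + norm z) ^ m * gauss z \<le> C * exp (- (norm z)\<^sup>2 / 4)"
proof
  let ?c = "\<integral>w. exp (- (norm (w::'a))\<^sup>2 / 2) \<partial>lborel"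
  show "0 \<le> exp ((real m)\<^sup>2) / ?c" using gauss_mass_pos[where 'a='a] by simp
  fix z :: 'a
  show "(1 + norm z) ^ m * gauss z \<le> exp ((real m)\<^sup>2) / ?c * exp (- (norm z)\<^sup>2 / 4)"
    using poly_exp_neg_square_le[of "1/2" "norm z" m] gauss_mass_pos[where 'a='a]
    by (simp add: gauss_def divide_right_mono)
qed

lemma gauss_has_derivative: "(gauss has_derivative (\<lambda>h. - (w \<bullet> h) * gauss w)) (at w)"
proof -
  have "((\<lambda>z::'a. exp (- (z \<bullet> z) / 2) / (\<integral>w. exp (- (norm (w::'a))\<^sup>2 / 2) \<partial>lborel)) has_derivative
      (\<lambda>h. - (w \<bullet> h) * gauss w)) (at w)"
    using gauss_mass_pos[where 'a='a]
    by (auto intro!: derivative_eq_intros simp: gauss_def power2_norm_eq_inner inner_commute fun_eq_iff)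
  then show ?thesis by (simp add: gauss_def[abs_def] power2_norm_eq_inner)
qed

lemma continuous_on_gauss [continuous_intros]:
  "continuous_on S f \<Longrightarrow> continuous_on S (\<lambda>x. gauss (f x))"
  unfolding gauss_def using gauss_mass_pos[where 'a='b] by (intro continuous_intros) auto

lemma borel_measurable_gauss [measurable]: "gauss \<in> borel_measurable borel"
  by (intro borel_measurable_continuous_onI continuous_intros)

lemma integrable_exp_quarter: "integrable lborel (\<lambda>z::'a::euclidean_space. exp (- (norm z)\<^sup>2 / 4))"
  using integrable_exp_neg_norm_square[of "1/4"] by simp

lemma integrable_poly_gauss: "integrable lborel (\<lambda>z::'a::euclidean_space. (1 + norm z) ^ m * gauss z)"
proof -
  obtain C where C: "0 \<le> C" "\<And>z::'a. (1 + norm z) ^ m * gauss z \<le> C * exp (- (norm z)\<^sup>2 / 4)"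
    by (rule poly_gauss_le[of m]) blast
  show ?thesis
    by (rule Bochner_Integration.integrable_bound[OF integrable_mult_right[OF integrable_exp_quarter, of C]])
       (use C in \<open>auto simp: abs_mult\<close>)
qed

lemma integrable_gauss: "integrable lborel (gauss::'a::euclidean_space \<Rightarrow> real)"
  using integrable_poly_gauss[of 0] by simp

lemma integral_gauss: "(\<integral>z. gauss (z::'a::euclidean_space) \<partial>lborel) = 1"
  using gauss_mass_pos[where 'a='a] by (simp add: gauss_def)

text \<open>Up to rescaling this is a convolution of \<open>g\<close> with \<open>k\<close> at scale
  \<open>s\<close>. With \<open>x\<close> and \<open>s\<close> placed in the argument of
  \<open>g\<close> the kernel stays fixed, so joint continuity in \<open>(s, x)\<close> follows by
  dominated convergence with the majorant \<open>M * norm (k z)\<close>, for merely continuous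
  bounded \<open>g\<close>.\<close>

definition gint :: "('a::euclidean_space \<Rightarrow> 'b::{banach, second_countable_topology}) \<Rightarrow> ('a \<Rightarrow> real) \<Rightarrow> real \<Rightarrow> 'a \<Rightarrow> 'b" where
  "gint k g s x = (\<integral>z. g (x + s *\<^sub>R z) *\<^sub>R k z \<partial>lborel)"

lemma gint_integrable:
  fixes k :: "'a::euclidean_space \<Rightarrow> 'b::{banach, second_countable_topology}"
  assumes k: "integrable lborel k" and g: "continuous_on UNIV g" "\<And>x. \<bar>g x\<bar> \<le> M"
  shows "integrable lborel (\<lambda>z. g (x + s *\<^sub>R z) *\<^sub>R k z)"
proof (rule Bochner_Integration.integrable_bound[OF integrable_mult_right[OF integrable_norm[OF k], of M]])
  have [measurable]: "g \<in> borel_measurable borel" by (rule borel_measurable_continuous_onI[OF g(1)])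
  show "(\<lambda>z. g (x + s *\<^sub>R z) *\<^sub>R k z) \<in> borel_measurable lborel"
    using borel_measurable_integrable[OF k] by measurable
  have "0 \<le> M" using g(2)[of 0] by simp
  then show "AE z in lborel. norm (g (x + s *\<^sub>R z) *\<^sub>R k z) \<le> norm (M * norm (k z))"
    using g(2) by (auto intro!: mult_right_mono simp: abs_mult)
qed

lemma gint_norm_le:
  fixes k :: "'a::euclidean_space \<Rightarrow> 'b::{banach, second_countable_topology}"
  assumes k: "integrable lborel k" and g: "continuous_on UNIV g" "\<And>x. \<bar>g x\<bar> \<le> M"
  shows "norm (gint k g s x) \<le> M * (\<integral>z. norm (k z) \<partial>lborel)"
proof -
  have "norm (gint k g s x) \<le> (\<integral>z. norm (g (x + s *\<^sub>R z) *\<^sub>R k z) \<partial>lborel)"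
    unfolding gint_def by (rule integral_norm_bound)
  also have "\<dots> \<le> (\<integral>z. M * norm (k z) \<partial>lborel)"
    using g by (intro integral_mono integrable_norm gint_integrable[OF k g] integrable_mult_right k)
      (auto intro!: mult_right_mono)
  finally show ?thesis by simp
qed

lemma gint_tendsto:
  fixes k :: "'a::euclidean_space \<Rightarrow> 'b::{banach, second_countable_topology}"
  assumes k: "integrable lborel k" and g: "\<And>n. continuous_on UNIV (g n)" "\<And>n x. \<bar>g n x\<bar> \<le> M"
    and lim: "\<And>z. (\<lambda>n. g n (x n + s n *\<^sub>R z)) \<longlonglongrightarrow> g0 (x0 + s0 *\<^sub>R z)"
  shows "(\<lambda>n. gint k (g n) (s n) (x n)) \<longlonglongrightarrow> gint k g0 s0 x0"
  unfolding gint_def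
proof (rule integral_dominated_convergence[where w="\<lambda>z. M * norm (k z)"])
  show m: "(\<lambda>z. g n (x n + s n *\<^sub>R z) *\<^sub>R k z) \<in> borel_measurable lborel" for n
    using borel_measurable_integrable[OF gint_integrable[OF k g(1) g(2)]] .
  show l: "AE z in lborel. (\<lambda>n. g n (x n + s n *\<^sub>R z) *\<^sub>R k z) \<longlonglongrightarrow> g0 (x0 + s0 *\<^sub>R z) *\<^sub>R k z"
    by (intro AE_I2 tendsto_scaleR lim tendsto_const)
  show "(\<lambda>z. g0 (x0 + s0 *\<^sub>R z) *\<^sub>R k z) \<in> borel_measurable lborel"
    by (rule borel_measurable_LIMSEQ_metric[where f="\<lambda>n z. g n (x n + s n *\<^sub>R z) *\<^sub>R k z", OF m]) (intro tendsto_scaleR lim tendsto_const)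
  show "integrable lborel (\<lambda>z. M * norm (k z))" using k by simp
  show "AE z in lborel. norm (g n (x n + s n *\<^sub>R z) *\<^sub>R k z) \<le> M * norm (k z)" for n
    using g(2) by (auto intro!: mult_right_mono)
qed

lemma continuous_on_gint:
  fixes k :: "'a::euclidean_space \<Rightarrow> 'b::{banach, second_countable_topology}"
  assumes k: "integrable lborel k" and g: "continuous_on UNIV g" "\<And>x. \<bar>g x\<bar> \<le> M"
  shows "continuous_on UNIV (\<lambda>p. gint k g (fst p) (snd p))"
  unfolding continuous_on_sequentially
proof (intro ballI allI impI, elim conjE, unfold o_def)
  fix p :: "nat \<Rightarrow> real \<times> 'a" and q assume "p \<longlonglongrightarrow> q"
  then have l: "(\<lambda>n. fst (p n)) \<longlonglongrightarrow> fst q" "(\<lambda>n. snd (p n)) \<longlonglongrightarrow> snd q" by (auto intro: tendsto_intros)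
  show "(\<lambda>n. gint k g (fst (p n)) (snd (p n))) \<longlonglongrightarrow> gint k g (fst q) (snd q)"
  proof (rule gint_tendsto[OF k g])
    fix z
    have "isCont g (snd q + fst q *\<^sub>R z)" using g(1) by (simp add: continuous_on_eq_continuous_at)
    then show "(\<lambda>n. g (snd (p n) + fst (p n) *\<^sub>R z)) \<longlonglongrightarrow> g (snd q + fst q *\<^sub>R z)"
      by (rule isCont_tendsto_compose) (intro tendsto_intros l)
  qed
qed

lemma gint_continuous_s:
  fixes k :: "'a::euclidean_space \<Rightarrow> 'b::{banach, second_countable_topology}"
  assumes k: "integrable lborel k" and g: "continuous_on UNIV g" "\<And>x. \<bar>g x\<bar> \<le> M"
  shows "continuous_on S (\<lambda>s. gint k g s x)"
proof -
  have "continuous_on S (\<lambda>s. (s, x))" by (intro continuous_intros)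
  from continuous_on_compose2[OF continuous_on_gint[OF assms] this] show ?thesis by simp
qed

lemma gint_continuous_x:
  fixes k :: "'a::euclidean_space \<Rightarrow> 'b::{banach, second_countable_topology}"
  assumes k: "integrable lborel k" and g: "continuous_on UNIV g" "\<And>x. \<bar>g x\<bar> \<le> M"
  shows "continuous_on S (\<lambda>x. gint k g s x)"
proof -
  have "continuous_on S (\<lambda>x. (s, x))" by (intro continuous_intros)
  from continuous_on_compose2[OF continuous_on_gint[OF assms] this] show ?thesis by simp
qed

text \<open>Since \<open>g\<close> need not be differentiable, the substitution y = x + z moves the
  variable x into the kernel \<open>k (y - x)\<close>, and the derivative falls there; this is the
  origin of the minus sign.\<close>

lemma gint_has_derivative_1:
  fixes k :: "'a::euclidean_space \<Rightarrow> 'b::euclidean_space"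
  assumes dk: "\<And>w. (k has_derivative k' w) (at w)"
    and k: "\<And>w. norm (k w) \<le> C * exp (- (norm w)\<^sup>2 / 4)"
    and k': "\<And>w h. norm (k' w h) \<le> C * exp (- (norm w)\<^sup>2 / 4) * norm h"
    and cont: "\<And>h. continuous_on UNIV (\<lambda>w. k' w h)"
    and g: "continuous_on UNIV g" "\<And>x. \<bar>g x\<bar> \<le> M"
  shows "(gint k g 1 has_derivative (\<lambda>h. - gint (\<lambda>z. k' z h) g 1 x0)) (at x0)"
proof -
  have M: "0 \<le> M" using g(2)[of 0] by simp
  have C: "0 \<le> C" using order_trans[OF norm_ge_zero k[of 0]] by simp
  have ck: "continuous_on UNIV k"
    by (rule has_derivative_continuous_on) (rule has_derivative_at_withinI[OF dk])
  note [measurable] = borel_measurable_continuous_onI[OF g(1)] borel_measurable_continuous_onI[OF ck]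
    borel_measurable_continuous_onI[OF cont]
  have tr: "gint k g 1 x = (\<integral>y. g y *\<^sub>R k (y - x) \<partial>lborel)" for x
    using lborel_integral_translation[of "\<lambda>y. g y *\<^sub>R k (y - x)" x] by (simp add: gint_def)
  have tr': "gint (\<lambda>z. k' z h) g 1 x = (\<integral>y. g y *\<^sub>R k' (y - x) h \<partial>lborel)" for x h
    using lborel_integral_translation[of "\<lambda>y. g y *\<^sub>R k' (y - x) h" x] by (simp add: gint_def)
  \<comment> \<open>For w within distance 1 of y - x0 one has |y - x0|^2 \<le> 2 |w|^2 + 2, so exp
    (- |w|^2 / 4) is at most exp (1/4) exp (- |y - x0|^2 / 8). One majorant thus serves the whole
    unit ball around x0.\<close>
  define B where "B y = M * (C * exp (1 / 4) * exp (- (1/8) * (norm (y - x0))\<^sup>2))" for y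
  have Bint: "integrable lborel B"
    unfolding B_def
    using lborel_integrable_translation[OF integrable_exp_neg_norm_square[of "1/8"], of "- x0"]
    by (intro integrable_mult_right) (simp add: algebra_simps)
  have "((\<lambda>x. \<integral>y. g y *\<^sub>R k (y - x) \<partial>lborel) has_derivative (\<lambda>h. \<integral>y. g y *\<^sub>R (k' (y - x0) (- h)) \<partial>lborel)) (at x0)"
  proof (rule has_derivative_integral(1)[where e=1 and B=B])
    fix y
    have "((\<lambda>x. k (y - x)) has_derivative (\<lambda>h. k' (y - x0) (- h))) (at x0)"
      by (rule has_derivative_compose[OF _ dk]) (auto intro!: derivative_eq_intros)
    then show "((\<lambda>x. g y *\<^sub>R k (y - x)) has_derivative (\<lambda>h. g y *\<^sub>R (k' (y - x0) (- h)))) (at x0)"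
      by (intro derivative_intros)
  next
    fix x y assume x: "dist x x0 < 1"
    have "norm (k (y - x) - k (y - x0)) \<le> C * exp (1 / 4) * exp (- (1/8) * (norm (y - x0))\<^sup>2) * norm ((y - x) - (y - x0))"
    proof (rule differentiable_bound[of "ball (y - x0) 1"])
      fix w assume "w \<in> ball (y - x0) 1"
      then have "norm ((y - x0) - w) < 1" by (simp add: dist_norm)
      then have n: "norm (y - x0) \<le> norm w + 1" using norm_triangle_ineq2[of "y - x0" w] by linarith
      have "(norm (y - x0))\<^sup>2 \<le> (norm w + 1)\<^sup>2" using n by (rule power_mono) simp
      also have "\<dots> \<le> 2 * (norm w)\<^sup>2 + 2"
        using zero_le_power2[of "norm w - 1"] by (simp add: power2_eq_square algebra_simps)
      finally have "- (norm w)\<^sup>2 / 4 \<le> 1 / 4 + - (1/8) * (norm (y - x0))\<^sup>2" by simp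
      then have "exp (- (norm w)\<^sup>2 / 4) \<le> exp (1 / 4 + - (1/8) * (norm (y - x0))\<^sup>2)" by simp
      also have "\<dots> = exp (1 / 4) * exp (- (1/8) * (norm (y - x0))\<^sup>2)" by (rule exp_add)
      finally have le: "C * exp (- (norm w)\<^sup>2 / 4) \<le> C * exp (1 / 4) * exp (- (1/8) * (norm (y - x0))\<^sup>2)"
        using C by (simp add: mult_left_mono mult.assoc)
      show "onorm (k' w) \<le> C * exp (1 / 4) * exp (- (1/8) * (norm (y - x0))\<^sup>2)"
        by (rule onorm_bound) (use C in simp, rule order_trans[OF k'[of w] mult_right_mono[OF le norm_ge_zero]])
    qed (use x in \<open>auto intro: has_derivative_at_withinI dk simp: dist_norm norm_minus_commute\<close>)
    then have "\<bar>g y\<bar> * norm (k (y - x) - k (y - x0)) \<le> M * (C * exp (1 / 4) * exp (- (1/8) * (norm (y - x0))\<^sup>2) * norm (x - x0))"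
      using g(2)[of y] M by (intro mult_mono) (auto simp: norm_minus_commute)
    then show "norm (g y *\<^sub>R k (y - x) - g y *\<^sub>R k (y - x0)) \<le> B y * norm (x - x0)"
      by (simp add: B_def scaleR_diff_right[symmetric] mult.assoc)
  next
    fix x :: 'a
    have "integrable lborel (\<lambda>y. C * exp (- (norm (y - x))\<^sup>2 / 4))"
      using lborel_integrable_translation[OF integrable_exp_quarter, of "- x"]
      by (intro integrable_mult_right) (simp add: algebra_simps)
    from integrable_mult_right[OF this, of M]
    show "integrable lborel (\<lambda>y. g y *\<^sub>R k (y - x))"
      by (rule Bochner_Integration.integrable_bound)
         (use g(2) k M C in \<open>auto simp: abs_mult intro!: AE_I2 mult_mono\<close>)
  qed (use Bint in auto)
  moreover have "(\<integral>y. g y *\<^sub>R (k' (y - x0) (- h)) \<partial>lborel) = - gint (\<lambda>z. k' z h) g 1 x0" for h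
  proof -
    have "k' w (- h) = - k' w h" for w
      using has_derivative_bounded_linear[OF dk[of w]] by (simp add: linear_simps)
    then show ?thesis by (simp add: tr')
  qed
  ultimately show ?thesis by (simp add: tr[abs_def])
qed

text \<open>Replacing \<open>g\<close> by its dilation y -> g (s y) reduces scale s at the point x
  to scale 1 at the point x / s; the chain rule through x / s produces the factor 1 / s.\<close>

lemma gint_has_derivative:
  fixes k :: "'a::euclidean_space \<Rightarrow> 'b::euclidean_space"
  assumes dk: "\<And>w. (k has_derivative k' w) (at w)"
    and k: "\<And>w. norm (k w) \<le> C * exp (- (norm w)\<^sup>2 / 4)"
    and k': "\<And>w h. norm (k' w h) \<le> C * exp (- (norm w)\<^sup>2 / 4) * norm h"
    and cont: "\<And>h. continuous_on UNIV (\<lambda>w. k' w h)"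
    and g: "continuous_on UNIV g" "\<And>x. \<bar>g x\<bar> \<le> M" and s: "0 < s"
  shows "(gint k g s has_derivative (\<lambda>h. - (1 / s) *\<^sub>R gint (\<lambda>z. k' z h) g s x)) (at x)"
proof -
  have sc: "gint \<kappa> g s x = gint \<kappa> (\<lambda>y. g (s *\<^sub>R y)) 1 ((1 / s) *\<^sub>R x)" for \<kappa> :: "'a \<Rightarrow> 'b" and x
    using s by (simp add: gint_def algebra_simps)
  have "continuous_on UNIV (\<lambda>y. g (s *\<^sub>R y))"
    by (rule continuous_on_compose2[OF g(1)]) (auto intro!: continuous_intros)
  then have "(gint k (\<lambda>y. g (s *\<^sub>R y)) 1 has_derivative (\<lambda>h. - gint (\<lambda>z. k' z h) (\<lambda>y. g (s *\<^sub>R y)) 1 ((1 / s) *\<^sub>R x))) (at ((1 / s) *\<^sub>R x))"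
    by (intro gint_has_derivative_1[OF dk k k' cont, where M=M]) (use g in auto)
  moreover have "((\<lambda>x. (1 / s) *\<^sub>R x) has_derivative (\<lambda>h. (1 / s) *\<^sub>R h)) (at x)"
    by (auto intro!: derivative_eq_intros)
  ultimately have d: "((\<lambda>x. gint k (\<lambda>y. g (s *\<^sub>R y)) 1 ((1 / s) *\<^sub>R x)) has_derivative
      (\<lambda>h. - gint (\<lambda>z. k' z ((1 / s) *\<^sub>R h)) (\<lambda>y. g (s *\<^sub>R y)) 1 ((1 / s) *\<^sub>R x))) (at x)"
    by (rule has_derivative_compose[rotated])
  have "k' z ((1 / s) *\<^sub>R h) = (1 / s) *\<^sub>R k' z h" for z h
    using has_derivative_bounded_linear[OF dk[of z]] by (simp add: linear_simps)
  then have "gint (\<lambda>z. k' z ((1 / s) *\<^sub>R h)) G 1 X = (1 / s) *\<^sub>R gint (\<lambda>z. k' z h) G 1 X" for G X h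
    unfolding gint_def by (subst integral_scaleR_right[symmetric]) (simp add: ac_simps)
  with d show ?thesis by (simp add: sc[abs_def])
qed


text \<open>The Hessian of \<open>gauss\<close> at z applied to h: the gradient is -z times the
  density, and differentiating once more gives this field.\<close>

definition gauss_hess :: "'a::euclidean_space \<Rightarrow> 'a \<Rightarrow> 'a" where
  "gauss_hess h z = gauss z *\<^sub>R ((z \<bullet> h) *\<^sub>R z - h)"

text \<open>This is the heat semigroup at time $s^2/2$; with $s$ in place of the time, $\partial_s$ of the heat
  extension is $s$ times its Laplacian, and the gradient estimates lose only a factor $1/s$.\<close>
definition heat :: "real \<Rightarrow> ('a::euclidean_space \<Rightarrow> real) \<Rightarrow> 'a \<Rightarrow> real" where
  "heat s g x = gint gauss g s x"

text \<open>Both derivative formulas have the derivatives already shifted onto the kernel, so they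
  make sense for any bounded continuous \<open>g\<close>; each derivative costs a factor 1 /
  s.\<close>

definition heat_grad :: "real \<Rightarrow> ('a::euclidean_space \<Rightarrow> real) \<Rightarrow> 'a \<Rightarrow> 'a" where
  "heat_grad s g x = (1 / s) *\<^sub>R gint (\<lambda>z. gauss z *\<^sub>R z) g s x"

definition heat_hess :: "real \<Rightarrow> ('a::euclidean_space \<Rightarrow> real) \<Rightarrow> 'a \<Rightarrow> 'a \<Rightarrow> 'a" where
  "heat_hess s g x h = (1 / s\<^sup>2) *\<^sub>R gint (gauss_hess h) g s x"

lemma integrable_gvec: "integrable lborel (\<lambda>z::'a::euclidean_space. gauss z *\<^sub>R z)"
  by (rule Bochner_Integration.integrable_bound[OF integrable_poly_gauss[of 1]])
     (auto intro!: AE_I2 simp: abs_mult algebra_simps)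

lemma norm_gauss_hess_le: "norm (gauss_hess h z) \<le> (1 + norm z) ^ 2 * gauss z * norm h"
proof -
  have "norm ((z \<bullet> h) *\<^sub>R z - h) \<le> norm z * norm h * norm z + norm h"
    by (rule order_trans[OF norm_triangle_ineq4])
       (auto intro!: mult_right_mono Cauchy_Schwarz_ineq2)
  also have "\<dots> \<le> (1 + norm z) ^ 2 * norm h"
    by (simp add: power2_eq_square algebra_simps)
  finally have "gauss z * norm ((z \<bullet> h) *\<^sub>R z - h) \<le> gauss z * ((1 + norm z) ^ 2 * norm h)"
    by (rule mult_left_mono) simp
  then show ?thesis by (simp add: gauss_hess_def ac_simps)
qed

lemma continuous_on_gauss_hess: "continuous_on S (gauss_hess h)"
  unfolding gauss_hess_def[abs_def] by (intro continuous_intros)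

lemma integrable_gauss_hess: "integrable lborel (gauss_hess h)"
proof (rule Bochner_Integration.integrable_bound[OF integrable_mult_left[OF integrable_poly_gauss[of 2], of "norm h"]])
  show "gauss_hess h \<in> borel_measurable lborel"
    using borel_measurable_continuous_onI[OF continuous_on_gauss_hess] by simp
  show "AE x in lborel. norm (gauss_hess h x) \<le> norm ((1 + norm x)\<^sup>2 * gauss x * norm h)"
    using norm_gauss_hess_le by (auto simp: abs_mult)
qed

lemma gvec_has_derivative:
  "((\<lambda>z. gauss z *\<^sub>R z) has_derivative (\<lambda>h. - gauss_hess h w)) (at w)"
  by (auto intro!: derivative_eq_intros gauss_has_derivative simp: gauss_hess_def fun_eq_iff algebra_simps)

lemma gint_gvec_has_derivative:
  assumes g: "continuous_on UNIV g" "\<And>x. \<bar>g x\<bar> \<le> M" and s: "0 < s"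
  shows "(gint (\<lambda>z. gauss z *\<^sub>R z) g s has_derivative (\<lambda>h. (1 / s) *\<^sub>R gint (gauss_hess h) g s x)) (at x)"
proof -
  obtain C where C: "0 \<le> C" "\<And>z::'a. (1 + norm z) ^ 2 * gauss z \<le> C * exp (- (norm z)\<^sup>2 / 4)"
    by (rule poly_gauss_le[of 2]) blast
  have "norm (gauss z *\<^sub>R z) \<le> C * exp (- (norm z)\<^sup>2 / 4)" for z :: 'a
  proof -
    have "norm (gauss z *\<^sub>R z) \<le> gauss z * (1 + norm z) ^ 2"
      by (auto intro!: mult_left_mono simp: power2_eq_square algebra_simps)
    then show ?thesis using C(2)[of z] by (simp add: mult.commute)
  qed
  moreover have "norm (- gauss_hess h w) \<le> C * exp (- (norm w)\<^sup>2 / 4) * norm h" for w h :: 'a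
    using order_trans[OF norm_gauss_hess_le[of h w] mult_right_mono[OF C(2)[of w], of "norm h"]] by simp
  ultimately have "(gint (\<lambda>z. gauss z *\<^sub>R z) g s has_derivative (\<lambda>h. - (1 / s) *\<^sub>R gint (\<lambda>z. - gauss_hess h z) g s x)) (at x)"
    by (intro gint_has_derivative[OF gvec_has_derivative _ _ _ g s])
       (auto intro!: continuous_intros continuous_on_gauss_hess)
  then show ?thesis by (simp add: gint_def)
qed

lemma heat_has_derivative:
  assumes g: "continuous_on UNIV g" "\<And>x. \<bar>g x\<bar> \<le> M" and s: "0 < s"
  shows "(heat s g has_derivative (\<lambda>h. heat_grad s g x \<bullet> h)) (at x)"
proof -
  obtain C where C: "0 \<le> C" "\<And>z::'a. (1 + norm z) ^ 1 * gauss z \<le> C * exp (- (norm z)\<^sup>2 / 4)"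
    by (rule poly_gauss_le[of 1]) blast
  have "norm (gauss z) \<le> C * exp (- (norm z)\<^sup>2 / 4)" for z :: 'a
  proof -
    have "1 * gauss z \<le> (1 + norm z) ^ 1 * gauss z" by (intro mult_right_mono) auto
    then show ?thesis using C(2)[of z] by simp
  qed
  moreover have "norm (- (w \<bullet> h) * gauss w) \<le> C * exp (- (norm w)\<^sup>2 / 4) * norm h" for w h :: 'a
  proof -
    have "norm (- (w \<bullet> h) * gauss w) \<le> norm w * norm h * gauss w"
      by (auto simp: abs_mult intro!: mult_right_mono Cauchy_Schwarz_ineq2)
    also have "\<dots> \<le> ((1 + norm w) ^ 1 * gauss w) * norm h"
      by (simp add: algebra_simps)
    also have "\<dots> \<le> C * exp (- (norm w)\<^sup>2 / 4) * norm h"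
      using C(2)[of w] by (rule mult_right_mono) simp
    finally show ?thesis .
  qed
  ultimately have d: "(gint gauss g s has_derivative (\<lambda>h. - (1 / s) *\<^sub>R gint (\<lambda>z. - (z \<bullet> h) * gauss z) g s x)) (at x)"
    by (intro gint_has_derivative[OF gauss_has_derivative _ _ _ g s]) (auto intro!: continuous_intros)
  have "gint (\<lambda>z. gauss z *\<^sub>R z) g s x \<bullet> h = gint (\<lambda>z. (z \<bullet> h) * gauss z) g s x" for h
  proof -
    have "gint (\<lambda>z. gauss z *\<^sub>R z) g s x \<bullet> h = (\<integral>z. (g (x + s *\<^sub>R z) *\<^sub>R (gauss z *\<^sub>R z)) \<bullet> h \<partial>lborel)"
      unfolding gint_def by (rule integral_inner_left[symmetric]) (rule gint_integrable[OF integrable_gvec g])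
    also have "\<dots> = gint (\<lambda>z. (z \<bullet> h) * gauss z) g s x"
      unfolding gint_def by (rule Bochner_Integration.integral_cong) (auto simp: ac_simps)
    finally show ?thesis .
  qed
  moreover have "gint (\<lambda>z. - (z \<bullet> h) * gauss z) g s x = - gint (\<lambda>z. (z \<bullet> h) * gauss z) g s x" for h
    by (simp add: gint_def)
  moreover have "heat s g = gint gauss g s" by (simp add: heat_def fun_eq_iff)
  ultimately show ?thesis using d by (simp add: heat_grad_def)
qed

lemma heat_grad_has_derivative:
  assumes g: "continuous_on UNIV g" "\<And>x. \<bar>g x\<bar> \<le> M" and s: "0 < s"
  shows "(heat_grad s g has_derivative heat_hess s g x) (at x)"
proof -
  have "((\<lambda>x. (1 / s) *\<^sub>R gint (\<lambda>z. gauss z *\<^sub>R z) g s x) has_derivative (\<lambda>h. (1 / s) *\<^sub>R ((1 / s) *\<^sub>R gint (gauss_hess h) g s x))) (at x)"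
    by (intro derivative_intros gint_gvec_has_derivative[OF g s])
  then show ?thesis
    by (simp add: heat_grad_def[abs_def] heat_hess_def[abs_def] power2_eq_square)
qed

lemma heat_abs_le:
  assumes g: "continuous_on UNIV g" "\<And>x. \<bar>g x\<bar> \<le> M"
  shows "\<bar>heat s g x\<bar> \<le> M"
  using gint_norm_le[OF integrable_gauss g, of s x] integral_gauss[where 'a='a] by (simp add: heat_def)

definition grad_const :: "'a::euclidean_space itself \<Rightarrow> real" where
  "grad_const _ = (\<integral>z. norm (gauss z *\<^sub>R (z::'a)) \<partial>lborel)"

lemma grad_const_nonneg: "0 \<le> grad_const TYPE('a::euclidean_space)"
  by (simp add: grad_const_def)

lemma heat_grad_norm_le:
  fixes x :: "'a::euclidean_space"
  assumes g: "continuous_on UNIV g" "\<And>x. \<bar>g x\<bar> \<le> M" and s: "0 < s"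
  shows "norm (heat_grad s g x) \<le> M * grad_const TYPE('a) / s"
  using gint_norm_le[OF integrable_gvec g, of s x] s
  by (simp add: heat_grad_def grad_const_def divide_right_mono)

text \<open>The plain bound of the Hessian uses only the second power. The third is there for the
  Hoelder bound, where |z|^a \<le> 1 + |z| costs one more power, so that a single constant serves
  both.\<close>

definition hess_const :: "'a::euclidean_space itself \<Rightarrow> real" where
  "hess_const _ = (\<integral>z. (1 + norm (z::'a)) ^ 3 * gauss z \<partial>lborel)"

lemma hess_const_nonneg: "0 \<le> hess_const TYPE('a::euclidean_space)"
  by (simp add: hess_const_def)

lemma norm_gauss_hess_le3: "norm (gauss_hess h z) \<le> (1 + norm z) ^ 3 * gauss z * norm h"
proof -
  have "(1 + norm z) ^ 2 \<le> (1 + norm z) ^ 3" by (rule power_increasing) auto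
  then have "(1 + norm z) ^ 2 * gauss z * norm h \<le> (1 + norm z) ^ 3 * gauss z * norm h"
    by (intro mult_right_mono) auto
  then show ?thesis using norm_gauss_hess_le[of h z] by linarith
qed

lemma heat_hess_norm_le:
  fixes x :: "'a::euclidean_space"
  assumes g: "continuous_on UNIV g" "\<And>x. \<bar>g x\<bar> \<le> M" and s: "0 < s"
  shows "norm (heat_hess s g x h) \<le> M * hess_const TYPE('a) * norm h / s\<^sup>2"
proof -
  have M: "0 \<le> M" using g(2)[of 0] by simp
  have "(\<integral>z. norm (gauss_hess h (z::'a)) \<partial>lborel) \<le> (\<integral>z. (1 + norm (z::'a)) ^ 3 * gauss z * norm h \<partial>lborel)"
    by (intro integral_mono integrable_norm integrable_gauss_hess integrable_mult_left integrable_poly_gauss norm_gauss_hess_le3)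
  then have "norm (gint (gauss_hess h) g s x) \<le> M * (hess_const TYPE('a) * norm h)"
    using gint_norm_le[OF integrable_gauss_hess g, of h s x] M
    by (auto simp: hess_const_def intro: order_trans mult_left_mono)
  then show ?thesis using s by (simp add: heat_hess_def divide_right_mono mult.assoc)
qed

text \<open>For g = 1 the Gaussian averages do not depend on x, so their derivative, an average of
  the Hessian kernel, vanishes.\<close>

lemma integral_gauss_hess: "(\<integral>z. gauss_hess h z \<partial>lborel) = 0"
proof -
  let ?g = "\<lambda>_::'a. 1 :: real"
  have "(gint (\<lambda>z. gauss z *\<^sub>R z) ?g 1 has_derivative (\<lambda>h. (1 / 1) *\<^sub>R gint (gauss_hess h) ?g 1 0)) (at 0)"
    by (rule gint_gvec_has_derivative[where M=1]) auto
  moreover have "(gint (\<lambda>z. gauss z *\<^sub>R z) ?g 1 has_derivative (\<lambda>h. 0)) (at 0)"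
    by (simp add: gint_def[abs_def])
  ultimately have "(\<lambda>h. (1 / 1) *\<^sub>R gint (gauss_hess h) ?g 1 0) = (\<lambda>h. 0)"
    by (rule has_derivative_unique)
  from fun_cong[OF this, of h] show ?thesis by (simp add: gint_def)
qed

text \<open>The kernel has mean zero, so the constant g x may be subtracted from g before taking
  norms. The Hoelder bound on the difference gains s^a over the plain estimate, and s^(a-2) is
  integrable near 0 against s ds whereas s^(-2) is not.\<close>

lemma heat_hess_holder:
  fixes x :: "'a::euclidean_space"
  assumes g: "continuous_on UNIV g" "\<And>x. \<bar>g x\<bar> \<le> M" and s: "0 < s"
    and a: "0 < a" "a \<le> 1" and A: "0 \<le> A" "\<And>y. \<bar>g y - g x\<bar> \<le> A * norm (y - x) powr a"
  shows "norm (heat_hess s g x h) \<le> A * hess_const TYPE('a) * norm h * s powr (a - 2)"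
proof -
  have int1: "integrable lborel (\<lambda>z. g (x + s *\<^sub>R z) *\<^sub>R gauss_hess h z)"
    by (rule gint_integrable[OF integrable_gauss_hess g])
  have int2: "integrable lborel (\<lambda>z. (g (x + s *\<^sub>R z) - g x) *\<^sub>R gauss_hess h z)"
    using Bochner_Integration.integrable_diff[OF int1 integrable_scaleR_right[OF integrable_gauss_hess[of h], of "g x"]]
    by (simp add: scaleR_diff_left)
  have "gint (gauss_hess h) g s x = (\<integral>z. g (x + s *\<^sub>R z) *\<^sub>R gauss_hess h z \<partial>lborel) - (\<integral>z. g x *\<^sub>R gauss_hess h z \<partial>lborel)"
    by (simp add: gint_def integral_gauss_hess)
  also have "\<dots> = (\<integral>z. (g (x + s *\<^sub>R z) - g x) *\<^sub>R gauss_hess h z \<partial>lborel)"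
    using int1 integrable_gauss_hess by (subst Bochner_Integration.integral_diff[symmetric]) (auto simp: scaleR_diff_left)
  finally have eq: "gint (gauss_hess h) g s x = (\<integral>z. (g (x + s *\<^sub>R z) - g x) *\<^sub>R gauss_hess h z \<partial>lborel)" .
  have "norm (gint (gauss_hess h) g s x) \<le> (\<integral>z. norm ((g (x + s *\<^sub>R z) - g x) *\<^sub>R gauss_hess h z) \<partial>lborel)"
    unfolding eq by (rule integral_norm_bound)
  also have "\<dots> \<le> (\<integral>z. A * s powr a * norm h * ((1 + norm (z::'a)) ^ 3 * gauss z) \<partial>lborel)"
  proof (intro integral_mono integrable_norm int2 integrable_mult_right integrable_poly_gauss)
    fix z :: 'a
    have "norm z powr a \<le> (1 + norm z) powr a" using a by (intro powr_mono2) auto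
    also have "\<dots> \<le> (1 + norm z) powr 1" using a by (intro powr_mono) auto
    finally have z: "norm z powr a \<le> 1 + norm z" by (simp add: powr_one)
    have "\<bar>g (x + s *\<^sub>R z) - g x\<bar> \<le> A * (s powr a * norm z powr a)"
      using A(2)[of "x + s *\<^sub>R z"] s by (simp add: powr_mult)
    also have "\<dots> \<le> A * (s powr a * (1 + norm z))"
      using z A(1) by (intro mult_left_mono) auto
    finally have 1: "\<bar>g (x + s *\<^sub>R z) - g x\<bar> \<le> A * (s powr a * (1 + norm z))" .
    have "norm ((g (x + s *\<^sub>R z) - g x) *\<^sub>R gauss_hess h z) \<le> (A * (s powr a * (1 + norm z))) * ((1 + norm z) ^ 2 * gauss z * norm h)"
      unfolding norm_scaleR by (intro mult_mono 1 norm_gauss_hess_le) (use A in auto)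
    also have "\<dots> = A * s powr a * norm h * ((1 + norm z) ^ 3 * gauss z)"
      by (simp add: power2_eq_square power3_eq_cube ac_simps)
    finally show "norm ((g (x + s *\<^sub>R z) - g x) *\<^sub>R gauss_hess h z) \<le> A * s powr a * norm h * ((1 + norm z) ^ 3 * gauss z)" .
  qed
  also have "\<dots> = A * s powr a * norm h * hess_const TYPE('a)" by (simp add: hess_const_def)
  finally have "norm (gint (gauss_hess h) g s x) / s\<^sup>2 \<le> A * s powr a * norm h * hess_const TYPE('a) / s\<^sup>2"
    by (rule divide_right_mono) simp
  moreover have "s powr (a - 2) = s powr a / s\<^sup>2" using s by (simp add: powr_diff powr_numeral)
  ultimately show ?thesis by (simp add: heat_hess_def ac_simps)
qed

lemma heat_tendsto_0:
  assumes g: "continuous_on UNIV g" "\<And>x. \<bar>g x\<bar> \<le> M"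
  shows "((\<lambda>s. heat s g x) \<longlongrightarrow> g x) (at_right 0)"
proof -
  have "continuous_on UNIV (\<lambda>s. gint gauss g s x)" by (rule gint_continuous_s[OF integrable_gauss g])
  then have "((\<lambda>s. gint gauss g s x) \<longlongrightarrow> gint gauss g 0 x) (at 0)"
    by (simp add: continuous_on_eq_continuous_at isCont_def)
  then have "((\<lambda>s. gint gauss g s x) \<longlongrightarrow> gint gauss g 0 x) (at_right 0)"
    by (rule tendsto_within_subset) auto
  then show ?thesis using integral_gauss[where 'a='a] by (simp add: heat_def[abs_def] gint_def)
qed

lemma trace_heat_hess:
  fixes x :: "'a::euclidean_space"
  assumes g: "continuous_on UNIV g" "\<And>x. \<bar>g x\<bar> \<le> M"
  shows "(\<Sum>b\<in>Basis. heat_hess s g x b \<bullet> b) = (1 / s\<^sup>2) * gint (\<lambda>z. ((norm z)\<^sup>2 - DIM('a)) * gauss z) g s x"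
proof -
  have int: "integrable lborel (\<lambda>z. g (x + s *\<^sub>R z) *\<^sub>R gauss_hess b z)" for b
    by (rule gint_integrable[OF integrable_gauss_hess g])
  have "(\<Sum>b\<in>Basis. gint (gauss_hess b) g s x \<bullet> b) = (\<Sum>b\<in>Basis. (\<integral>z. (g (x + s *\<^sub>R z) *\<^sub>R gauss_hess b z) \<bullet> b \<partial>lborel))"
    unfolding gint_def using int by (intro sum.cong refl integral_inner_left[symmetric]) auto
  also have "\<dots> = (\<integral>z. (\<Sum>b\<in>Basis. (g (x + s *\<^sub>R z) *\<^sub>R gauss_hess b z) \<bullet> b) \<partial>lborel)"
    using int by (intro Bochner_Integration.integral_sum[symmetric] integrable_inner_left) auto
  also have "\<dots> = gint (\<lambda>z. ((norm z)\<^sup>2 - DIM('a)) * gauss z) g s x"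
    unfolding gint_def
  proof (rule Bochner_Integration.integral_cong[OF refl])
    fix z :: 'a
    have "(\<Sum>b\<in>Basis. (g (x + s *\<^sub>R z) *\<^sub>R gauss_hess b z) \<bullet> b)
        = g (x + s *\<^sub>R z) * gauss z * (\<Sum>b\<in>Basis. (z \<bullet> b) * (z \<bullet> b) - b \<bullet> b)"
      by (simp add: gauss_hess_def inner_diff_left sum_distrib_left ac_simps)
    also have "(\<Sum>b\<in>Basis. (z \<bullet> b) * (z \<bullet> b) - b \<bullet> b) = (norm z)\<^sup>2 - DIM('a)"
      by (simp add: sum_subtractf power2_norm_eq_inner euclidean_inner[of z z])
    finally show "(\<Sum>b\<in>Basis. (g (x + s *\<^sub>R z) *\<^sub>R gauss_hess b z) \<bullet> b) = g (x + s *\<^sub>R z) *\<^sub>R (((norm z)\<^sup>2 - DIM('a)) * gauss z)"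
      by (simp add: ac_simps)
  qed
  finally show ?thesis by (simp add: heat_hess_def sum_divide_distrib[symmetric])
qed

text \<open>As with the space derivatives, the scale is moved from g to the kernel: \<kappa> t w is
  t^(-N) gauss (w / t). Its t-derivative carries the factor |w|^2 / t^3 - N / t, which after
  rescaling is the trace of the Hessian kernel times 1 / t.\<close>

lemma heat_has_real_derivative_s:
  fixes x :: "'a::euclidean_space"
  assumes g: "continuous_on UNIV g" "\<And>x. \<bar>g x\<bar> \<le> M" and s: "0 < s"
  shows "((\<lambda>s. heat s g x) has_real_derivative s * (\<Sum>b\<in>Basis. heat_hess s g x b \<bullet> b)) (at s)"
proof -
  let ?N = "DIM('a)"
  define c where "c = (\<integral>w. exp (- (norm (w::'a))\<^sup>2 / 2) \<partial>lborel)"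
  have c: "c > 0" unfolding c_def by (rule gauss_mass_pos)
  have M: "0 \<le> M" using g(2)[of 0] by simp
  have [measurable]: "g \<in> borel_measurable borel" by (rule borel_measurable_continuous_onI[OF g(1)])
  define \<kappa> where "\<kappa> t w = exp (- (norm (w::'a))\<^sup>2 / (2 * t\<^sup>2)) / (c * t ^ ?N)" for t w
  have \<kappa>: "\<kappa> t w = gauss ((1 / t) *\<^sub>R w) / t ^ ?N" if "t > 0" for t w
    using that by (simp add: \<kappa>_def gauss_def c_def power_mult_distrib field_simps)
  define \<kappa>' where "\<kappa>' t w = \<kappa> t w * ((norm w)\<^sup>2 / t ^ 3 - ?N / t)" for t w
  have d\<kappa>: "((\<lambda>t. \<kappa> t w) has_real_derivative \<kappa>' t w) (at t)" if t: "t > 0" for t w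
  proof -
    have e1: "((\<lambda>t. exp (- (norm w)\<^sup>2 / (2 * t\<^sup>2))) has_real_derivative exp (- (norm w)\<^sup>2 / (2 * t\<^sup>2)) * ((norm w)\<^sup>2 / t ^ 3)) (at t)"
      using t by (auto intro!: derivative_eq_intros simp: field_simps power2_eq_square power3_eq_cube)
    have e2: "((\<lambda>t. 1 / (c * t ^ ?N)) has_real_derivative (1 / (c * t ^ ?N)) * (- ?N / t)) (at t)"
    proof -
      obtain k where k: "?N = Suc k" using DIM_positive[where 'a='a] by (cases "?N") auto
      have "((\<lambda>t. c * t ^ Suc k) has_real_derivative c * (Suc k * t ^ k)) (at t)"
        using DERIV_cmult[OF DERIV_pow[of "Suc k" t], of c] by simp
      from DERIV_inverse'[OF this]
      have inv: "((\<lambda>t. inverse (c * t ^ Suc k)) has_real_derivative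
          - (inverse (c * t ^ Suc k) * (c * (Suc k * t ^ k)) * inverse (c * t ^ Suc k))) (at t)"
        using t c by simp
      show ?thesis unfolding k
        by (rule DERIV_cong[OF inv[unfolded inverse_eq_divide]])
           (use t c in \<open>simp add: field_simps\<close>)
    qed
    have "((\<lambda>t. exp (- (norm w)\<^sup>2 / (2 * t\<^sup>2)) * (1 / (c * t ^ ?N))) has_real_derivative
       exp (- (norm w)\<^sup>2 / (2 * t\<^sup>2)) * ((norm w)\<^sup>2 / t ^ 3) * (1 / (c * t ^ ?N)) + (1 / (c * t ^ ?N)) * (- ?N / t) * exp (- (norm w)\<^sup>2 / (2 * t\<^sup>2))) (at t)"
      by (rule DERIV_mult'[OF e1 e2, THEN DERIV_cong]) simp
    moreover have "exp (- (norm w)\<^sup>2 / (2 * t\<^sup>2)) * ((norm w)\<^sup>2 / t ^ 3) * (1 / (c * t ^ ?N)) + (1 / (c * t ^ ?N)) * (- ?N / t) * exp (- (norm w)\<^sup>2 / (2 * t\<^sup>2)) = \<kappa>' t w"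
      using t c by (simp add: \<kappa>'_def \<kappa>_def field_simps)
    ultimately show ?thesis by (simp add: \<kappa>_def)
  qed
  have meas\<kappa> [measurable]: "(\<lambda>w. \<kappa> t w) \<in> borel_measurable borel" for t
    unfolding \<kappa>_def by measurable
  have scale: "gint (\<lambda>z. q z * gauss z) g t x = (\<integral>w. g (x + w) * (q ((1 / t) *\<^sub>R w) * \<kappa> t w) \<partial>lborel)"
    if t: "t > 0" and q: "q \<in> borel_measurable borel" for t and q :: "'a \<Rightarrow> real"
  proof -
    note [measurable] = q
    have "gint (\<lambda>z. q z * gauss z) g t x = (\<integral>z. (\<lambda>w. g (x + w) * (q ((1 / t) *\<^sub>R w) * gauss ((1 / t) *\<^sub>R w))) (t *\<^sub>R z) \<partial>lborel)"
      using t by (simp add: gint_def)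
    also have "\<dots> = (1 / t ^ ?N) *\<^sub>R (\<integral>w. g (x + w) * (q ((1 / t) *\<^sub>R w) * gauss ((1 / t) *\<^sub>R w)) \<partial>lborel)"
      by (rule lborel_integral_scale[OF _ t]) measurable
    also have "\<dots> = (\<integral>w. g (x + w) * (q ((1 / t) *\<^sub>R w) * \<kappa> t w) \<partial>lborel)"
      using t by (subst integral_scaleR_right[symmetric]) (simp add: \<kappa> ac_simps)
    finally show ?thesis .
  qed
  \<comment> \<open>The majorant must hold for all t between s/2 and 3s/2. The upper end gives 1 /
    (2 t^2) \<ge> 2 / (9 s^2), the exponent a; the lower end gives the factors 8 / s^3, 2 N / s and
    (s/2)^N in \<open>K\<close>.\<close>
  define a where "a = 2 / (9 * s\<^sup>2)"
  define K where "K = M * ((8 / s ^ 3 + 2 * ?N / s) * (1 / (c * (s / 2) ^ ?N)))"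
  have a: "a > 0" using s by (simp add: a_def)
  have \<kappa>'_le: "\<bar>\<kappa>' t w\<bar> \<le> (8 / s ^ 3 + 2 * ?N / s) * (1 / (c * (s / 2) ^ ?N)) * ((1 + norm w) ^ 2 * exp (- a * (norm w)\<^sup>2))"
    if t: "s / 2 \<le> t" "t \<le> 3 * s / 2" for t w
  proof -
    have tp: "t > 0" using t s by linarith
    have "t\<^sup>2 \<le> (3 * s / 2)\<^sup>2" using t tp by (intro power_mono) auto
    then have "2 * t\<^sup>2 \<le> 9 * s\<^sup>2 / 2" by (simp add: power_mult_distrib power_divide)
    then have "(norm w)\<^sup>2 / (9 * s\<^sup>2 / 2) \<le> (norm w)\<^sup>2 / (2 * t\<^sup>2)"
      using tp s by (intro divide_left_mono mult_pos_pos) auto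
    then have E: "exp (- (norm w)\<^sup>2 / (2 * t\<^sup>2)) \<le> exp (- a * (norm w)\<^sup>2)" by (simp add: a_def mult.commute)
    have "c * (s / 2) ^ ?N \<le> c * t ^ ?N" using t s c by (intro mult_left_mono power_mono) auto
    then have "1 / (c * t ^ ?N) \<le> 1 / (c * (s / 2) ^ ?N)" using c s tp by (intro divide_left_mono) auto
    then have k1: "\<kappa> t w \<le> exp (- a * (norm w)\<^sup>2) * (1 / (c * (s / 2) ^ ?N))"
      using E c tp unfolding \<kappa>_def divide_inverse[of "exp _"] by (intro mult_mono) (auto simp: field_simps)
    have k0: "0 \<le> \<kappa> t w" using c tp by (simp add: \<kappa>_def)
    have t3: "1 / t ^ 3 \<le> 8 / s ^ 3"
    proof -
      have "(s / 2) ^ 3 \<le> t ^ 3" using t s by (intro power_mono) auto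
      then have "1 / t ^ 3 \<le> 1 / (s / 2) ^ 3" using s tp by (intro divide_left_mono) auto
      then show ?thesis by (simp add: power_divide)
    qed
    have t1: "1 / t \<le> 2 / s" using t s tp by (simp add: field_simps)
    have "\<bar>(norm w)\<^sup>2 / t ^ 3 - ?N / t\<bar> \<le> (norm w)\<^sup>2 * (1 / t ^ 3) + ?N * (1 / t)"
      using tp by (intro order_trans[OF abs_triangle_ineq4]) auto
    also have "\<dots> \<le> (norm w)\<^sup>2 * (8 / s ^ 3) + ?N * (2 / s)"
      by (intro add_mono mult_left_mono t3 t1) auto
    also have "\<dots> \<le> (1 + norm w) ^ 2 * (8 / s ^ 3) + (1 + norm w) ^ 2 * (?N * (2 / s))"
    proof (intro add_mono mult_right_mono)
      have "1 ^ 2 \<le> (1 + norm w) ^ 2" by (rule power_mono) auto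
      then have "1 * (?N * (2 / s)) \<le> (1 + norm w) ^ 2 * (?N * (2 / s))" using s by (intro mult_right_mono) auto
      then show "?N * (2 / s) \<le> (1 + norm w) ^ 2 * (?N * (2 / s))" by simp
    qed (use s in \<open>auto simp: power2_eq_square algebra_simps\<close>)
    also have "\<dots> = (8 / s ^ 3 + 2 * ?N / s) * (1 + norm w) ^ 2" by (simp add: algebra_simps)
    finally have q: "\<bar>(norm w)\<^sup>2 / t ^ 3 - ?N / t\<bar> \<le> (8 / s ^ 3 + 2 * ?N / s) * (1 + norm w) ^ 2" .
    have "\<bar>\<kappa>' t w\<bar> = \<kappa> t w * \<bar>(norm w)\<^sup>2 / t ^ 3 - ?N / t\<bar>" using k0 by (simp add: \<kappa>'_def abs_mult)
    also have "\<dots> \<le> (exp (- a * (norm w)\<^sup>2) * (1 / (c * (s / 2) ^ ?N))) * ((8 / s ^ 3 + 2 * ?N / s) * (1 + norm w) ^ 2)"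
      using c s by (intro mult_mono k1 q) auto
    finally show ?thesis by (simp add: ac_simps)
  qed
  have "((\<lambda>t. \<integral>w. g (x + w) * \<kappa> t w \<partial>lborel) has_derivative (\<lambda>h. \<integral>w. h * (g (x + w) * \<kappa>' s w) \<partial>lborel)) (at s)"
  proof (rule has_derivative_integral(1)[where e="s / 2" and B="\<lambda>w. K * ((1 + norm w) ^ 2 * exp (- a * (norm w)\<^sup>2))"])
    show "((\<lambda>t. g (x + w) * \<kappa> t w) has_derivative (\<lambda>h. h * (g (x + w) * \<kappa>' s w))) (at s)" for w
      using DERIV_cmult[OF d\<kappa>[OF s], of "g (x + w)" w] by (simp add: has_field_derivative_def mult_commute_abs)
    show "norm (g (x + w) * \<kappa> t w - g (x + w) * \<kappa> s w) \<le> K * ((1 + norm w) ^ 2 * exp (- a * (norm w)\<^sup>2)) * norm (t - s)"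
      if t: "dist t s < s / 2" for t w
    proof -
      have tb: "s / 2 \<le> t" "t \<le> 3 * s / 2" using t unfolding dist_real_def by linarith+
      have "norm (\<kappa> t w - \<kappa> s w) \<le> (8 / s ^ 3 + 2 * ?N / s) * (1 / (c * (s / 2) ^ ?N)) * ((1 + norm w) ^ 2 * exp (- a * (norm w)\<^sup>2)) * norm (t - s)"
      proof (rule field_differentiable_bound[of "{s / 2 .. 3 * s / 2}"])
        show "((\<lambda>t. \<kappa> t w) has_field_derivative \<kappa>' r w) (at r within {s / 2 .. 3 * s / 2})" if "r \<in> {s / 2 .. 3 * s / 2}" for r
          using that s by (intro has_field_derivative_at_within[OF d\<kappa>]) auto
      qed (use tb s \<kappa>'_le in auto)
      then have "\<bar>g (x + w)\<bar> * norm (\<kappa> t w - \<kappa> s w) \<le> M * ((8 / s ^ 3 + 2 * ?N / s) * (1 / (c * (s / 2) ^ ?N)) * ((1 + norm w) ^ 2 * exp (- a * (norm w)\<^sup>2)) * norm (t - s))"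
        using M g(2) by (intro mult_mono) auto
      moreover have "norm (g (x + w) * \<kappa> t w - g (x + w) * \<kappa> s w) = \<bar>g (x + w)\<bar> * norm (\<kappa> t w - \<kappa> s w)"
        by (simp add: right_diff_distrib[symmetric] abs_mult)
      ultimately show ?thesis unfolding K_def by (simp only: mult.assoc)
    qed
    show "integrable lborel (\<lambda>w. g (x + w) * \<kappa> t w)" if t: "dist t s < s / 2" for t
    proof -
      have tp: "t > 0" using t s by (auto simp: dist_real_def abs_if split: if_splits)
      have "integrable lborel (\<lambda>w::'a. M / (c * t ^ ?N) * exp (- (1 / (2 * t\<^sup>2)) * (norm w)\<^sup>2))"
        using tp by (intro integrable_mult_right integrable_exp_neg_norm_square) auto
      then show ?thesis
      proof (rule Bochner_Integration.integrable_bound)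
        have "\<bar>g (x + w)\<bar> * \<kappa> t w \<le> M * \<kappa> t w" for w
          using g(2) c tp by (intro mult_right_mono) (auto simp: \<kappa>_def)
        then show "AE w in lborel. norm (g (x + w) * \<kappa> t w) \<le> norm (M / (c * t ^ ?N) * exp (- (1 / (2 * t\<^sup>2)) * (norm w)\<^sup>2))"
          using c tp M by (auto simp: abs_mult \<kappa>_def)
      qed measurable
    qed
    show "integrable lborel (\<lambda>w::'a. K * ((1 + norm w) ^ 2 * exp (- a * (norm w)\<^sup>2)))"
      by (intro integrable_mult_right integrable_poly_exp_neg_norm_square a)
    show "(\<lambda>w. h * (g (x + w) * \<kappa>' s w)) \<in> borel_measurable lborel" for h
      unfolding \<kappa>'_def by measurable
  qed (use s in auto)
  then have d: "((\<lambda>t. \<integral>w. g (x + w) * \<kappa> t w \<partial>lborel) has_real_derivative (\<integral>w. g (x + w) * \<kappa>' s w \<partial>lborel)) (at s)"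
    by (simp add: has_field_derivative_def mult_commute_abs)
  have heat: "heat t g x = (\<integral>w. g (x + w) * \<kappa> t w \<partial>lborel)" if "t > 0" for t
    using scale[OF that, of "\<lambda>_. 1"] by (simp add: heat_def)
  have "(\<integral>w. g (x + w) * \<kappa>' s w \<partial>lborel) = (1 / s) * (\<integral>w. g (x + w) * (((norm ((1 / s) *\<^sub>R w))\<^sup>2 - ?N) * \<kappa> s w) \<partial>lborel)"
    using s by (subst integral_mult_right_zero[symmetric])
      (auto intro!: Bochner_Integration.integral_cong simp: \<kappa>'_def field_simps power2_eq_square power3_eq_cube)
  also have "\<dots> = (1 / s) * gint (\<lambda>z. ((norm z)\<^sup>2 - ?N) * gauss z) g s x"
    using scale[OF s, of "\<lambda>z. (norm z)\<^sup>2 - ?N"] by simp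
  also have "\<dots> = s * (\<Sum>b\<in>Basis. heat_hess s g x b \<bullet> b)"
    using s by (simp add: trace_heat_hess[OF g] power2_eq_square)
  finally have "((\<lambda>t. \<integral>w. g (x + w) * \<kappa> t w \<partial>lborel) has_real_derivative s * (\<Sum>b\<in>Basis. heat_hess s g x b \<bullet> b)) (at s)"
    using d by simp
  then show ?thesis
    by (rule DERIV_cong_ev[THEN iffD2, rotated -1])
       (use s heat in \<open>auto simp: eventually_at_filter eventually_nhds intro!: exI[of _ "{0<..}"]\<close>)
qed

section \<open>The resolvent of the Laplacian\<close>

text \<open>The exponent may vary with the ball. This makes the class closed under products and
  compositions, where exponents shrink or multiply, without any bookkeeping.\<close>

definition hoelder_loc :: "('a::real_normed_vector \<Rightarrow> 'b::real_normed_vector) \<Rightarrow> bool" where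
  "hoelder_loc g \<longleftrightarrow> (\<forall>R. \<exists>a A. 0 < a \<and> a \<le> 1 \<and> 0 \<le> A \<and>
     (\<forall>x\<in>cball 0 R. \<forall>y\<in>cball 0 R. norm (g x - g y) \<le> A * norm (x - y) powr a))"

lemma hoelder_locE:
  assumes "hoelder_loc g"
  obtains a A where "0 < a" "a \<le> 1" "0 \<le> A"
    "\<And>x y. norm x \<le> R \<Longrightarrow> norm y \<le> R \<Longrightarrow> norm (g x - g y) \<le> A * norm (x - y) powr a"
proof -
  obtain a A where "0 < a" "a \<le> 1" "0 \<le> A"
    "\<forall>x\<in>cball 0 R. \<forall>y\<in>cball 0 R. norm (g x - g y) \<le> A * norm (x - y) powr a"
    using assms unfolding hoelder_loc_def by blast
  then show ?thesis by (intro that[of a A]) auto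
qed

lemma hoelder_loc_continuous:
  assumes "hoelder_loc g"
  shows "continuous_on S g"
proof -
  have "isCont g x" for x
  proof -
    obtain a A where aA: "0 < a" "a \<le> 1" "0 \<le> A"
      "\<And>y z. norm y \<le> norm x + 1 \<Longrightarrow> norm z \<le> norm x + 1 \<Longrightarrow> norm (g y - g z) \<le> A * norm (y - z) powr a"
      by (rule hoelder_locE[OF assms, of "norm x + 1"]) blast
    have "((\<lambda>y. norm (y - x)) \<longlongrightarrow> norm (x - x)) (at x)" by (intro tendsto_intros)
    then have "((\<lambda>y. norm (y - x) powr a) \<longlongrightarrow> 0 powr a) (at x)"
      using aA(1) by (intro tendsto_powr2) (auto intro!: tendsto_intros)
    then have l: "((\<lambda>y. A * norm (y - x) powr a) \<longlongrightarrow> 0) (at x)"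
      using aA(1) by (auto intro!: tendsto_eq_intros)
    have "eventually (\<lambda>y. norm (g y - g x) \<le> A * norm (y - x) powr a) (at x)"
      unfolding eventually_at
    proof (intro exI[of _ 1] conjI ballI impI)
      fix y assume "y \<noteq> x \<and> dist y x < 1"
      then have "norm y \<le> norm x + 1" using norm_triangle_ineq2[of y x] by (simp add: dist_norm)
      then show "norm (g y - g x) \<le> A * norm (y - x) powr a" by (intro aA) auto
    qed simp
    from Lim_null_comparison[OF this l] show ?thesis
      by (simp add: isCont_def LIM_zero_iff)
  qed
  then show ?thesis by (simp add: continuous_at_imp_continuous_on)
qed

text \<open>Gaussian averages see all of space, so one of the two points must be unrestricted. If |y
  - x| > 1, boundedness alone gives 2 M \<le> 2 M |y - x|^a; otherwise y lies in the ball of radius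
  R + 1.\<close>

lemma hoelder_loc_bounded_global:
  fixes g :: "'a::real_normed_vector \<Rightarrow> 'b::real_normed_vector"
  assumes h: "hoelder_loc g" and b: "\<And>x. norm (g x) \<le> M"
  obtains a A where "0 < a" "a \<le> 1" "0 \<le> A"
    "\<And>x y. norm x \<le> R \<Longrightarrow> norm (g y - g x) \<le> A * norm (y - x) powr a"
proof -
  obtain a A where aA: "0 < a" "a \<le> 1" "0 \<le> A"
    "\<And>x y. norm x \<le> R + 1 \<Longrightarrow> norm y \<le> R + 1 \<Longrightarrow> norm (g x - g y) \<le> A * norm (x - y) powr a"
    by (rule hoelder_locE[OF h, of "R + 1"]) blast
  have M: "0 \<le> M" using order_trans[OF norm_ge_zero b[of 0]] .
  show ?thesis
  proof (rule that[of a "A + 2 * M"])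
    fix x y :: 'a assume x: "norm x \<le> R"
    show "norm (g y - g x) \<le> (A + 2 * M) * norm (y - x) powr a"
    proof (cases "norm (y - x) \<le> 1")
      case True
      then have "norm y \<le> R + 1" using x norm_triangle_sub[of y x] by linarith
      then have "norm (g y - g x) \<le> A * norm (y - x) powr a" using x by (intro aA) auto
      also have "\<dots> \<le> (A + 2 * M) * norm (y - x) powr a" using M by (intro mult_right_mono) auto
      finally show ?thesis .
    next
      case False
      then have "1 \<le> norm (y - x) powr a" using aA by (intro ge_one_powr_ge_zero) auto
      then have "(2 * M) * 1 \<le> (A + 2 * M) * norm (y - x) powr a" using M aA by (intro mult_mono) auto
      moreover have "norm (g y - g x) \<le> 2 * M" using norm_triangle_ineq4[of "g y" "g x"] b[of x] b[of y] by linarith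
      ultimately show ?thesis by linarith
    qed
  qed (use aA M in auto)
qed

text \<open>In the variable $t = s^2/2$ this measure is $e^{-\lambda t}\,dt$, so that integrating the heat
  semigroup against it gives the resolvent $(\lambda - \Delta)^{-1}$.\<close>
definition res_measure :: "real \<Rightarrow> real measure" where
  "res_measure l = density (restrict_space lborel {0<..}) (\<lambda>s. ennreal (s * exp (- l * s\<^sup>2 / 2)))"

lemma space_res_measure [simp]: "space (res_measure l) = {0<..}"
  by (simp add: res_measure_def space_restrict_space)

lemma res_measure_measurable:
  fixes f :: "real \<Rightarrow> 'b::{real_normed_vector, second_countable_topology}"
  assumes "continuous_on {0<..} f"
  shows "f \<in> borel_measurable (res_measure l)"
proof -
  have "f \<in> borel_measurable (restrict_space borel {0<..})"
    by (rule borel_measurable_continuous_on_restrict[OF assms])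
  then show ?thesis
    by (subst measurable_cong_sets[of _ "restrict_space borel {0<..}" _ borel])
       (auto simp: res_measure_def cong: sets_restrict_space_cong)
qed

lemma
  fixes f :: "real \<Rightarrow> 'b::{banach, second_countable_topology}"
  assumes f: "continuous_on {0<..} f"
  shows integrable_res_measure: "integrable (res_measure l) f \<longleftrightarrow>
      set_integrable lborel {0<..} (\<lambda>s. (s * exp (- l * s\<^sup>2 / 2)) *\<^sub>R f s)"
    and integral_res_measure: "(\<integral>s. f s \<partial>res_measure l) = (LINT s:{0<..}|lborel. (s * exp (- l * s\<^sup>2 / 2)) *\<^sub>R f s)"
proof -
  have m: "f \<in> borel_measurable (restrict_space lborel {0<..})"
    using borel_measurable_continuous_on_restrict[OF f]
    by (subst measurable_cong_sets[of _ "restrict_space borel {0<..}" _ borel]) (auto cong: sets_restrict_space_cong)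
  have w: "(\<lambda>s. s * exp (- l * s\<^sup>2 / 2)) \<in> borel_measurable (restrict_space lborel {0<..})"
    by (intro measurable_restrict_space1) measurable
  have "AE s in restrict_space lborel {0<..}. 0 \<le> s * exp (- l * s\<^sup>2 / 2)"
    by (auto simp: space_restrict_space intro!: AE_I2)
  note wp = this
  show "integrable (res_measure l) f \<longleftrightarrow> set_integrable lborel {0<..} (\<lambda>s. (s * exp (- l * s\<^sup>2 / 2)) *\<^sub>R f s)"
    unfolding res_measure_def
    by (subst integrable_density[OF m w wp]) (simp add: integrable_restrict_space set_integrable_def)
  show "(\<integral>s. f s \<partial>res_measure l) = (LINT s:{0<..}|lborel. (s * exp (- l * s\<^sup>2 / 2)) *\<^sub>R f s)"
    unfolding res_measure_def
    by (subst integral_density[OF m w wp]) (simp add: integral_restrict_space set_lebesgue_integral_def)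
qed

lemma powr_integrable_0_1:
  assumes "-1 < (c::real)"
  shows "set_integrable lborel {0..1} (\<lambda>s. s powr c)"
proof -
  have "(\<lambda>s::real. s powr c) integrable_on {0..1}"
    using has_integral_powr_from_0[OF assms, of 1] by (auto simp: integrable_on_def)
  then have "(\<lambda>s::real. s powr c) absolutely_integrable_on {0..1}"
    by (intro nonnegative_absolutely_integrable_1) auto
  then have "integrable (completion lborel) (\<lambda>s. indicator {0..1::real} s *\<^sub>R s powr c)"
    by (simp add: set_integrable_def)
  then show ?thesis unfolding set_integrable_def
    by (subst (asm) integrable_completion) auto
qed

text \<open>Near 0 the density times s^b behaves like s^(1+b), integrable since b > -2; beyond 1 the
  Gaussian factor dominates. The exponents that occur are 0 for the function, -1 for its gradient,
  -3/2 for the Hoelder bound of the gradient and a - 2 for the Hessian.\<close>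

lemma res_measure_powr:
  assumes l: "0 < l" and b: "-2 < b" "b \<le> 0"
  shows "integrable (res_measure l) (\<lambda>s. s powr b)"
proof -
  have "set_integrable lborel {0<..} (\<lambda>s. (s * exp (- l * s\<^sup>2 / 2)) *\<^sub>R s powr b)"
    unfolding set_integrable_def
  proof (rule Bochner_Integration.integrable_bound)
    show "integrable lborel (\<lambda>s::real. indicator {0..1} s *\<^sub>R s powr (1 + b) + (1 + norm s) ^ 1 * exp (- (l/2) * (norm s)\<^sup>2))"
      using powr_integrable_0_1[of "1 + b"] b l
      by (intro Bochner_Integration.integrable_add integrable_poly_exp_neg_norm_square) (auto simp: set_integrable_def)
    show "(\<lambda>x. indicat_real {0<..} x *\<^sub>R (x * exp (- l * x\<^sup>2 / 2)) *\<^sub>R x powr b) \<in> borel_measurable lborel"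
      by measurable
    show "AE s in lborel. norm (indicat_real {0<..} s *\<^sub>R (s * exp (- l * s\<^sup>2 / 2)) *\<^sub>R s powr b)
        \<le> norm (indicator {0..1} s *\<^sub>R s powr (1 + b) + (1 + norm s) ^ 1 * exp (- (l/2) * (norm s)\<^sup>2))"
    proof (rule AE_I2)
      fix s :: real
      have nn: "0 \<le> indicator {0..1} s *\<^sub>R s powr (1 + b)" "0 \<le> (1 + norm s) ^ 1 * exp (- (l/2) * (norm s)\<^sup>2)" by auto
      have "indicat_real {0<..} s *\<^sub>R (s * exp (- l * s\<^sup>2 / 2)) *\<^sub>R s powr b
         \<le> indicator {0..1} s *\<^sub>R s powr (1 + b) + (1 + norm s) ^ 1 * exp (- (l/2) * (norm s)\<^sup>2)"
      proof (cases "0 < s")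
        case s: True
        show ?thesis
        proof (cases "s \<le> 1")
          case True
          have "(s * exp (- l * s\<^sup>2 / 2)) * s powr b \<le> (s * 1) * s powr b"
            using s l by (intro mult_right_mono mult_left_mono) auto
          also have "\<dots> = s powr (1 + b)" using s by (simp add: powr_add)
          finally have "(s * exp (- l * s\<^sup>2 / 2)) * s powr b \<le> s powr (1 + b) + (1 + norm s) ^ 1 * exp (- (l/2) * (norm s)\<^sup>2)"
            using nn(2) by linarith
          then show ?thesis using s True by simp
        next
          case False
          have "s powr b \<le> s powr 0" using False b by (intro powr_mono) auto
          then have "s powr b \<le> 1" using s by simp
          then have "(s * exp (- l * s\<^sup>2 / 2)) * s powr b \<le> (s * exp (- l * s\<^sup>2 / 2)) * 1"
            using s by (intro mult_left_mono) auto
          also have "\<dots> \<le> (1 + norm s) ^ 1 * exp (- (l/2) * (norm s)\<^sup>2)" using s by (simp add: algebra_simps)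
          finally show ?thesis using s False by simp
        qed
      next
        case False
        then have "indicat_real {0<..} s = 0" by simp
        then show ?thesis using nn by simp
      qed
      then show "norm (indicat_real {0<..} s *\<^sub>R (s * exp (- l * s\<^sup>2 / 2)) *\<^sub>R s powr b)
        \<le> norm (indicator {0..1} s *\<^sub>R s powr (1 + b) + (1 + norm s) ^ 1 * exp (- (l/2) * (norm s)\<^sup>2))"
        using nn by (auto simp: indicator_def)
    qed
  qed
  moreover have "continuous_on {0<..} (\<lambda>s::real. s powr b)" by (auto intro!: continuous_intros)
  ultimately show ?thesis by (simp add: integrable_res_measure)
qed

lemma res_measure_const:
  assumes "0 < l"
  shows "integrable (res_measure l) (\<lambda>_. c :: real)"
proof -
  have "integrable (res_measure l) (\<lambda>s. c * s powr 0)"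
    using res_measure_powr[OF assms, of 0] by (intro integrable_mult_right) auto
  then show ?thesis
    by (rule Bochner_Integration.integrable_cong[THEN iffD1, rotated -1]) auto
qed

definition res_mass :: "real \<Rightarrow> real \<Rightarrow> real" where
  "res_mass l b = (\<integral>s. s powr b \<partial>res_measure l)"

lemma res_mass_nonneg: "0 \<le> res_mass l b"
  unfolding res_mass_def by (intro integral_nonneg_AE AE_I2) auto

text \<open>The power s^(-1) cancels the factor s of the density, leaving a half-line Gaussian
  integral. What matters is the decay as l grows: it makes the gradient of the resolvent a small
  operator.\<close>

lemma res_mass_minus_1_le:
  assumes l: "0 < l"
  shows "res_mass l (-1) \<le> sqrt (2 * pi / l)"
proof -
  define \<sigma> where "\<sigma> = sqrt (1 / l)"
  have \<sigma>: "\<sigma> > 0" "\<sigma>\<^sup>2 = 1 / l" using l by (auto simp: \<sigma>_def)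
  have n: "sqrt (2 * pi / l) * normal_density 0 \<sigma> s = exp (- l * s\<^sup>2 / 2)" for s
    using l by (simp add: normal_density_def \<sigma>(2))
  have int: "integrable lborel (\<lambda>s. exp (- l * s\<^sup>2 / 2))"
    using integrable_exp_neg_square_real[of "l / 2"] l by simp
  have tot: "(\<integral>s. exp (- l * s\<^sup>2 / 2) \<partial>lborel) = sqrt (2 * pi / l)"
    using integral_normal_density[OF \<sigma>(1), of 0] unfolding n[symmetric] by simp
  have c: "continuous_on {0<..} (\<lambda>s::real. s powr (-1))" by (auto intro!: continuous_intros)
  have "res_mass l (-1) = (LINT s:{0<..}|lborel. (s * exp (- l * s\<^sup>2 / 2)) *\<^sub>R s powr (-1))"
    unfolding res_mass_def by (rule integral_res_measure[OF c])
  also have "\<dots> = (\<integral>s. indicator {0<..} s * exp (- l * s\<^sup>2 / 2) \<partial>lborel)"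
    unfolding set_lebesgue_integral_def
    by (rule Bochner_Integration.integral_cong) (auto simp: indicator_def powr_minus_divide)
  also have "\<dots> \<le> (\<integral>s. exp (- l * s\<^sup>2 / 2) \<partial>lborel)"
    by (rule integral_mono[OF _ int]) (use integrable_real_mult_indicator[OF _ int, of "{0<..}"] in \<open>auto simp: indicator_def mult.commute\<close>)
  finally show ?thesis using tot by simp
qed

definition resolvent :: "real \<Rightarrow> ('a::euclidean_space \<Rightarrow> real) \<Rightarrow> 'a \<Rightarrow> real" where
  "resolvent l g x = (\<integral>s. heat s g x \<partial>res_measure l)"

definition res_grad :: "real \<Rightarrow> ('a::euclidean_space \<Rightarrow> real) \<Rightarrow> 'a \<Rightarrow> 'a" where
  "res_grad l g x = (\<integral>s. heat_grad s g x \<partial>res_measure l)"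

definition res_hess :: "real \<Rightarrow> ('a::euclidean_space \<Rightarrow> real) \<Rightarrow> 'a \<Rightarrow> 'a \<Rightarrow> 'a" where
  "res_hess l g x h = (\<integral>s. heat_hess s g x h \<partial>res_measure l)"

section \<open>Resolvent and its gradient for bounded continuous data\<close>

context
  fixes g :: "'a::euclidean_space \<Rightarrow> real" and M l :: real
  assumes g: "continuous_on UNIV g" "\<And>x. \<bar>g x\<bar> \<le> M" and l: "0 < l"
begin

lemma bound_nonneg: "0 \<le> M" using g(2)[of 0] by simp

lemma heat_cont_s: "continuous_on {0<..} (\<lambda>s. heat s g x)"
  unfolding heat_def by (rule gint_continuous_s[OF integrable_gauss g])

lemma heat_grad_cont_s: "continuous_on {0<..} (\<lambda>s. heat_grad s g x)"
  unfolding heat_grad_def by (intro continuous_intros gint_continuous_s[OF integrable_gvec g]) auto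

lemma heat_hess_cont_s: "continuous_on {0<..} (\<lambda>s. heat_hess s g x h)"
  unfolding heat_hess_def by (intro continuous_intros gint_continuous_s[OF integrable_gauss_hess g]) auto

lemma heat_res_integrable: "integrable (res_measure l) (\<lambda>s. heat s g x)"
  by (rule Bochner_Integration.integrable_bound[OF res_measure_const[OF l, of M] res_measure_measurable[OF heat_cont_s]])
     (use heat_abs_le[OF g] bound_nonneg in auto)

lemma heat_grad_res_integrable: "integrable (res_measure l) (\<lambda>s. heat_grad s g x)"
proof (rule Bochner_Integration.integrable_bound[OF _ res_measure_measurable[OF heat_grad_cont_s]])
  show "integrable (res_measure l) (\<lambda>s. M * grad_const TYPE('a) * s powr (-1))"
    using l by (intro integrable_mult_right res_measure_powr) auto
  show "AE s in res_measure l. norm (heat_grad s g x) \<le> norm (M * grad_const TYPE('a) * s powr (-1))"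
    using heat_grad_norm_le[OF g] bound_nonneg grad_const_nonneg[where 'a='a]
    by (intro AE_I2) (auto simp: powr_minus_divide abs_mult)
qed

lemma res_grad_norm_le: "norm (res_grad l g x) \<le> M * grad_const TYPE('a) * res_mass l (-1)"
proof -
  have "norm (res_grad l g x) \<le> (\<integral>s. norm (heat_grad s g x) \<partial>res_measure l)"
    unfolding res_grad_def by (rule integral_norm_bound)
  also have "\<dots> \<le> (\<integral>s. M * grad_const TYPE('a) * s powr (-1) \<partial>res_measure l)"
    using heat_grad_norm_le[OF g] l
    by (intro integral_mono integrable_norm heat_grad_res_integrable integrable_mult_right res_measure_powr)
       (auto simp: powr_minus_divide)
  finally show ?thesis by (simp only: res_mass_def integral_mult_right_zero)
qed

lemma resolvent_abs_le: "\<bar>resolvent l g x\<bar> \<le> M * res_mass l 0"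
proof -
  have "\<bar>resolvent l g x\<bar> \<le> (\<integral>s. \<bar>heat s g x\<bar> \<partial>res_measure l)"
    unfolding resolvent_def using integral_norm_bound[of "res_measure l" "\<lambda>s. heat s g x"] by simp
  also have "\<dots> \<le> (\<integral>s. M * s powr 0 \<partial>res_measure l)"
    using heat_abs_le[OF g] l
    by (intro integral_mono integrable_abs heat_res_integrable integrable_mult_right res_measure_powr) auto
  finally show ?thesis by (simp add: res_mass_def)
qed

lemma heat_lipschitz:
  assumes s: "0 < s"
  shows "norm (heat s g x - heat s g y) \<le> M * grad_const TYPE('a) / s * norm (x - y)"
proof (rule differentiable_bound[of UNIV])
  show "(heat s g has_derivative (\<lambda>h. heat_grad s g z \<bullet> h)) (at z within UNIV)" for z
    using heat_has_derivative[OF g s] by simp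
  show "onorm (\<lambda>h. heat_grad s g z \<bullet> h) \<le> M * grad_const TYPE('a) / s" for z
  proof (rule onorm_bound)
    show "norm (heat_grad s g z \<bullet> h) \<le> M * grad_const TYPE('a) / s * norm h" for h
      using order_trans[OF Cauchy_Schwarz_ineq2 mult_right_mono[OF heat_grad_norm_le[OF g s], of "norm h" z]] by simp
  qed (use s bound_nonneg grad_const_nonneg[where 'a='a] in simp)
qed auto

lemma resolvent_has_derivative:
  "(resolvent l g has_derivative (\<lambda>h. res_grad l g x \<bullet> h)) (at x)"
proof -
  have "((\<lambda>x. \<integral>s. heat s g x \<partial>res_measure l) has_derivative (\<lambda>h. \<integral>s. heat_grad s g x \<bullet> h \<partial>res_measure l)) (at x)"
  proof (rule has_derivative_integral(1)[where e=1 and B="\<lambda>s. M * grad_const TYPE('a) * s powr (-1)"])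
    show "((\<lambda>x. heat s g x) has_derivative (\<lambda>h. heat_grad s g x \<bullet> h)) (at x)" if "s \<in> space (res_measure l)" for s
      using heat_has_derivative[OF g, of s x] that by simp
    show "norm (heat s g y - heat s g x) \<le> M * grad_const TYPE('a) * s powr - 1 * norm (y - x)" if "s \<in> space (res_measure l)" for s y
      using heat_lipschitz[of s y x] that by (simp add: powr_minus_divide)
    show "(\<lambda>s. heat_grad s g x \<bullet> h) \<in> borel_measurable (res_measure l)" for h
      using borel_measurable_integrable[OF heat_grad_res_integrable[of x]] by measurable
    show "integrable (res_measure l) (\<lambda>s. M * grad_const TYPE('a) * s powr - 1)"
      using l by (intro integrable_mult_right res_measure_powr) auto
  qed (auto intro: heat_res_integrable)
  moreover have "(\<integral>s. heat_grad s g x \<bullet> h \<partial>res_measure l) = res_grad l g x \<bullet> h" for h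
    unfolding res_grad_def by (rule integral_inner_left) (rule heat_grad_res_integrable)
  ultimately show ?thesis by (simp add: resolvent_def[abs_def])
qed

text \<open>Interpolation: the difference is at most a multiple of 1/s by the gradient bound and of
  |x - y| / s^2 by the Hessian bound. The geometric mean of the two is of order s^(-3/2) |x -
  y|^(1/2), and the power -3/2 is still integrable against the resolvent measure. No Hoelder
  continuity of g is used, so the resulting bound depends on g only through M.\<close>

lemma heat_grad_hoelder_half:
  assumes s: "0 < s"
  shows "norm (heat_grad s g x - heat_grad s g y)
    \<le> M * sqrt (2 * grad_const TYPE('a) * hess_const TYPE('a)) * s powr (-3/2) * sqrt (norm (x - y))"
proof -
  let ?d = "norm (heat_grad s g x - heat_grad s g y)"
  let ?C1 = "grad_const TYPE('a)" and ?C2 = "hess_const TYPE('a)"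
  have 1: "?d \<le> 2 * M * ?C1 / s"
    using norm_triangle_ineq4[of "heat_grad s g x" "heat_grad s g y"] heat_grad_norm_le[OF g s, of x] heat_grad_norm_le[OF g s, of y]
    by simp
  have 2: "?d \<le> M * ?C2 / s\<^sup>2 * norm (x - y)"
  proof (rule differentiable_bound[of UNIV])
    show "(heat_grad s g has_derivative heat_hess s g z) (at z within UNIV)" for z
      using heat_grad_has_derivative[OF g s] by simp
    show "onorm (heat_hess s g z) \<le> M * ?C2 / s\<^sup>2" for z
      by (rule onorm_bound) (use heat_hess_norm_le[OF g s, of z] s bound_nonneg hess_const_nonneg[where 'a='a] in auto)
  qed auto
  have "?d * ?d \<le> (2 * M * ?C1 / s) * (M * ?C2 / s\<^sup>2 * norm (x - y))"
    by (rule mult_mono[OF 1 2]) (use s bound_nonneg grad_const_nonneg[where 'a='a] in auto)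
  also have "\<dots> = (M * sqrt (2 * ?C1 * ?C2) * s powr (-3/2) * sqrt (norm (x - y)))\<^sup>2"
  proof -
    have "(s powr (-3/2))\<^sup>2 = 1 / s ^ 3"
    proof -
      have "(s powr (-3/2))\<^sup>2 = s powr (-3/2 + -3/2)" by (simp only: power2_eq_square powr_add)
      also have "\<dots> = 1 / s ^ 3" using s by (simp add: powr_minus_divide powr_numeral)
      finally show ?thesis .
    qed
    then have sq: "(M * sqrt (2 * ?C1 * ?C2) * s powr (-3/2) * sqrt (norm (x - y)))\<^sup>2 = M\<^sup>2 * (2 * ?C1 * ?C2) * (1 / s ^ 3) * norm (x - y)"
      using grad_const_nonneg[where 'a='a] hess_const_nonneg[where 'a='a]
      by (simp add: power_mult_distrib)
    show ?thesis unfolding sq using s by (simp add: power2_eq_square power3_eq_cube mult_ac)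
  qed
  finally have "?d\<^sup>2 \<le> (M * sqrt (2 * ?C1 * ?C2) * s powr (-3/2) * sqrt (norm (x - y)))\<^sup>2"
    by (simp only: power2_eq_square)
  then show ?thesis
    by (rule power2_le_imp_le) (use bound_nonneg grad_const_nonneg[where 'a='a] hess_const_nonneg[where 'a='a] in auto)
qed

lemma res_grad_hoelder_half:
  "norm (res_grad l g x - res_grad l g y)
    \<le> M * (sqrt (2 * grad_const TYPE('a) * hess_const TYPE('a)) * res_mass l (-3/2)) * sqrt (norm (x - y))"
proof -
  have "res_grad l g x - res_grad l g y = (\<integral>s. heat_grad s g x - heat_grad s g y \<partial>res_measure l)"
    unfolding res_grad_def by (rule Bochner_Integration.integral_diff[symmetric]) (rule heat_grad_res_integrable)+
  also have "norm \<dots> \<le> (\<integral>s. norm (heat_grad s g x - heat_grad s g y) \<partial>res_measure l)"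
    by (rule integral_norm_bound)
  also have "\<dots> \<le> (\<integral>s. M * sqrt (2 * grad_const TYPE('a) * hess_const TYPE('a)) * sqrt (norm (x - y)) * s powr (-3/2) \<partial>res_measure l)"
    using l heat_grad_hoelder_half[of _ x y]
    by (intro integral_mono integrable_norm Bochner_Integration.integrable_diff heat_grad_res_integrable integrable_mult_right res_measure_powr)
       (auto simp: ac_simps)
  finally show ?thesis by (simp add: res_mass_def ac_simps)
qed

lemma hoelder_loc_res_grad: "hoelder_loc (res_grad l g)"
  unfolding hoelder_loc_def
proof (intro allI exI conjI ballI)
  fix x y :: 'a
  show "norm (res_grad l g x - res_grad l g y)
      \<le> M * (sqrt (2 * grad_const TYPE('a) * hess_const TYPE('a)) * res_mass l (-3/2)) * norm (x - y) powr (1/2)"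
    using res_grad_hoelder_half[of x y] by (simp add: powr_half_sqrt)
qed (use bound_nonneg grad_const_nonneg[where 'a='a] hess_const_nonneg[where 'a='a] res_mass_nonneg in auto)

section \<open>Second derivatives and the resolvent equation for Hoelder data\<close>

context
  assumes gh: "hoelder_loc g"
begin

lemma heat_hess_dominated:
  obtains a A where "-2 < a" "a \<le> 0" "0 \<le> A"
    "\<And>x s h. norm x \<le> R \<Longrightarrow> 0 < s \<Longrightarrow> norm (heat_hess s g x h) \<le> A * s powr a * norm h"
proof -
  obtain a A where aA: "0 < a" "a \<le> 1" "0 \<le> A"
    "\<And>x y. norm x \<le> R \<Longrightarrow> norm (g y - g x) \<le> A * norm (y - x) powr a"
    by (rule hoelder_loc_bounded_global[OF gh, of M R]) (use g in auto)
  show ?thesis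
  proof (rule that[of "a - 2" "A * hess_const TYPE('a)"])
    fix x s h assume "norm (x::'a) \<le> R" "0 < (s::real)"
    then show "norm (heat_hess s g x h) \<le> A * hess_const TYPE('a) * s powr (a - 2) * norm h"
      using heat_hess_holder[OF g _ aA(1-3), of s x h] aA(4)[of x] by (simp add: ac_simps)
  qed (use aA hess_const_nonneg[where 'a='a] in auto)
qed

lemma heat_hess_res_integrable: "integrable (res_measure l) (\<lambda>s. heat_hess s g x h)"
proof -
  obtain a A where aA: "-2 < a" "a \<le> 0" "0 \<le> A"
    "\<And>x' s h. norm x' \<le> norm x \<Longrightarrow> 0 < s \<Longrightarrow> norm (heat_hess s g x' h) \<le> A * s powr a * norm h"
    by (rule heat_hess_dominated[of "norm x"]) blast
  show ?thesis
  proof (rule Bochner_Integration.integrable_bound[OF _ res_measure_measurable[OF heat_hess_cont_s]])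
    show "integrable (res_measure l) (\<lambda>s. A * norm h * s powr a)"
      using l aA by (intro integrable_mult_right res_measure_powr) auto
    show "AE s in res_measure l. norm (heat_hess s g x h) \<le> norm (A * norm h * s powr a)"
      using aA(4)[of x] aA(3) by (intro AE_I2) (auto simp: ac_simps)
  qed
qed

lemma res_grad_has_derivative: "(res_grad l g has_derivative res_hess l g x) (at x)"
proof -
  obtain a A where aA: "-2 < a" "a \<le> 0" "0 \<le> A"
    "\<And>x' s h. norm x' \<le> norm x + 1 \<Longrightarrow> 0 < s \<Longrightarrow> norm (heat_hess s g x' h) \<le> A * s powr a * norm h"
    by (rule heat_hess_dominated[of "norm x + 1"]) blast
  have "((\<lambda>x. \<integral>s. heat_grad s g x \<partial>res_measure l) has_derivative (\<lambda>h. \<integral>s. heat_hess s g x h \<partial>res_measure l)) (at x)"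
  proof (rule has_derivative_integral(1)[where e=1 and B="\<lambda>s. A * s powr a"])
    show "((\<lambda>x. heat_grad s g x) has_derivative (\<lambda>h. heat_hess s g x h)) (at x)" if "s \<in> space (res_measure l)" for s
      using heat_grad_has_derivative[OF g, of s x] that by simp
    show "norm (heat_grad s g y - heat_grad s g x) \<le> A * s powr a * norm (y - x)"
      if s: "s \<in> space (res_measure l)" and y: "dist y x < 1" for s y
    proof (rule differentiable_bound[of "ball x 1"])
      show "(heat_grad s g has_derivative heat_hess s g z) (at z within ball x 1)" for z
        using heat_grad_has_derivative[OF g] s by (auto intro: has_derivative_at_withinI)
      fix z assume "z \<in> ball x 1"
      then have "norm z \<le> norm x + 1" using norm_triangle_ineq2[of z x] by (simp add: dist_norm norm_minus_commute)
      then show "onorm (heat_hess s g z) \<le> A * s powr a"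
        by (intro onorm_bound) (use s aA in auto)
    qed (use y in \<open>auto simp: dist_commute\<close>)
    show "(\<lambda>s. heat_hess s g x h) \<in> borel_measurable (res_measure l)" for h
      using borel_measurable_integrable[OF heat_hess_res_integrable] .
    show "integrable (res_measure l) (\<lambda>s. A * s powr a)"
      using l aA by (intro integrable_mult_right res_measure_powr) auto
  qed (auto intro: heat_grad_res_integrable)
  then show ?thesis by (simp add: res_grad_def[abs_def] res_hess_def[abs_def])
qed

lemma res_hess_continuous: "continuous_on UNIV (\<lambda>x. res_hess l g x h)"
  unfolding continuous_on_sequentially
proof (intro ballI allI impI, elim conjE, unfold o_def)
  fix X :: "nat \<Rightarrow> 'a" and x assume X: "X \<longlonglongrightarrow> x"
  then obtain R where R: "\<And>n. norm (X n) \<le> R"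
    by (meson Bseq_def convergentI convergent_imp_Bseq)
  obtain a A where aA: "-2 < a" "a \<le> 0" "0 \<le> A"
    "\<And>x' s h. norm x' \<le> R \<Longrightarrow> 0 < s \<Longrightarrow> norm (heat_hess s g x' h) \<le> A * s powr a * norm h"
    by (rule heat_hess_dominated[of R]) blast
  show "(\<lambda>n. res_hess l g (X n) h) \<longlonglongrightarrow> res_hess l g x h"
    unfolding res_hess_def
  proof (rule integral_dominated_convergence[where w="\<lambda>s. A * norm h * s powr a"])
    show "integrable (res_measure l) (\<lambda>s. A * norm h * s powr a)"
      using l aA by (intro integrable_mult_right res_measure_powr) auto
    show "AE s in res_measure l. (\<lambda>n. heat_hess s g (X n) h) \<longlonglongrightarrow> heat_hess s g x h"
    proof (rule AE_I2)
      fix s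
      have "continuous_on UNIV (\<lambda>x. gint (gauss_hess h) g s x)" by (rule gint_continuous_x[OF integrable_gauss_hess g])
      then have "isCont (\<lambda>x. gint (gauss_hess h) g s x) x" by (simp add: continuous_on_eq_continuous_at)
      then show "(\<lambda>n. heat_hess s g (X n) h) \<longlonglongrightarrow> heat_hess s g x h"
        unfolding heat_hess_def by (intro tendsto_intros isCont_tendsto_compose[OF _ X])
    qed
    show "AE s in res_measure l. norm (heat_hess s g (X n) h) \<le> A * norm h * s powr a" for n
      using aA(4)[OF R] by (intro AE_I2) (auto simp: ac_simps)
  qed (auto intro: borel_measurable_integrable heat_hess_res_integrable)
qed

text \<open>Integration in s: \<open>F\<close> has derivative s exp (- l s^2 / 2) times (l -
  Laplacian) of the heat extension, by the heat equation. Its boundary values are - g x at 0,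
  because the Gaussian averages tend to g, and 0 at infinity.\<close>

lemma res_equation: "l * resolvent l g x - (\<Sum>b\<in>Basis. res_hess l g x b \<bullet> b) = g x"
proof -
  define T where "T s = (\<Sum>b\<in>Basis. heat_hess s g x b \<bullet> b)" for s
  define F where "F s = - (exp (- l * s\<^sup>2 / 2) * heat s g x)" for s
  have cT: "continuous_on {0<..} T" unfolding T_def by (intro continuous_intros heat_hess_cont_s)
  have iT: "integrable (res_measure l) T"
    unfolding T_def[abs_def] by (intro Bochner_Integration.integrable_sum integrable_inner_left heat_hess_res_integrable)
  have "(\<Sum>b\<in>Basis. res_hess l g x b \<bullet> b) = (\<Sum>b\<in>Basis. (\<integral>s. heat_hess s g x b \<bullet> b \<partial>res_measure l))"
    unfolding res_hess_def by (intro sum.cong refl integral_inner_left[symmetric] heat_hess_res_integrable)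
  also have "\<dots> = (\<integral>s. T s \<partial>res_measure l)"
    unfolding T_def by (intro Bochner_Integration.integral_sum[symmetric] integrable_inner_left heat_hess_res_integrable)
  finally have "l * resolvent l g x - (\<Sum>b\<in>Basis. res_hess l g x b \<bullet> b) = (\<integral>s. l * heat s g x - T s \<partial>res_measure l)"
    using iT heat_res_integrable by (simp add: resolvent_def)
  also have "\<dots> = (LINT s:{0<..}|lborel. (s * exp (- l * s\<^sup>2 / 2)) *\<^sub>R (l * heat s g x - T s))"
    by (rule integral_res_measure) (auto intro!: continuous_intros heat_cont_s cT)
  also have "\<dots> = (LBINT s=0..\<infinity>. (s * exp (- l * s\<^sup>2 / 2)) * (l * heat s g x - T s))"
    by (simp add: interval_lebesgue_integral_def einterval_def zero_ereal_def greaterThan_def)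
  also have "\<dots> = 0 - (- g x)"
  proof (rule interval_integral_FTC_integrable[where F=F])
    fix s assume "0 < ereal s"
    then have s: "0 < s" by simp
    have e: "((\<lambda>s. exp (- l * s\<^sup>2 / 2)) has_real_derivative - (l * s) * exp (- l * s\<^sup>2 / 2)) (at s)"
      by (auto intro!: derivative_eq_intros)
    have "(F has_real_derivative (s * exp (- l * s\<^sup>2 / 2)) * (l * heat s g x - T s)) (at s)"
      unfolding F_def[abs_def]
      by (rule DERIV_cong[OF DERIV_minus[OF DERIV_mult[OF e heat_has_real_derivative_s[OF g s, of x]]]])
         (simp add: T_def algebra_simps)
    then show "(F has_vector_derivative (s * exp (- l * s\<^sup>2 / 2)) * (l * heat s g x - T s)) (at s)"
      by (simp add: has_real_derivative_iff_has_vector_derivative)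
    have "continuous_on {0<..} (\<lambda>s. (s * exp (- l * s\<^sup>2 / 2)) * (l * heat s g x - T s))"
      by (auto intro!: continuous_intros heat_cont_s cT)
    then show "isCont (\<lambda>s. (s * exp (- l * s\<^sup>2 / 2)) * (l * heat s g x - T s)) s"
      using s by (simp add: continuous_on_eq_continuous_at)
  next
    have "integrable (res_measure l) (\<lambda>s. l * heat s g x - T s)" using iT heat_res_integrable by simp
    moreover have "continuous_on {0<..} (\<lambda>s. l * heat s g x - T s)"
      by (intro continuous_intros heat_cont_s cT)
    ultimately have "set_integrable lborel {0<..} (\<lambda>s. (s * exp (- l * s\<^sup>2 / 2)) *\<^sub>R (l * heat s g x - T s))"
      by (simp only: integrable_res_measure)
    then show "set_integrable lborel (einterval 0 \<infinity>) (\<lambda>s. (s * exp (- l * s\<^sup>2 / 2)) * (l * heat s g x - T s))"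
      by (simp add: einterval_def zero_ereal_def greaterThan_def)
  next
    have "((\<lambda>s. - (exp (- l * s\<^sup>2 / 2) * heat s g x)) \<longlongrightarrow> - (exp (- l * 0\<^sup>2 / 2) * g x)) (at_right 0)"
      by (intro tendsto_intros heat_tendsto_0[OF g]) auto
    then show "((F \<circ> real_of_ereal) \<longlongrightarrow> - g x) (at_right 0)"
      by (simp add: F_def[abs_def] zero_ereal_def ereal_tendsto_simps)
  next
    have "((\<lambda>s. M * exp (- l * s\<^sup>2 / 2)) \<longlongrightarrow> 0) at_top" using l by real_asymp
    then have "(F \<longlongrightarrow> 0) at_top"
      by (rule Lim_null_comparison[rotated])
         (use heat_abs_le[OF g] bound_nonneg in \<open>auto simp: F_def abs_mult mult.commute intro!: mult_right_mono always_eventually\<close>)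
    then show "((F \<circ> real_of_ereal) \<longlongrightarrow> 0) (at_left \<infinity>)"
      by (simp add: ereal_tendsto_simps)
  qed auto
  finally show ?thesis by simp
qed

end

end

lemma res_grad_diff_le:
  fixes g1 g2 :: "'a::euclidean_space \<Rightarrow> real"
  assumes g1: "continuous_on UNIV g1" "\<And>x. \<bar>g1 x\<bar> \<le> M1" and g2: "continuous_on UNIV g2" "\<And>x. \<bar>g2 x\<bar> \<le> M2"
    and d: "\<And>x. \<bar>g1 x - g2 x\<bar> \<le> D" and l: "0 < l"
  shows "norm (res_grad l g1 x - res_grad l g2 x) \<le> D * grad_const TYPE('a) * res_mass l (-1)"
proof -
  have "heat_grad s g1 x - heat_grad s g2 x = heat_grad s (\<lambda>x. g1 x - g2 x) x" for s
  proof -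
    have "gint (\<lambda>z. gauss z *\<^sub>R z) g1 s x - gint (\<lambda>z. gauss z *\<^sub>R z) g2 s x = gint (\<lambda>z. gauss z *\<^sub>R z) (\<lambda>x. g1 x - g2 x) s x"
      unfolding gint_def scaleR_diff_left
      by (rule Bochner_Integration.integral_diff[symmetric]) (rule gint_integrable[OF integrable_gvec] g1 g2)+
    then show ?thesis by (simp add: heat_grad_def scaleR_diff_right[symmetric])
  qed
  then have "res_grad l g1 x - res_grad l g2 x = res_grad l (\<lambda>x. g1 x - g2 x) x"
    using heat_grad_res_integrable[OF g1 l] heat_grad_res_integrable[OF g2 l] by (simp add: res_grad_def flip: Bochner_Integration.integral_diff)
  then show ?thesis
    using res_grad_norm_le[of "\<lambda>x. g1 x - g2 x" D l x] d l g1(1) g2(1) by (auto intro!: continuous_intros)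
qed

lemma resolvent_tendsto:
  fixes g :: "'a::euclidean_space \<Rightarrow> real"
  assumes gn: "\<And>n. continuous_on UNIV (gn n)" "\<And>n x. \<bar>gn n x\<bar> \<le> M" and g: "continuous_on UNIV g" "\<And>x. \<bar>g x\<bar> \<le> M"
    and lim: "\<And>x. (\<lambda>n. gn n x) \<longlonglongrightarrow> g x" and l: "0 < l"
  shows "(\<lambda>n. resolvent l (gn n) x) \<longlonglongrightarrow> resolvent l g x"
  unfolding resolvent_def
proof (rule integral_dominated_convergence[where w="\<lambda>_. M"])
  show "AE s in res_measure l. (\<lambda>n. heat s (gn n) x) \<longlonglongrightarrow> heat s g x"
    unfolding heat_def by (intro AE_I2 gint_tendsto[OF integrable_gauss gn] lim)
qed (use heat_abs_le[OF gn] heat_res_integrable[OF gn l] heat_res_integrable[OF g l] res_measure_const[OF l] in \<open>auto intro: borel_measurable_integrable\<close>)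

section \<open>Hoelder continuity and comparison principle\<close>

text \<open>On a bounded range of distances a larger exponent can be traded for a smaller one at the
  price of a constant; two locally Hoelder functions thereby get a common exponent on each
  ball.\<close>

lemma powr_le_powr_smaller_exponent:
  fixes d D a b :: real
  assumes "0 \<le> d" "d \<le> D" "1 \<le> D" "0 < b" "b \<le> a" "a \<le> 1"
  shows "d powr a \<le> D * d powr b"
proof (cases "d = 0")
  case False
  then have d: "0 < d" using assms by simp
  have "d powr (a - b) \<le> D powr (a - b)" using assms by (intro powr_mono2) auto
  also have "\<dots> \<le> D powr 1" using assms by (intro powr_mono) auto
  finally have "d powr (a - b) \<le> D" using assms by simp
  then have "d powr (a - b) * d powr b \<le> D * d powr b" by (intro mult_right_mono) auto
  then show ?thesis by (simp add: powr_add[symmetric])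
qed (use assms in auto)

lemma hoelder_loc2E:
  fixes f :: "'a::real_normed_vector \<Rightarrow> 'b::real_normed_vector" and g :: "'a \<Rightarrow> 'c::real_normed_vector"
  assumes f: "hoelder_loc f" and g: "hoelder_loc g"
  obtains a A where "0 < a" "a \<le> 1" "0 \<le> A"
    "\<And>x y. norm x \<le> R \<Longrightarrow> norm y \<le> R \<Longrightarrow> norm (f x - f y) \<le> A * norm (x - y) powr a"
    "\<And>x y. norm x \<le> R \<Longrightarrow> norm y \<le> R \<Longrightarrow> norm (g x - g y) \<le> A * norm (x - y) powr a"
proof -
  obtain a A where aA: "0 < a" "a \<le> 1" "0 \<le> A"
    "\<And>x y. norm x \<le> R \<Longrightarrow> norm y \<le> R \<Longrightarrow> norm (f x - f y) \<le> A * norm (x - y) powr a"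
    by (rule hoelder_locE[OF f, of R]) blast
  obtain b B where bB: "0 < b" "b \<le> 1" "0 \<le> B"
    "\<And>x y. norm x \<le> R \<Longrightarrow> norm y \<le> R \<Longrightarrow> norm (g x - g y) \<le> B * norm (x - y) powr b"
    by (rule hoelder_locE[OF g, of R]) blast
  define D where "D = 2 * \<bar>R\<bar> + 1"
  have nD: "norm (x - y) \<le> D" if "norm x \<le> R" "norm y \<le> R" for x y :: 'a
    using norm_triangle_ineq4[of x y] that by (simp add: D_def)
  have D1: "1 \<le> D" by (simp add: D_def)
  show ?thesis
  proof (rule that[of "min a b" "(A + B) * D"])
    fix x y :: 'a assume xy: "norm x \<le> R" "norm y \<le> R"
    have "norm (f x - f y) \<le> A * norm (x - y) powr a" using aA xy by auto
    also have "\<dots> \<le> A * (D * norm (x - y) powr min a b)"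
      using aA bB nD[OF xy] D1 by (intro mult_left_mono powr_le_powr_smaller_exponent) auto
    also have "\<dots> \<le> (A + B) * (D * norm (x - y) powr min a b)"
      using aA bB D1 by (intro mult_right_mono) auto
    finally show "norm (f x - f y) \<le> (A + B) * D * norm (x - y) powr min a b" by (simp add: ac_simps)
    have "norm (g x - g y) \<le> B * norm (x - y) powr b" using bB xy by auto
    also have "\<dots> \<le> B * (D * norm (x - y) powr min a b)"
      using aA bB nD[OF xy] D1 by (intro mult_left_mono powr_le_powr_smaller_exponent) auto
    also have "\<dots> \<le> (A + B) * (D * norm (x - y) powr min a b)"
      using aA bB D1 by (intro mult_right_mono) auto
    finally show "norm (g x - g y) \<le> (A + B) * D * norm (x - y) powr min a b" by (simp add: ac_simps)
  qed (use aA bB D1 in auto)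
qed

lemma hoelder_locI:
  assumes "\<And>R. 0 < R \<Longrightarrow> \<exists>a A. 0 < a \<and> a \<le> 1 \<and> 0 \<le> A \<and>
     (\<forall>x y. norm x \<le> R \<longrightarrow> norm y \<le> R \<longrightarrow> norm (g x - g y) \<le> A * norm (x - y) powr a)"
  shows "hoelder_loc g"
  unfolding hoelder_loc_def
proof
  fix R :: real
  have "0 < \<bar>R\<bar> + 1" by simp
  from assms[OF this] obtain a A where "0 < a \<and> a \<le> 1 \<and> 0 \<le> A \<and>
     (\<forall>x y. norm x \<le> \<bar>R\<bar> + 1 \<longrightarrow> norm y \<le> \<bar>R\<bar> + 1 \<longrightarrow> norm (g x - g y) \<le> A * norm (x - y) powr a)"
    by blast
  then show "\<exists>a A. 0 < a \<and> a \<le> 1 \<and> 0 \<le> A \<and> (\<forall>x\<in>cball 0 R. \<forall>y\<in>cball 0 R. norm (g x - g y) \<le> A * norm (x - y) powr a)"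
    by (intro exI[of _ a] exI[of _ A]) auto
qed

lemma continuous_bounded_on_ball:
  fixes g :: "'a::euclidean_space \<Rightarrow> 'b::real_normed_vector"
  assumes "continuous_on UNIV g"
  obtains B where "0 \<le> B" "\<And>x. norm x \<le> R \<Longrightarrow> norm (g x) \<le> B"
proof -
  have "compact (g ` cball 0 R)"
    by (intro compact_continuous_image continuous_on_subset[OF assms]) auto
  then obtain B where B: "\<forall>x\<in>g ` cball 0 R. norm x \<le> B"
    using compact_imp_bounded bounded_iff by metis
  show ?thesis by (rule that[of "\<bar>B\<bar>"]) (use B in force)+
qed

lemma hoelder_loc_add:
  assumes f: "hoelder_loc f" and g: "hoelder_loc g"
  shows "hoelder_loc (\<lambda>x. f x + g x)"
proof (rule hoelder_locI)
  fix R :: real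
  obtain a A where aA: "0 < a" "a \<le> 1" "0 \<le> A"
    "\<And>x y. norm x \<le> R \<Longrightarrow> norm y \<le> R \<Longrightarrow> norm (f x - f y) \<le> A * norm (x - y) powr a"
    "\<And>x y. norm x \<le> R \<Longrightarrow> norm y \<le> R \<Longrightarrow> norm (g x - g y) \<le> A * norm (x - y) powr a"
    by (rule hoelder_loc2E[OF f g, of R]) blast
  have "norm ((f x + g x) - (f y + g y)) \<le> (2 * A) * norm (x - y) powr a" if "norm x \<le> R" "norm y \<le> R" for x y
    using aA(4)[OF that] aA(5)[OF that] norm_triangle_ineq[of "f x - f y" "g x - g y"] by (simp add: algebra_simps)
  then show "\<exists>a A. 0 < a \<and> a \<le> 1 \<and> 0 \<le> A \<and>
     (\<forall>x y. norm x \<le> R \<longrightarrow> norm y \<le> R \<longrightarrow> norm ((f x + g x) - (f y + g y)) \<le> A * norm (x - y) powr a)"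
    using aA(1-3) by (intro exI[of _ a] exI[of _ "2 * A"]) auto
qed

lemma hoelder_loc_bilinear:
  fixes f :: "'a::euclidean_space \<Rightarrow> 'b::real_normed_vector" and g :: "'a \<Rightarrow> 'c::real_normed_vector"
    and pr :: "'b \<Rightarrow> 'c \<Rightarrow> 'd::real_normed_vector"
  assumes bl: "bounded_bilinear pr" and f: "hoelder_loc f" and g: "hoelder_loc g"
  shows "hoelder_loc (\<lambda>x. pr (f x) (g x))"
proof (rule hoelder_locI)
  interpret bounded_bilinear pr by fact
  fix R :: real
  obtain K where K: "0 < K" "\<And>a b. norm (pr a b) \<le> norm a * norm b * K" using pos_bounded by blast
  obtain a A where aA: "0 < a" "a \<le> 1" "0 \<le> A"
    "\<And>x y. norm x \<le> R \<Longrightarrow> norm y \<le> R \<Longrightarrow> norm (f x - f y) \<le> A * norm (x - y) powr a"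
    "\<And>x y. norm x \<le> R \<Longrightarrow> norm y \<le> R \<Longrightarrow> norm (g x - g y) \<le> A * norm (x - y) powr a"
    by (rule hoelder_loc2E[OF f g, of R]) blast
  obtain B where B: "0 \<le> B" "\<And>x. norm x \<le> R \<Longrightarrow> norm (f x) \<le> B"
    by (rule continuous_bounded_on_ball[OF hoelder_loc_continuous[OF f], of R]) blast
  obtain C where C: "0 \<le> C" "\<And>x. norm x \<le> R \<Longrightarrow> norm (g x) \<le> C"
    by (rule continuous_bounded_on_ball[OF hoelder_loc_continuous[OF g], of R]) blast
  have "norm (pr (f x) (g x) - pr (f y) (g y)) \<le> (A * C * K + B * A * K) * norm (x - y) powr a"
    if xy: "norm x \<le> R" "norm y \<le> R" for x y
  proof -
    have "pr (f x) (g x) - pr (f y) (g y) = pr (f x - f y) (g x) + pr (f y) (g x - g y)"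
      by (simp add: diff_left diff_right)
    also have "norm \<dots> \<le> norm (f x - f y) * norm (g x) * K + norm (f y) * norm (g x - g y) * K"
      by (rule order_trans[OF norm_triangle_ineq add_mono[OF K(2) K(2)]])
    also have "\<dots> \<le> (A * norm (x - y) powr a) * C * K + B * (A * norm (x - y) powr a) * K"
      using xy aA B C K by (intro add_mono mult_right_mono mult_mono) auto
    finally show ?thesis by (simp add: algebra_simps)
  qed
  then show "\<exists>a A. 0 < a \<and> a \<le> 1 \<and> 0 \<le> A \<and>
     (\<forall>x y. norm x \<le> R \<longrightarrow> norm y \<le> R \<longrightarrow> norm (pr (f x) (g x) - pr (f y) (g y)) \<le> A * norm (x - y) powr a)"
    using aA B C K by (intro exI[of _ a] exI[of _ "A * C * K + B * A * K"]) auto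
qed

lemmas hoelder_loc_mult = hoelder_loc_bilinear[OF bounded_bilinear_mult]
lemmas hoelder_loc_inner = hoelder_loc_bilinear[OF bounded_bilinear_inner]

lemma hoelder_loc_norm:
  assumes "hoelder_loc g"
  shows "hoelder_loc (\<lambda>x. norm (g x))"
proof (rule hoelder_locI)
  fix R :: real
  obtain a A where aA: "0 < a" "a \<le> 1" "0 \<le> A"
    "\<And>x y. norm x \<le> R \<Longrightarrow> norm y \<le> R \<Longrightarrow> norm (g x - g y) \<le> A * norm (x - y) powr a"
    by (rule hoelder_locE[OF assms, of R]) blast
  have "norm (norm (g x) - norm (g y)) \<le> A * norm (x - y) powr a" if "norm x \<le> R" "norm y \<le> R" for x y
    using aA(4)[OF that] norm_triangle_ineq3[of "g x" "g y"] by simp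
  then show "\<exists>a A. 0 < a \<and> a \<le> 1 \<and> 0 \<le> A \<and>
     (\<forall>x y. norm x \<le> R \<longrightarrow> norm y \<le> R \<longrightarrow> norm (norm (g x) - norm (g y)) \<le> A * norm (x - y) powr a)"
    using aA by (intro exI[of _ a] exI[of _ A]) auto
qed

lemma hoelder_loc_const: "hoelder_loc (\<lambda>_. c)"
  by (rule hoelder_locI, rule exI[of _ 1], rule exI[of _ 0]) auto

lemma hoelder_loc_minus: "hoelder_loc g \<Longrightarrow> hoelder_loc (\<lambda>x. - g x)"
  unfolding hoelder_loc_def by (simp add: norm_minus_commute)

lemma hoelder_loc_diff: "hoelder_loc f \<Longrightarrow> hoelder_loc g \<Longrightarrow> hoelder_loc (\<lambda>x. f x - g x)"
  using hoelder_loc_add[OF _ hoelder_loc_minus, of f g] by simp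

lemma hoelder_locI_lipschitz:
  assumes "\<And>R. 0 < R \<Longrightarrow> \<exists>A\<ge>0. \<forall>x y. norm x \<le> R \<longrightarrow> norm y \<le> R \<longrightarrow> norm (g x - g y) \<le> A * norm (x - y)"
  shows "hoelder_loc g"
proof (rule hoelder_locI)
  fix R :: real assume "0 < R"
  then obtain A where "A \<ge> 0" "\<forall>x y. norm x \<le> R \<longrightarrow> norm y \<le> R \<longrightarrow> norm (g x - g y) \<le> A * norm (x - y)"
    using assms by blast
  then show "\<exists>a A. 0 < a \<and> a \<le> 1 \<and> 0 \<le> A \<and>
     (\<forall>x y. norm x \<le> R \<longrightarrow> norm y \<le> R \<longrightarrow> norm (g x - g y) \<le> A * norm (x - y) powr a)"
    by (intro exI[of _ 1] exI[of _ A]) auto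
qed

lemma hoelder_loc_C1:
  fixes f :: "'a::euclidean_space \<Rightarrow> 'b::real_normed_vector"
  assumes d: "\<And>x. (f has_derivative f' x) (at x)" and c: "\<And>h. continuous_on UNIV (\<lambda>x. f' x h)"
  shows "hoelder_loc f"
proof (rule hoelder_locI_lipschitz)
  fix R :: real
  have "\<exists>B. 0 \<le> B \<and> (\<forall>x. norm x \<le> R \<longrightarrow> norm (f' x b) \<le> B)" for b
    by (rule continuous_bounded_on_ball[OF c[of b], of R]) blast
  then obtain B where B: "\<And>b. 0 \<le> B b" "\<And>b x. norm x \<le> R \<Longrightarrow> norm (f' x b) \<le> B b" by metis
  have on: "onorm (f' x) \<le> (\<Sum>b\<in>Basis. B b)" if "x \<in> cball 0 R" for x
  proof (rule onorm_bound)
    fix h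
    interpret bounded_linear "f' x" by (rule has_derivative_bounded_linear[OF d])
    have "f' x h = f' x (\<Sum>b\<in>Basis. (h \<bullet> b) *\<^sub>R b)" by (simp add: euclidean_representation)
    also have "\<dots> = (\<Sum>b\<in>Basis. (h \<bullet> b) *\<^sub>R f' x b)" by (simp add: sum scale)
    also have "norm \<dots> \<le> (\<Sum>b\<in>Basis. norm h * B b)"
      using B that by (intro sum_norm_le) (auto intro!: mult_mono Basis_le_norm)
    finally show "norm (f' x h) \<le> (\<Sum>b\<in>Basis. B b) * norm h" by (simp add: sum_distrib_left mult.commute)
  qed (use B in \<open>auto intro: sum_nonneg\<close>)
  have "norm (f x - f y) \<le> (\<Sum>b\<in>Basis. B b) * norm (x - y)" if "norm x \<le> R" "norm y \<le> R" for x y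
    by (rule differentiable_bound[of "cball 0 R", OF _ has_derivative_at_withinI[OF d] on]) (use that in auto)
  then show "\<exists>A\<ge>0. \<forall>x y. norm x \<le> R \<longrightarrow> norm y \<le> R \<longrightarrow> norm (f x - f y) \<le> A * norm (x - y)"
    using B by (intro exI[of _ "\<Sum>b\<in>Basis. B b"]) (auto intro: sum_nonneg)
qed

section \<open>Twice differentiable functions and the maximum principle\<close>

definition twice_diff :: "('a::euclidean_space \<Rightarrow> real) \<Rightarrow> ('a \<Rightarrow> 'a) \<Rightarrow> ('a \<Rightarrow> 'a \<Rightarrow> 'a) \<Rightarrow> bool" where
  "twice_diff u g H \<longleftrightarrow> (\<forall>x. (u has_derivative (\<lambda>h. g x \<bullet> h)) (at x)) \<and> (\<forall>x. (g has_derivative H x) (at x))"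

text \<open>Continuity of the Hessian is kept apart from \<open>twice_diff\<close>: the maximum
  principle uses second derivatives only at one point, and the radial barriers enter it in that
  weaker form.\<close>

definition C2 :: "('a::euclidean_space \<Rightarrow> real) \<Rightarrow> ('a \<Rightarrow> 'a) \<Rightarrow> ('a \<Rightarrow> 'a \<Rightarrow> 'a) \<Rightarrow> bool" where
  "C2 u g H \<longleftrightarrow> twice_diff u g H \<and> (\<forall>h. continuous_on UNIV (\<lambda>x. H x h))"

text \<open>Applied to the Hessian \<open>H x\<close>, this is the Laplacian at x.\<close>

definition lin_trace :: "('a::euclidean_space \<Rightarrow> 'a) \<Rightarrow> real" where
  "lin_trace L = (\<Sum>b\<in>Basis. L b \<bullet> b)"

lemma lin_trace_add: "lin_trace (\<lambda>h. L h + K h) = lin_trace L + lin_trace K"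
  and lin_trace_diff: "lin_trace (\<lambda>h. L h - K h) = lin_trace L - lin_trace K"
  and lin_trace_scaleR: "lin_trace (\<lambda>h. c *\<^sub>R L h) = c * lin_trace L"
  by (simp_all add: lin_trace_def inner_add_left inner_diff_left sum.distrib sum_subtractf sum_distrib_left)

lemma twice_diff_continuous:
  assumes "twice_diff u g H"
  shows "continuous_on S u" "continuous_on S g"
proof -
  show "continuous_on S u"
    using assms unfolding twice_diff_def
    by (intro has_derivative_continuous_on[of _ _ "\<lambda>x h. g x \<bullet> h"]) (auto intro: has_derivative_at_withinI)
  show "continuous_on S g"
    using assms unfolding twice_diff_def
    by (intro has_derivative_continuous_on[of _ _ H]) (auto intro: has_derivative_at_withinI)
qed

lemma C2_hoelder:
  assumes "C2 u g H"
  shows "hoelder_loc u" "hoelder_loc g"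
proof -
  have t: "twice_diff u g H" using assms by (simp add: C2_def)
  show "hoelder_loc u"
    using t by (intro hoelder_loc_C1[of u "\<lambda>x h. g x \<bullet> h"])
      (auto simp: twice_diff_def intro!: continuous_intros twice_diff_continuous(2)[OF t])
  show "hoelder_loc g"
    using assms by (intro hoelder_loc_C1[of g H]) (auto simp: C2_def twice_diff_def)
qed

lemma twice_diff_diff:
  assumes "twice_diff u g H" "twice_diff v k K"
  shows "twice_diff (\<lambda>x. u x - v x) (\<lambda>x. g x - k x) (\<lambda>x h. H x h - K x h)"
proof -
  have "((\<lambda>x. u x - v x) has_derivative (\<lambda>h. g x \<bullet> h - k x \<bullet> h)) (at x)" for x
    using assms unfolding twice_diff_def by (intro has_derivative_diff) blast+
  moreover have "((\<lambda>x. g x - k x) has_derivative (\<lambda>h. H x h - K x h)) (at x)" for x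
    using assms unfolding twice_diff_def by (intro has_derivative_diff) blast+
  ultimately show ?thesis by (simp add: twice_diff_def inner_diff_left)
qed

lemma twice_diff_scale:
  assumes "twice_diff u g H"
  shows "twice_diff (\<lambda>x. c * u x) (\<lambda>x. c *\<^sub>R g x) (\<lambda>x h. c *\<^sub>R H x h)"
proof -
  have "((\<lambda>x. c * u x) has_derivative (\<lambda>h. c * (g x \<bullet> h))) (at x)" for x
    using assms unfolding twice_diff_def by (intro has_derivative_mult_right) blast
  moreover have "((\<lambda>x. c *\<^sub>R g x) has_derivative (\<lambda>h. c *\<^sub>R H x h)) (at x)" for x
    using assms unfolding twice_diff_def by (intro has_derivative_scaleR_right) blast
  ultimately show ?thesis by (simp add: twice_diff_def)
qed

text \<open>The second derivative is required at 0 only. Were c positive, the first derivative, zero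
  at 0, would be positive just to the right of it, and \<phi> would increase there.\<close>

lemma local_max_second_derivative:
  fixes \<phi> \<phi>' :: "real \<Rightarrow> real"
  assumes e: "0 < e" and d: "\<And>t. \<bar>t\<bar> < e \<Longrightarrow> (\<phi> has_real_derivative \<phi>' t) (at t)"
    and d2: "(\<phi>' has_real_derivative c) (at 0)" and mx: "\<And>t. \<bar>t\<bar> < e \<Longrightarrow> \<phi> t \<le> \<phi> 0"
  shows "\<phi>' 0 = 0" "c \<le> 0"
proof -
  show z: "\<phi>' 0 = 0"
    by (rule DERIV_local_max[OF d[of 0] e]) (use e mx in auto)
  show "c \<le> 0"
  proof (rule ccontr)
    assume "\<not> c \<le> 0"
    then obtain r where r: "r > 0" "\<And>h. 0 < h \<Longrightarrow> h < r \<Longrightarrow> \<phi>' 0 < \<phi>' (0 + h)"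
      using DERIV_pos_inc_right[OF d2] by (metis not_le)
    define t where "t = min (r / 2) (e / 2)"
    have t: "0 < t" "t < r" "t < e" using r e by (auto simp: t_def)
    have "\<phi> 0 < \<phi> t"
    proof (rule DERIV_pos_imp_increasing_open[OF t(1)])
      show "\<exists>y. (\<phi> has_real_derivative y) (at x) \<and> 0 < y" if "0 < x" "x < t" for x
        using d[of x] r(2)[of x] that t z by auto
      show "continuous_on {0..t} \<phi>"
        by (rule continuous_at_imp_continuous_on) (use t in \<open>auto intro: DERIV_isCont[OF d]\<close>)
    qed
    with mx[of t] t show False by simp
  qed
qed

lemma twice_diff_line:
  assumes "twice_diff u g H"
  shows "((\<lambda>t. u (x + t *\<^sub>R h)) has_real_derivative g (x + t *\<^sub>R h) \<bullet> h) (at t)"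
    and "((\<lambda>t. g (x + t *\<^sub>R h) \<bullet> k) has_real_derivative H (x + t *\<^sub>R h) h \<bullet> k) (at t)"
proof -
  have l: "((\<lambda>t. x + t *\<^sub>R h) has_derivative (\<lambda>s. s *\<^sub>R h)) (at t)"
    by (auto intro!: derivative_eq_intros)
  have "((\<lambda>t. u (x + t *\<^sub>R h)) has_derivative (\<lambda>s. g (x + t *\<^sub>R h) \<bullet> (s *\<^sub>R h))) (at t)"
    by (rule has_derivative_compose[OF l]) (use assms in \<open>auto simp: twice_diff_def\<close>)
  then show "((\<lambda>t. u (x + t *\<^sub>R h)) has_real_derivative g (x + t *\<^sub>R h) \<bullet> h) (at t)"
    by (simp add: has_field_derivative_def mult_commute_abs)
  have d: "(g has_derivative H (x + t *\<^sub>R h)) (at (x + t *\<^sub>R h))" using assms by (auto simp: twice_diff_def)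
  have "((\<lambda>t. g (x + t *\<^sub>R h)) has_derivative (\<lambda>s. H (x + t *\<^sub>R h) (s *\<^sub>R h))) (at t)"
    by (rule has_derivative_compose[OF l d])
  then have "((\<lambda>t. g (x + t *\<^sub>R h) \<bullet> k) has_derivative (\<lambda>s. H (x + t *\<^sub>R h) (s *\<^sub>R h) \<bullet> k)) (at t)"
    by (rule has_derivative_inner_left)
  then show "((\<lambda>t. g (x + t *\<^sub>R h) \<bullet> k) has_real_derivative H (x + t *\<^sub>R h) h \<bullet> k) (at t)"
    using linear_cmul[OF bounded_linear.linear[OF has_derivative_bounded_linear[OF d]]]
    by (simp add: has_field_derivative_def mult_commute_abs)
qed

lemma twice_diff_max:
  assumes t: "twice_diff u g H" and mx: "\<And>x. u x \<le> u x0"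
  shows "g x0 = 0" "lin_trace (H x0) \<le> 0"
proof -
  have 1: "g x0 \<bullet> h = 0" and 2: "H x0 h \<bullet> h \<le> 0" for h
    using local_max_second_derivative[of 1 "\<lambda>t. u (x0 + t *\<^sub>R h)" "\<lambda>t. g (x0 + t *\<^sub>R h) \<bullet> h" "H x0 h \<bullet> h"]
      twice_diff_line(1)[OF t, of x0 h] twice_diff_line(2)[OF t, of x0 h h 0] mx by auto
  show "g x0 = 0" using 1[of "g x0"] by simp
  show "lin_trace (H x0) \<le> 0" unfolding lin_trace_def using 2 by (auto intro: sum_nonpos)
qed

lemma attains_max_outside:
  fixes v :: "'a::euclidean_space \<Rightarrow> real"
  assumes c: "continuous_on UNIV v" and R: "\<And>x. R < norm x \<Longrightarrow> v x \<le> v x1"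
  obtains x0 where "\<And>x. v x \<le> v x0"
proof -
  have "\<exists>x\<in>cball 0 (max R (norm x1)). \<forall>y\<in>cball 0 (max R (norm x1)). v y \<le> v x"
    by (rule continuous_attains_sup) (auto intro: continuous_on_subset[OF c] simp: ball_eq_empty intro!: exI[of _ x1])
  then obtain x0 where "\<forall>y\<in>cball 0 (max R (norm x1)). v y \<le> v x0" by blast
  then have x0: "\<And>y. norm y \<le> max R (norm x1) \<Longrightarrow> v y \<le> v x0" by (simp add: mem_cball_0)
  show ?thesis
  proof (rule that[of x0])
    fix x
    show "v x \<le> v x0"
    proof (cases "norm x \<le> max R (norm x1)")
      case False
      then have "v x \<le> v x1" by (intro R) auto
      also have "\<dots> \<le> v x0" by (intro x0) auto
      finally show ?thesis .
    qed (rule x0)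
  qed
qed

text \<open>A smooth substitute for the norm: it grows at least like |x|, its gradient has norm at
  most 1 and its Laplacian is at most N, so a small multiple of it is a harmless penalty at
  infinity.\<close>

definition bracket :: "'a::euclidean_space \<Rightarrow> real" where
  "bracket x = sqrt (1 + x \<bullet> x)"

lemma bracket_pos: "0 < bracket x" and bracket_ge_1: "1 \<le> bracket x" and bracket_ge_norm: "norm x \<le> bracket x"
  by (auto simp: bracket_def norm_eq_sqrt_inner add_pos_nonneg)

lemma twice_diff_bracket:
  "twice_diff bracket (\<lambda>x. (1 / bracket x) *\<^sub>R x)
     (\<lambda>x h. (1 / bracket x) *\<^sub>R h - ((x \<bullet> h) / bracket x ^ 3) *\<^sub>R x)"
proof -
  have p: "0 < 1 + x \<bullet> x" for x :: 'a by (simp add: add_pos_nonneg)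
  have d: "(bracket has_derivative (\<lambda>h. (x \<bullet> h) / bracket x)) (at x)" for x :: 'a
    unfolding bracket_def[abs_def] using p[of x]
    by (auto intro!: derivative_eq_intros simp: inner_commute field_simps)
  have "((\<lambda>x. (1 / bracket x) *\<^sub>R x) has_derivative (\<lambda>h. (1 / bracket x) *\<^sub>R h - ((x \<bullet> h) / bracket x ^ 3) *\<^sub>R x)) (at x)" for x :: 'a
    using bracket_pos[of x]
    by (auto intro!: derivative_eq_intros d simp: fun_eq_iff power3_eq_cube divide_simps)
  with d show ?thesis by (simp add: twice_diff_def)
qed

text \<open>Subtracting \<epsilon> times \<open>bracket\<close> makes u - w attain its maximum
  although it is only bounded above. There the gradients and Laplacians of u and w differ by at most
  \<epsilon> and \<epsilon> N, which the zeroth-order term with l > 0 beats for small \<epsilon>.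
  The case m = 1 is the nonlinear equation, m = 0 the linear resolvent equation.\<close>

theorem comparison:
  fixes u w :: "'a::euclidean_space \<Rightarrow> real"
  assumes u: "twice_diff u gu Hu" and w: "twice_diff w gw Hw"
    and bdd: "\<And>x. u x - w x \<le> B" and l: "0 < l" and m: "0 \<le> m"
    and ineq: "\<And>x. l * u x - lin_trace (Hu x) - m * norm (gu x) \<le> l * w x - lin_trace (Hw x) - m * norm (gw x)"
  shows "u x \<le> w x"
proof (rule ccontr)
  let ?N = "real DIM('a)"
  define d where "d = u x - w x"
  assume "\<not> u x \<le> w x"
  then have d: "0 < d" by (simp add: d_def)
  \<comment> \<open>The total cost of the penalty per unit of \<epsilon>: N from its Laplacian, m
    from its gradient, and l times its value at the point x where u exceeds w by d. The choice of
    \<epsilon> makes this half of l d.\<close>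
  define Q where "Q = ?N + m + l * bracket x"
  have Q: "0 < Q" using m l bracket_pos[of x] by (simp add: Q_def add_pos_nonneg)
  define \<epsilon> where "\<epsilon> = l * d / (2 * Q)"
  have \<epsilon>: "0 < \<epsilon>" using l d Q by (simp add: \<epsilon>_def)
  define v where "v y = (u y - w y) - \<epsilon> * bracket y" for y
  have t: "twice_diff v (\<lambda>x. (gu x - gw x) - \<epsilon> *\<^sub>R ((1 / bracket x) *\<^sub>R x))
      (\<lambda>x h. (Hu x h - Hw x h) - \<epsilon> *\<^sub>R ((1 / bracket x) *\<^sub>R h - ((x \<bullet> h) / bracket x ^ 3) *\<^sub>R x))"
    unfolding v_def by (intro twice_diff_diff u w twice_diff_scale twice_diff_bracket)
  obtain x0 where x0: "\<And>y. v y \<le> v x0"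
  proof (rule attains_max_outside[of v "(B - v x) / \<epsilon>" x])
    show "continuous_on UNIV v" by (rule twice_diff_continuous[OF t])
    fix y :: 'a assume "(B - v x) / \<epsilon> < norm y"
    then have "B - v x < \<epsilon> * norm y" using \<epsilon> by (simp add: field_simps)
    also have "\<dots> \<le> \<epsilon> * bracket y" using \<epsilon> bracket_ge_norm by (intro mult_left_mono) auto
    finally show "v y \<le> v x" using bdd[of y] by (simp add: v_def)
  qed blast
  have g0: "gu x0 - gw x0 = \<epsilon> *\<^sub>R ((1 / bracket x0) *\<^sub>R x0)" using twice_diff_max(1)[OF t x0] by simp
  have tr: "lin_trace (Hu x0) - lin_trace (Hw x0) \<le> \<epsilon> * lin_trace (\<lambda>h. (1 / bracket x0) *\<^sub>R h - ((x0 \<bullet> h) / bracket x0 ^ 3) *\<^sub>R x0)"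
    using twice_diff_max(2)[OF t x0] by (simp add: lin_trace_diff lin_trace_scaleR)
  have "lin_trace (\<lambda>h. (1 / bracket x0) *\<^sub>R h - ((x0 \<bullet> h) / bracket x0 ^ 3) *\<^sub>R x0)
      = ?N / bracket x0 - (\<Sum>b\<in>Basis. (x0 \<bullet> b) * (x0 \<bullet> b)) / bracket x0 ^ 3"
    by (simp add: lin_trace_def inner_diff_left sum_subtractf sum_divide_distrib)
  also have "\<dots> \<le> ?N / bracket x0" using bracket_pos[of x0] by (auto intro!: divide_nonneg_pos sum_nonneg)
  also have "\<dots> \<le> ?N" using bracket_ge_1[of x0] by (simp add: divide_le_eq mult_le_cancel_left1)
  finally have "lin_trace (\<lambda>h. (1 / bracket x0) *\<^sub>R h - ((x0 \<bullet> h) / bracket x0 ^ 3) *\<^sub>R x0) \<le> ?N" .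
  then have tr2: "lin_trace (Hu x0) - lin_trace (Hw x0) \<le> \<epsilon> * ?N"
    using \<epsilon> by (intro order_trans[OF tr] mult_left_mono) auto
  have "norm ((1 / bracket x0) *\<^sub>R x0) \<le> 1"
    using bracket_ge_norm[of x0] bracket_pos[of x0] by (simp add: divide_le_eq)
  from mult_left_mono[OF this, of \<epsilon>] have "norm (gu x0 - gw x0) \<le> \<epsilon> * 1" unfolding g0 using \<epsilon> by simp
  then have gr: "norm (gu x0) - norm (gw x0) \<le> \<epsilon>" using norm_triangle_ineq2[of "gu x0" "gw x0"] by linarith
  have "0 \<le> \<epsilon> * bracket x0" using \<epsilon> bracket_pos[of x0] by simp
  moreover have "v x \<le> v x0" by (rule x0)
  ultimately have "d - \<epsilon> * bracket x \<le> u x0 - w x0"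
    by (simp add: v_def d_def)
  then have "l * (d - \<epsilon> * bracket x) \<le> l * (u x0 - w x0)" using l by (intro mult_left_mono) auto
  also have "\<dots> \<le> (lin_trace (Hu x0) - lin_trace (Hw x0)) + m * (norm (gu x0) - norm (gw x0))"
    using ineq[of x0] by (simp add: algebra_simps)
  also have "\<dots> \<le> \<epsilon> * ?N + m * \<epsilon>" by (intro add_mono tr2 mult_left_mono gr m)
  finally have "l * d \<le> \<epsilon> * Q" by (simp add: Q_def algebra_simps)
  also have "\<dots> = l * d / 2" using Q by (simp add: \<epsilon>_def)
  finally show False using l d by simp
qed

text \<open>The unknown of the fixed-point problem is the gradient field V = grad (l -
  Laplacian)^(-1) (|V| + g) in the bounded continuous fields; the smallness hypothesis makes the map
  a contraction with factor 1/2. A fixed point is a gradient of a resolvent, hence Hoelder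
  continuous, so the source |V| + g is Hoelder too and the second derivatives exist.\<close>

theorem nonlinear_resolvent:
  fixes g :: "'a::euclidean_space \<Rightarrow> real"
  assumes l: "0 < l" and small: "grad_const TYPE('a) * res_mass l (-1) \<le> 1 / 2"
    and gh: "hoelder_loc g" and gb: "\<And>x. \<bar>g x\<bar> \<le> M"
  obtains u gu Hu B where "C2 u gu Hu" "\<And>x. \<bar>u x\<bar> \<le> B" "\<And>x. l * u x - lin_trace (Hu x) - norm (gu x) = g x"
proof -
  have gc: "continuous_on UNIV g" by (rule hoelder_loc_continuous[OF gh])
  define G where "G V x = norm (apply_bcontfun V x) + g x" for V :: "'a \<Rightarrow>\<^sub>C 'a" and x
  have Gc: "continuous_on UNIV (G V)" for V unfolding G_def by (intro continuous_intros gc) auto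
  have Gb: "\<bar>G V x\<bar> \<le> norm V + M" for V x
    using gb[of x] norm_bounded[of V x] norm_ge_zero[of "apply_bcontfun V x"] unfolding G_def by linarith
  define T where "T V = Bcontfun (res_grad l (G V))" for V
  have T: "apply_bcontfun (T V) = res_grad l (G V)" for V
    unfolding T_def
  proof (rule Bcontfun_inverse, rule bcontfun_normI)
    show "continuous_on UNIV (res_grad l (G V))"
      by (rule hoelder_loc_continuous[OF hoelder_loc_res_grad[OF Gc Gb l]])
    show "norm (res_grad l (G V) x) \<le> (norm V + M) * grad_const TYPE('a) * res_mass l (-1)" for x
      by (rule res_grad_norm_le[OF Gc Gb l])
  qed
  have "\<exists>!V. T V = V"
  proof (rule banach_fix_type[where c="1/2"])
    show "\<forall>V W. dist (T V) (T W) \<le> 1 / 2 * dist V W"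
    proof (intro allI dist_bound)
      fix V W x
      have "\<bar>G V x - G W x\<bar> \<le> dist V W" for x
        using norm_triangle_ineq3[of "apply_bcontfun V x" "apply_bcontfun W x"] dist_bounded[of V x W] by (simp add: dist_norm G_def)
      then have "dist (T V x) (T W x) \<le> dist V W * grad_const TYPE('a) * res_mass l (-1)"
        unfolding T dist_norm by (rule res_grad_diff_le[OF Gc Gb Gc Gb _ l])
      also have "\<dots> = dist V W * (grad_const TYPE('a) * res_mass l (-1))" by simp
      also have "\<dots> \<le> dist V W * (1 / 2)" using small by (rule mult_left_mono) simp
      finally show "dist (T V x) (T W x) \<le> 1 / 2 * dist V W" by simp
    qed
  qed auto
  then obtain V where V: "T V = V" by blast
  then have VV: "apply_bcontfun V = res_grad l (G V)" using T by metis
  have "hoelder_loc (apply_bcontfun V)" unfolding VV by (rule hoelder_loc_res_grad[OF Gc Gb l])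
  then have Gh: "hoelder_loc (G V)" unfolding G_def[abs_def] by (intro hoelder_loc_add hoelder_loc_norm gh)
  show ?thesis
  proof (rule that[of "resolvent l (G V)" "res_grad l (G V)" "res_hess l (G V)" "(norm V + M) * res_mass l 0"])
    show "C2 (resolvent l (G V)) (res_grad l (G V)) (res_hess l (G V))"
      unfolding C2_def twice_diff_def
      using resolvent_has_derivative[OF Gc Gb l] res_grad_has_derivative[OF Gc Gb l Gh] res_hess_continuous[OF Gc Gb l Gh] by blast
    show "\<bar>resolvent l (G V) x\<bar> \<le> (norm V + M) * res_mass l 0" for x by (rule resolvent_abs_le[OF Gc Gb l])
    show "l * resolvent l (G V) x - lin_trace (res_hess l (G V) x) - norm (res_grad l (G V) x) = g x" for x
      using res_equation[OF Gc Gb l Gh, of x] fun_cong[OF VV, of x] by (simp add: lin_trace_def G_def)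
  qed
qed

section \<open>Interior gradient bound and cutoff functions\<close>

text \<open>The map b -> b - 2 (b . e) e is the reflection in the hyperplane orthogonal to the unit
  vector e, and the trace is invariant under orthogonal changes of basis.\<close>

lemma lin_trace_reflection:
  fixes e :: "'a::euclidean_space"
  assumes L: "linear L" and e: "norm e = 1"
  shows "(\<Sum>b\<in>Basis. L (b - (2 * (b \<bullet> e)) *\<^sub>R e) \<bullet> (b - (2 * (b \<bullet> e)) *\<^sub>R e)) = lin_trace L"
proof -
  interpret linear L by fact
  have ee: "e \<bullet> e = 1" using e by (simp add: norm_eq_1)
  have "(\<Sum>b\<in>Basis. (b \<bullet> e) *\<^sub>R L b) = L (\<Sum>b\<in>Basis. (e \<bullet> b) *\<^sub>R b)"
    by (simp add: sum scale inner_commute)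
  then have 1: "(\<Sum>b\<in>Basis. (b \<bullet> e) *\<^sub>R L b) = L e" by (simp add: euclidean_representation)
  have 2: "(\<Sum>b\<in>Basis. (b \<bullet> e) * (L b \<bullet> e)) = L e \<bullet> e"
    using arg_cong[OF 1, of "\<lambda>v. v \<bullet> e"] by (simp add: inner_sum_left)
  have 3: "(\<Sum>b\<in>Basis. (b \<bullet> e) * (L e \<bullet> b)) = L e \<bullet> e"
    by (subst euclidean_inner[of "L e" e]) (simp add: inner_commute mult.commute)
  have 4: "(\<Sum>b\<in>Basis. (b \<bullet> e) * (b \<bullet> e)) = 1"
    using ee euclidean_inner[of e e] by (simp add: inner_commute)
  have "(\<Sum>b\<in>Basis. L (b - (2 * (b \<bullet> e)) *\<^sub>R e) \<bullet> (b - (2 * (b \<bullet> e)) *\<^sub>R e))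
     = (\<Sum>b\<in>Basis. L b \<bullet> b - 2 * ((b \<bullet> e) * (L b \<bullet> e)) - 2 * ((b \<bullet> e) * (L e \<bullet> b)) + 4 * ((b \<bullet> e) * (b \<bullet> e)) * (L e \<bullet> e))"
    by (intro sum.cong refl) (simp add: diff scale inner_diff_left inner_diff_right algebra_simps)
  also have "\<dots> = lin_trace L - 2 * (L e \<bullet> e) - 2 * (L e \<bullet> e) + 4 * 1 * (L e \<bullet> e)"
    by (simp add: lin_trace_def sum.distrib sum_subtractf sum_distrib_left[symmetric] sum_distrib_right[symmetric] 2 3 4)
  finally show ?thesis by simp
qed

text \<open>The first-order term $|\nabla u|$ drops out of the doubling-of-variables argument because
  $\nabla u(x) - \nabla u(y)$ is controlled at the maximum; the reflected increments
  $b - 2\langle b,e\rangle e$ make $|x - y|$ affine along the test curves.\<close>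
theorem interior_gradient_bound:
  fixes u :: "'a::euclidean_space \<Rightarrow> real"
  assumes t: "twice_diff u g H"
    and U: "\<And>x. norm (x - x0) \<le> 1 \<Longrightarrow> \<bar>u x\<bar> \<le> U"
    and Q: "\<And>x. norm (x - x0) \<le> 1 \<Longrightarrow> \<bar>lin_trace (H x) + norm (g x)\<bar> \<le> Q"
  shows "norm (g x0) \<le> Q + (8 * U + 1) * (DIM('a) + 1) + 16 * U + 1"
proof -
  let ?N = "real DIM('a)"
  \<comment> \<open>M is large enough that 2 U < M / 4, which confines x to distance 1/2 from x0. In
    \<open>L\<close>, the part 16 U forces |x - y| \<le> 1/4, and the excess over Q + M (N + 1)
    contradicts the second-order condition.\<close>
  define M where "M = 8 * U + 1"
  define L where "L = Q + M * (?N + 1) + 16 * U + 1"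
  have U0: "0 \<le> U" using order_trans[OF abs_ge_zero U[of x0]] by simp
  have Q0: "0 \<le> Q" using order_trans[OF abs_ge_zero Q[of x0]] by simp
  have M: "1 \<le> M" using U0 by (simp add: M_def)
  have L: "0 < L" "16 * U \<le> L" using U0 Q0 M by (auto simp: L_def add_nonneg_pos)
  \<comment> \<open>On [0, 2], which contains all distances in the unit ball, s/2 \<le> \<omega> s
    \<le> s. The strict concavity, with second derivative -1/2, is the source of the term that beats
    the bounded right-hand side.\<close>
  define \<omega> where "\<omega> s = s - s\<^sup>2 / 4" for s :: real
  define \<Phi> where "\<Phi> p = u (fst p) - u (snd p) - L * \<omega> (norm (fst p - snd p)) - M * (norm (fst p - x0))\<^sup>2" for p
  have cu: "continuous_on S u" for S by (rule twice_diff_continuous(1)[OF t])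
  have "\<exists>p\<in>cball x0 1 \<times> cball x0 1. \<forall>q\<in>cball x0 1 \<times> cball x0 1. \<Phi> q \<le> \<Phi> p"
  proof (rule continuous_attains_sup)
    show "continuous_on (cball x0 1 \<times> cball x0 1) \<Phi>"
      unfolding \<Phi>_def \<omega>_def by (intro continuous_intros continuous_on_compose2[OF cu[of UNIV]]) auto
  qed (auto intro: compact_Times)
  then obtain p where p: "p \<in> cball x0 1 \<times> cball x0 1" "\<forall>q\<in>cball x0 1 \<times> cball x0 1. \<Phi> q \<le> \<Phi> p" by blast
  define x y where "x = fst p" and "y = snd p"
  have xy: "norm (x - x0) \<le> 1" "norm (y - x0) \<le> 1"
    using p(1) by (auto simp: x_def y_def mem_Times_iff dist_norm norm_minus_commute)
  have mx: "\<Phi> (x', y') \<le> \<Phi> (x, y)" if "norm (x' - x0) \<le> 1" "norm (y' - x0) \<le> 1" for x' y'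
    using p(2)[rule_format, of "(x', y')"] that by (simp add: x_def y_def dist_norm norm_minus_commute)
  \<comment> \<open>By contradiction: a positive maximum forces the maximal pair off the diagonal
    and strictly inside the balls, so that first-order and second-order conditions are available
    there.\<close>
  have le0: "\<Phi> (x, y) \<le> 0"
  proof (rule ccontr)
    assume "\<not> \<Phi> (x, y) \<le> 0"
    then have pos: "0 < u x - u y - L * \<omega> (norm (x - y)) - M * (norm (x - x0))\<^sup>2" by (simp add: \<Phi>_def)
    define s where "s = norm (x - y)"
    have s2: "s \<le> 2" using norm_triangle_ineq4[of "x - x0" "y - x0"] xy by (simp add: s_def)
    have s0: "0 \<le> s" by (simp add: s_def)
    have "s * s \<le> s * 2" using s2 s0 by (rule mult_left_mono)
    then have \<omega>s: "s / 2 \<le> \<omega> s" by (simp add: \<omega>_def power2_eq_square)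
    have ne: "x \<noteq> y"
    proof
      assume "x = y"
      then have "0 < - (M * (norm (x - x0))\<^sup>2)" using pos by (simp add: \<omega>_def)
      then show False using M by (simp add: mult_less_0_iff)
    qed
    then have spos: "0 < s" by (simp add: s_def)
    have uu: "u x - u y \<le> 2 * U" using U[OF xy(1)] U[OF xy(2)] by linarith
    have a1: "M * (norm (x - x0))\<^sup>2 < 2 * U"
      using pos uu L \<omega>s s0 mult_nonneg_nonneg[of L "\<omega> s"] unfolding s_def by linarith
    have xh: "norm (x - x0) \<le> 1 / 2"
    proof (rule power2_le_imp_le)
      have "4 * (U * (norm (x - x0))\<^sup>2) \<ge> 0" using U0 by simp
      have "(8 * U + 1) * (norm (x - x0))\<^sup>2 \<le> (8 * U + 1) * (1/4)" using a1 by (simp add: M_def)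
      then show "(norm (x - x0))\<^sup>2 \<le> (1 / 2)\<^sup>2" using U0 by (simp add: mult_le_cancel_left power2_eq_square)
    qed simp
    have "L * (s / 2) \<le> L * \<omega> s" using \<omega>s L by (intro mult_left_mono) auto
    moreover have "0 \<le> M * (norm (x - x0))\<^sup>2" using M by simp
    ultimately have "L * (s / 2) \<le> 2 * U" using pos uu unfolding s_def by linarith
    then have "L * s \<le> 4 * U" by simp
    also have "\<dots> \<le> L * (1 / 4)" using L by simp
    finally have s4: "s \<le> 1 / 4" using L by simp
    have yh: "norm (y - x0) \<le> 3 / 4"
      using norm_triangle_ineq[of "x - x0" "y - x"] xh s4 by (simp add: s_def norm_minus_commute)
    \<comment> \<open>Moving both points by the same vector leaves x - y unchanged, so only the
      localising square contributes. Increments of length at most 1/4 stay admissible, since y is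
      within 3/4 of x0.\<close>
    have gg: "g x - g y = (2 * M) *\<^sub>R (x - x0)"
    proof -
      have "(g x - g y - (2 * M) *\<^sub>R (x - x0)) \<bullet> h = 0" for h
      proof (cases "h = 0")
        case False
        define e where "e = 1 / (4 * norm h)"
        have quad: "((\<lambda>r. (x + r *\<^sub>R h - x0) \<bullet> (x + r *\<^sub>R h - x0)) has_real_derivative 2 * ((x - x0) \<bullet> h)) (at 0)"
        proof -
          have eq: "(\<lambda>r. (x + r *\<^sub>R h - x0) \<bullet> (x + r *\<^sub>R h - x0))
              = (\<lambda>r. (x - x0) \<bullet> (x - x0) + 2 * r * ((x - x0) \<bullet> h) + r\<^sup>2 * (h \<bullet> h))"
            by (auto simp: fun_eq_iff inner_diff_left inner_diff_right inner_add_left inner_add_right inner_commute power2_eq_square algebra_simps)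
          show ?thesis unfolding eq by (auto intro!: derivative_eq_intros)
        qed
        define \<phi> where "\<phi> r = u (x + r *\<^sub>R h) - u (y + r *\<^sub>R h) - L * \<omega> s - M * ((x + r *\<^sub>R h - x0) \<bullet> (x + r *\<^sub>R h - x0))" for r
        have "(\<phi> has_real_derivative (g (x + 0 *\<^sub>R h) \<bullet> h - g (y + 0 *\<^sub>R h) \<bullet> h - M * (2 * ((x - x0) \<bullet> h)))) (at 0)"
          unfolding \<phi>_def
          by (rule DERIV_cong[OF DERIV_diff[OF DERIV_diff[OF DERIV_diff[OF twice_diff_line(1)[OF t, of x h 0]
              twice_diff_line(1)[OF t, of y h 0]] DERIV_const[of "L * \<omega> s"]] DERIV_cmult[OF quad, of M]]]) simp
        moreover have "0 < e" using False by (simp add: e_def)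
        moreover have "\<forall>r. \<bar>0 - r\<bar> < e \<longrightarrow> \<phi> r \<le> \<phi> 0"
        proof (intro allI impI)
          fix r assume "\<bar>0 - r\<bar> < e"
          then have "norm (r *\<^sub>R h) \<le> 1 / 4" using False by (simp add: e_def field_simps)
          then have "norm (x + r *\<^sub>R h - x0) \<le> 1" "norm (y + r *\<^sub>R h - x0) \<le> 1"
            using norm_triangle_ineq[of "x - x0" "r *\<^sub>R h"] norm_triangle_ineq[of "y - x0" "r *\<^sub>R h"] xh yh
            by (simp_all add: algebra_simps)
          from mx[OF this] show "\<phi> r \<le> \<phi> 0"
            by (simp add: \<phi>_def \<Phi>_def s_def power2_norm_eq_inner)
        qed
        ultimately have "g (x + 0 *\<^sub>R h) \<bullet> h - g (y + 0 *\<^sub>R h) \<bullet> h - M * (2 * ((x - x0) \<bullet> h)) = 0"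
          by (rule DERIV_local_max)
        then show ?thesis by (simp add: inner_diff_left)
      qed simp
      from this[of "g x - g y - (2 * M) *\<^sub>R (x - x0)"] show ?thesis by simp
    qed
    have "norm (g x - g y) \<le> 2 * M * 1"
      unfolding gg norm_scaleR using xy M by (intro mult_mono) auto
    then have gn: "norm (g x) - norm (g y) \<le> 2 * M" using norm_triangle_ineq2[of "g x" "g y"] by linarith
    define e where "e = (1 / s) *\<^sub>R (x - y)"
    have e1: "norm e = 1" using spos by (simp add: e_def s_def)
    have xye: "x - y = s *\<^sub>R e" using spos by (simp add: e_def)
    define r where "r b = b - (2 * (b \<bullet> e)) *\<^sub>R e" for b
    \<comment> \<open>Along these curves the concavity of \<omega> contributes 2 L (b . e)^2 and the
      localising square - 2 M. The squares (b . e)^2 add up to 1 over the basis, which leaves 2 L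
      against 2 M N.\<close>
    have second: "H x b \<bullet> b - H y (r b) \<bullet> r b + 2 * L * (b \<bullet> e)\<^sup>2 - 2 * M \<le> 0" if b: "b \<in> Basis" for b
    proof -
      define c where "c = b \<bullet> e"
      have nb: "norm b = 1" using b by simp
      have c1: "\<bar>c\<bar> \<le> 1" using Cauchy_Schwarz_ineq2[of b e] nb e1 by (simp add: c_def)
      have nr: "norm (r b) = 1"
      proof -
        have "r b \<bullet> r b = 1"
          using nb e1 by (simp add: r_def norm_eq_1 inner_diff_left inner_diff_right inner_commute algebra_simps)
        then show ?thesis by (simp add: norm_eq_1)
      qed
      define \<phi> where "\<phi> \<tau> = u (x + \<tau> *\<^sub>R b) - u (y + \<tau> *\<^sub>R r b) - L * \<omega> (s + 2 * \<tau> * c) - M * ((x + \<tau> *\<^sub>R b - x0) \<bullet> (x + \<tau> *\<^sub>R b - x0))" for \<tau>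
      define \<phi>' where "\<phi>' \<tau> = g (x + \<tau> *\<^sub>R b) \<bullet> b - g (y + \<tau> *\<^sub>R r b) \<bullet> r b - L * (2 * c - (s + 2 * \<tau> * c) * c) - M * (2 * ((x - x0) \<bullet> b) + 2 * \<tau>)" for \<tau>
      have bb: "b \<bullet> b = 1" using nb by (simp add: norm_eq_1)
      have "H x b \<bullet> b - H y (r b) \<bullet> r b + L * (2 * c * c) - M * 2 \<le> 0"
      proof (rule local_max_second_derivative(2)[of "min (1/4) (s / 2)" \<phi> \<phi>'])
        show "(\<phi> has_real_derivative \<phi>' \<tau>) (at \<tau>)" for \<tau>
        proof -
          have \<phi>eq: "\<phi> = (\<lambda>\<tau>. u (x + \<tau> *\<^sub>R b) - u (y + \<tau> *\<^sub>R r b) - L * ((s + 2 * \<tau> * c) - (s + 2 * \<tau> * c)\<^sup>2 / 4)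
              - M * ((x - x0) \<bullet> (x - x0) + 2 * \<tau> * ((x - x0) \<bullet> b) + \<tau>\<^sup>2))"
            using bb by (auto simp: \<phi>_def \<omega>_def fun_eq_iff inner_diff_left inner_diff_right inner_add_left inner_add_right inner_commute power2_eq_square algebra_simps)
          show ?thesis unfolding \<phi>eq
            by (auto intro!: derivative_eq_intros twice_diff_line(1)[OF t] simp: \<phi>'_def algebra_simps)
        qed
        have "((\<lambda>\<tau>. g (x + \<tau> *\<^sub>R b) \<bullet> b - g (y + \<tau> *\<^sub>R r b) \<bullet> r b - L * (2 * c - (s + 2 * \<tau> * c) * c) - M * (2 * ((x - x0) \<bullet> b) + 2 * \<tau>))
            has_real_derivative (H (x + 0 *\<^sub>R b) b \<bullet> b - H (y + 0 *\<^sub>R r b) (r b) \<bullet> r b + L * (2 * c * c) - M * 2)) (at 0)"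
          by (auto intro!: derivative_eq_intros twice_diff_line(2)[OF t])
        then show "(\<phi>' has_real_derivative H x b \<bullet> b - H y (r b) \<bullet> r b + L * (2 * c * c) - M * 2) (at 0)"
          by (simp add: \<phi>'_def[abs_def])
        show "\<phi> \<tau> \<le> \<phi> 0" if \<tau>: "\<bar>\<tau>\<bar> < min (1/4) (s / 2)" for \<tau>
        proof -
          have "norm (x + \<tau> *\<^sub>R b - x0) \<le> 1" "norm (y + \<tau> *\<^sub>R r b - x0) \<le> 1"
            using norm_triangle_ineq[of "x - x0" "\<tau> *\<^sub>R b"] norm_triangle_ineq[of "y - x0" "\<tau> *\<^sub>R r b"] xh yh \<tau> nb nr
            by (simp_all add: algebra_simps)
          note m = mx[OF this]
          have "\<bar>\<tau> * c\<bar> \<le> \<bar>\<tau>\<bar> * 1" unfolding abs_mult using c1 by (intro mult_left_mono) auto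
          then have "0 \<le> s + 2 * \<tau> * c" using \<tau> by (simp add: abs_le_iff)
          moreover have "(x + \<tau> *\<^sub>R b) - (y + \<tau> *\<^sub>R r b) = (s + 2 * \<tau> * c) *\<^sub>R e"
            using xye by (simp add: r_def c_def algebra_simps)
          ultimately have "norm ((x + \<tau> *\<^sub>R b) - (y + \<tau> *\<^sub>R r b)) = s + 2 * \<tau> * c" using e1 by simp
          then show ?thesis using m by (simp add: \<Phi>_def \<phi>_def s_def[symmetric] power2_norm_eq_inner)
        qed
      qed (use spos in auto)
      then show ?thesis by (simp add: c_def power2_eq_square algebra_simps)
    qed
    have lin: "linear (H y)" using t by (auto simp: twice_diff_def intro: bounded_linear.linear has_derivative_bounded_linear)
    have "(\<Sum>b\<in>Basis. (b \<bullet> e)\<^sup>2) = 1"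
      using e1 euclidean_inner[of e e] by (simp add: norm_eq_1 inner_commute power2_eq_square)
    moreover have "(\<Sum>b\<in>Basis. H x b \<bullet> b - H y (r b) \<bullet> r b + 2 * L * (b \<bullet> e)\<^sup>2 - 2 * M) \<le> 0"
      using second by (intro sum_nonpos) auto
    ultimately have "lin_trace (H x) - lin_trace (H y) + 2 * L - 2 * M * ?N \<le> 0"
      using lin_trace_reflection[OF lin e1]
      by (simp add: sum_subtractf sum.distrib sum_distrib_left[symmetric] lin_trace_def r_def mult.commute[of "real DIM('a)"])
    moreover have "- 2 * Q - 2 * M \<le> lin_trace (H x) - lin_trace (H y)"
      using Q[OF xy(1)] Q[OF xy(2)] gn by linarith
    ultimately have "2 * L \<le> 2 * (Q + M * (?N + 1))" by (simp add: algebra_simps)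
    then show False using U0 by (simp add: L_def)
  qed
  \<comment> \<open>With the first point at x0 the localising square vanishes, and \<Phi> \<le> 0
    becomes a one-sided Lipschitz bound at x0. Tested in the direction of steepest descent it bounds
    the gradient.\<close>
  have low: "u x0 - u y' \<le> L * norm (y' - x0)" if "norm (y' - x0) \<le> 1" for y'
  proof -
    have "\<Phi> (x0, y') \<le> 0" using mx[of x0 y'] that le0 by simp
    then have "u x0 - u y' \<le> L * \<omega> (norm (y' - x0))" by (simp add: \<Phi>_def norm_minus_commute)
    also have "\<dots> \<le> L * norm (y' - x0)" using L by (intro mult_left_mono) (auto simp: \<omega>_def)
    finally show ?thesis .
  qed
  have "norm (g x0) \<le> L"
  proof (cases "g x0 = 0")
    case False
    define h where "h = - g x0 /\<^sub>R norm (g x0)"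
    have nh: "norm h = 1" using False by (simp add: h_def)
    have gh: "g x0 \<bullet> h = - norm (g x0)" using False by (simp add: h_def dot_square_norm power2_eq_square)
    have "((\<lambda>r. u (x0 + r *\<^sub>R h) + L * r) has_real_derivative g (x0 + 0 *\<^sub>R h) \<bullet> h + L) (at 0)"
      by (auto intro!: derivative_eq_intros twice_diff_line(1)[OF t])
    then have d: "((\<lambda>r. u (x0 + r *\<^sub>R h) + L * r) has_real_derivative L - norm (g x0)) (at 0)"
      by (simp add: gh)
    show ?thesis
    proof (rule ccontr)
      assume "\<not> norm (g x0) \<le> L"
      then have "L - norm (g x0) < 0" by simp
      from DERIV_neg_dec_right[OF d this] obtain \<delta> where \<delta>: "0 < \<delta>"
        "\<And>r. 0 < r \<Longrightarrow> r < \<delta> \<Longrightarrow> u (x0 + r *\<^sub>R h) + L * r < u x0" by auto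
      define r where "r = min (\<delta> / 2) 1"
      have r: "0 < r" "r < \<delta>" "r \<le> 1" using \<delta> by (auto simp: r_def)
      show False using \<delta>(2)[OF r(1,2)] low[of "x0 + r *\<^sub>R h"] r nh by simp
    qed
  qed (use L in simp)
  then show ?thesis by (simp add: L_def M_def algebra_simps)
qed

section \<open>Compositions, products and cutoff functions\<close>

lemma hoelder_loc_compose:
  fixes u :: "'a::euclidean_space \<Rightarrow> 'b::real_normed_vector" and f :: "'b \<Rightarrow> 'c::real_normed_vector"
  assumes f: "hoelder_loc f" and u: "hoelder_loc u"
  shows "hoelder_loc (\<lambda>x. f (u x))"
proof (rule hoelder_locI)
  fix R :: real
  obtain a A where aA: "0 < a" "a \<le> 1" "0 \<le> A"
    "\<And>x y. norm x \<le> R \<Longrightarrow> norm y \<le> R \<Longrightarrow> norm (u x - u y) \<le> A * norm (x - y) powr a"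
    by (rule hoelder_locE[OF u, of R]) blast
  obtain C where C: "0 \<le> C" "\<And>x. norm x \<le> R \<Longrightarrow> norm (u x) \<le> C"
    by (rule continuous_bounded_on_ball[OF hoelder_loc_continuous[OF u], of R]) blast
  obtain b B where bB: "0 < b" "b \<le> 1" "0 \<le> B"
    "\<And>x y. norm x \<le> C \<Longrightarrow> norm y \<le> C \<Longrightarrow> norm (f x - f y) \<le> B * norm (x - y) powr b"
    by (rule hoelder_locE[OF f, of C]) blast
  have "norm (f (u x) - f (u y)) \<le> (B * A powr b) * norm (x - y) powr (a * b)"
    if xy: "norm x \<le> R" "norm y \<le> R" for x y
  proof -
    have "norm (f (u x) - f (u y)) \<le> B * norm (u x - u y) powr b" using bB C xy by auto
    also have "\<dots> \<le> B * (A * norm (x - y) powr a) powr b"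
      using bB aA(4)[OF xy] by (intro mult_left_mono powr_mono2) auto
    also have "\<dots> = (B * A powr b) * norm (x - y) powr (a * b)"
      using aA by (simp add: powr_mult powr_powr)
    finally show ?thesis .
  qed
  moreover have "a * b \<le> 1" using aA bB by (simp add: mult_le_one)
  ultimately show "\<exists>a A. 0 < a \<and> a \<le> 1 \<and> 0 \<le> A \<and>
     (\<forall>x y. norm x \<le> R \<longrightarrow> norm y \<le> R \<longrightarrow> norm (f (u x) - f (u y)) \<le> A * norm (x - y) powr a)"
    using aA bB by (intro exI[of _ "a * b"] exI[of _ "B * A powr b"]) auto
qed

text \<open>The Laplacian of a cutoff enters the source of the localised equation, and the resolvent
  has second derivatives only for Hoelder sources; hence the stronger requirement on the
  Hessian.\<close>

definition C2h :: "('a::euclidean_space \<Rightarrow> real) \<Rightarrow> ('a \<Rightarrow> 'a) \<Rightarrow> ('a \<Rightarrow> 'a \<Rightarrow> 'a) \<Rightarrow> bool" where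
  "C2h u g H \<longleftrightarrow> twice_diff u g H \<and> (\<forall>h. hoelder_loc (\<lambda>x. H x h))"

lemma C2h_imp_C2: "C2h u g H \<Longrightarrow> C2 u g H"
  by (auto simp: C2h_def C2_def hoelder_loc_continuous)

lemma twice_diff_mult:
  assumes "twice_diff u g H" "twice_diff v k K"
  shows "twice_diff (\<lambda>x. u x * v x) (\<lambda>x. u x *\<^sub>R k x + v x *\<^sub>R g x)
    (\<lambda>x h. u x *\<^sub>R K x h + (g x \<bullet> h) *\<^sub>R k x + (v x *\<^sub>R H x h + (k x \<bullet> h) *\<^sub>R g x))"
proof -
  have u: "(u has_derivative (\<lambda>h. g x \<bullet> h)) (at x)" "(g has_derivative H x) (at x)"
    and v: "(v has_derivative (\<lambda>h. k x \<bullet> h)) (at x)" "(k has_derivative K x) (at x)" for x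
    using assms by (auto simp: twice_diff_def)
  have "((\<lambda>x. u x * v x) has_derivative (\<lambda>h. u x * (k x \<bullet> h) + (g x \<bullet> h) * v x)) (at x)" for x
    by (rule has_derivative_mult[OF u(1) v(1)])
  moreover have "((\<lambda>x. u x *\<^sub>R k x + v x *\<^sub>R g x) has_derivative
     (\<lambda>h. (u x *\<^sub>R K x h + (g x \<bullet> h) *\<^sub>R k x) + (v x *\<^sub>R H x h + (k x \<bullet> h) *\<^sub>R g x))) (at x)" for x
    by (intro has_derivative_add has_derivative_scaleR u v)
  ultimately show ?thesis by (simp add: twice_diff_def inner_add_left mult.commute)
qed

lemma twice_diff_compose:
  assumes u: "twice_diff u g H"
    and c: "\<And>t. (c has_real_derivative c' t) (at t)" "\<And>t. (c' has_real_derivative c'' t) (at t)"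
  shows "twice_diff (\<lambda>x. c (u x)) (\<lambda>x. c' (u x) *\<^sub>R g x) (\<lambda>x h. c' (u x) *\<^sub>R H x h + ((g x \<bullet> h) * c'' (u x)) *\<^sub>R g x)"
proof -
  have u: "(u has_derivative (\<lambda>h. g x \<bullet> h)) (at x)" "(g has_derivative H x) (at x)" for x
    using assms by (auto simp: twice_diff_def)
  have c1: "(c has_derivative (\<lambda>h. h * c' t)) (at t)" "(c' has_derivative (\<lambda>h. h * c'' t)) (at t)" for t
    using c by (simp_all add: has_field_derivative_def mult_commute_abs)
  have "((\<lambda>x. c (u x)) has_derivative (\<lambda>h. (g x \<bullet> h) * c' (u x))) (at x)" for x
    by (rule has_derivative_compose[OF u(1) c1(1)])
  moreover have "((\<lambda>x. c' (u x) *\<^sub>R g x) has_derivative (\<lambda>h. c' (u x) *\<^sub>R H x h + ((g x \<bullet> h) * c'' (u x)) *\<^sub>R g x)) (at x)" for x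
    by (rule has_derivative_scaleR[OF has_derivative_compose[OF u(1) c1(2)] u(2)])
  ultimately show ?thesis by (simp add: twice_diff_def mult.commute)
qed

lemma C2h_compose:
  assumes u: "C2h u g H" and c: "\<And>t. (c has_real_derivative c' t) (at t)" "\<And>t. (c' has_real_derivative c'' t) (at t)"
    and h: "hoelder_loc c''"
  obtains g' H' where "C2h (\<lambda>x. c (u x)) g' H'"
proof (rule that)
  have t: "twice_diff u g H" using u by (simp add: C2h_def)
  have hu: "hoelder_loc u" "hoelder_loc g" by (rule C2_hoelder[OF C2h_imp_C2[OF u]])+
  have c''c: "continuous_on UNIV c''" by (rule hoelder_loc_continuous[OF h])
  have hc': "hoelder_loc c'"
    by (rule hoelder_loc_C1[of c' "\<lambda>t h. h * c'' t"])
       (use c in \<open>auto simp: has_field_derivative_def mult_commute_abs intro!: continuous_intros c''c\<close>)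
  show "C2h (\<lambda>x. c (u x)) (\<lambda>x. c' (u x) *\<^sub>R g x) (\<lambda>x h. c' (u x) *\<^sub>R H x h + ((g x \<bullet> h) * c'' (u x)) *\<^sub>R g x)"
    unfolding C2h_def
    using u by (auto simp: C2h_def intro!: twice_diff_compose[OF t c] hoelder_loc_add
        hoelder_loc_bilinear[OF bounded_bilinear_scaleR] hoelder_loc_mult hoelder_loc_inner hoelder_loc_const
        hoelder_loc_compose[OF h] hoelder_loc_compose[OF hc'] hu)
qed

text \<open>The cubed positive part is twice differentiable with Lipschitz second derivative 6 max 0
  t, while the square has a jump there. A piecewise polynomial cutoff is therefore regular
  enough.\<close>

definition cube_plus :: "real \<Rightarrow> real" where "cube_plus t = (max 0 t) ^ 3"

lemma cube_plus_derivs: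
  "(cube_plus has_real_derivative 3 * (max 0 t)\<^sup>2) (at t)"
  "((\<lambda>t. 3 * (max 0 t)\<^sup>2) has_real_derivative 6 * max 0 t) (at t)"
proof -
  have gen: "((\<lambda>t. (max 0 t) ^ Suc (Suc n)) has_real_derivative real (Suc (Suc n)) * (max 0 t) ^ Suc n) (at t)" for n and t :: real
  proof -
    consider "t < 0" | "t > 0" | "t = 0" by linarith
    then show ?thesis
    proof cases
      case 1
      have "((\<lambda>t::real. 0) has_real_derivative 0) (at t)" by simp
      then have "((\<lambda>t. (max 0 t) ^ Suc (Suc n)) has_real_derivative 0) (at t)"
        by (rule has_field_derivative_transform_within_open[of _ _ _ "{..<0}"]) (use 1 in auto)
      then show ?thesis using 1 by simp
    next
      case 2
      have "((\<lambda>t. t ^ Suc (Suc n)) has_real_derivative real (Suc (Suc n)) * t ^ Suc n) (at t)"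
        using DERIV_pow[of "Suc (Suc n)" t] by simp
      then have "((\<lambda>t. (max 0 t) ^ Suc (Suc n)) has_real_derivative real (Suc (Suc n)) * t ^ Suc n) (at t)"
        by (rule has_field_derivative_transform_within_open[of _ _ _ "{0<..}"]) (use 2 in auto)
      then show ?thesis using 2 by simp
    next
      case 3
      have "((\<lambda>h::real. ((max 0 (0 + h)) ^ Suc (Suc n) - (max 0 0) ^ Suc (Suc n)) / h) \<longlongrightarrow> 0) (at 0)"
      proof (rule Lim_null_comparison)
        show "((\<lambda>h::real. \<bar>h\<bar> ^ Suc n) \<longlongrightarrow> 0) (at 0)"
          by (auto intro!: tendsto_eq_intros)
        show "\<forall>\<^sub>F h in at 0. norm (((max 0 (0 + h)) ^ Suc (Suc n) - (max 0 0) ^ Suc (Suc n)) / h) \<le> \<bar>h::real\<bar> ^ Suc n"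
          by (auto intro!: always_eventually simp: max_def abs_mult power_abs mult_nonpos_nonneg)
      qed
      then show ?thesis using 3 by (simp add: DERIV_def)
    qed
  qed
  show "(cube_plus has_real_derivative 3 * (max 0 t)\<^sup>2) (at t)"
    using gen[of 1 t] by (simp add: cube_plus_def[abs_def] numeral_3_eq_3 numeral_2_eq_2)
  show "((\<lambda>t. 3 * (max 0 t)\<^sup>2) has_real_derivative 6 * max 0 t) (at t)"
    using DERIV_cmult[OF gen[of 0 t], of 3] by (simp add: numeral_2_eq_2)
qed

lemma hoelder_loc_pos_part: "hoelder_loc (\<lambda>t::real. 6 * max 0 t)"
  by (rule hoelder_locI_lipschitz, rule exI[of _ 6]) (auto simp: max_def abs_if)

text \<open>The function is 1 - (1 - (2 - |x|^2/R^2)_+^3)_+^3. For |x| \<le> R the inner bracket is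
  at least 1, so the outer cube vanishes; for |x| \<ge> 2 R the inner bracket is non-positive, so
  the outer cube is 1. It is built by composing one regular step at a time.\<close>

lemma cutoff_exists:
  assumes R: "0 < (R::real)"
  obtains \<eta> g H where "C2h (\<eta> :: 'a::euclidean_space \<Rightarrow> real) g H"
    "\<And>x. norm x \<le> R \<Longrightarrow> \<eta> x = 1" "\<And>x. 2 * R \<le> norm x \<Longrightarrow> \<eta> x = 0"
proof -
  have "twice_diff (\<lambda>x::'a. x \<bullet> x) (\<lambda>x. 2 *\<^sub>R x) (\<lambda>x h. 2 *\<^sub>R h)"
    unfolding twice_diff_def
    by (auto intro!: derivative_eq_intros simp: inner_commute fun_eq_iff)
  then have 0: "C2h (\<lambda>x::'a. x \<bullet> x) (\<lambda>x. 2 *\<^sub>R x) (\<lambda>x h. 2 *\<^sub>R h)"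
    by (auto simp: C2h_def hoelder_loc_const)
  have d1: "((\<lambda>t. 2 - t / R\<^sup>2) has_real_derivative - (1 / R\<^sup>2)) (at t)" for t
    using R by (auto intro!: derivative_eq_intros simp: field_simps power2_eq_square)
  obtain g1 H1 where 1: "C2h (\<lambda>x::'a. 2 - (x \<bullet> x) / R\<^sup>2) g1 H1"
    by (rule C2h_compose[OF 0 d1, of "\<lambda>t. 0"]) (auto intro: hoelder_loc_const)
  obtain g2 H2 where 2: "C2h (\<lambda>x::'a. cube_plus (2 - (x \<bullet> x) / R\<^sup>2)) g2 H2"
    by (rule C2h_compose[OF 1 cube_plus_derivs hoelder_loc_pos_part])
  obtain g3 H3 where 3: "C2h (\<lambda>x::'a. 1 - cube_plus (2 - (x \<bullet> x) / R\<^sup>2)) g3 H3"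
    by (rule C2h_compose[OF 2, of "\<lambda>t. 1 - t" "\<lambda>t. - 1" "\<lambda>t. 0"])
       (auto intro!: derivative_eq_intros hoelder_loc_const)
  obtain g4 H4 where 4: "C2h (\<lambda>x::'a. cube_plus (1 - cube_plus (2 - (x \<bullet> x) / R\<^sup>2))) g4 H4"
    by (rule C2h_compose[OF 3 cube_plus_derivs hoelder_loc_pos_part])
  obtain g5 H5 where 5: "C2h (\<lambda>x::'a. 1 - cube_plus (1 - cube_plus (2 - (x \<bullet> x) / R\<^sup>2))) g5 H5"
    by (rule C2h_compose[OF 4, of "\<lambda>t. 1 - t" "\<lambda>t. - 1" "\<lambda>t. 0"])
       (auto intro!: derivative_eq_intros hoelder_loc_const)
  show ?thesis
  proof (rule that[OF 5])
    fix x :: 'a assume "norm x \<le> R"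
    then have "x \<bullet> x \<le> R\<^sup>2" using R by (simp add: norm_le_square)
    then have "1 \<le> 2 - (x \<bullet> x) / R\<^sup>2" using R by (simp add: divide_le_eq)
    then have "1 \<le> cube_plus (2 - (x \<bullet> x) / R\<^sup>2)"
      using one_le_power[of "max 0 (2 - (x \<bullet> x) / R\<^sup>2)" 3] by (simp add: cube_plus_def)
    then show "1 - cube_plus (1 - cube_plus (2 - (x \<bullet> x) / R\<^sup>2)) = 1" by (simp add: cube_plus_def)
  next
    fix x :: 'a assume x: "2 * R \<le> norm x"
    have "2 * R\<^sup>2 \<le> (2 * R)\<^sup>2" by (simp add: power2_eq_square)
    also have "\<dots> \<le> (norm x)\<^sup>2" using x R by (intro power_mono) auto
    finally have "2 - (x \<bullet> x) / R\<^sup>2 \<le> 0" using R by (simp add: power2_norm_eq_inner le_divide_eq)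
    then show "1 - cube_plus (1 - cube_plus (2 - (x \<bullet> x) / R\<^sup>2)) = 0" by (simp add: cube_plus_def)
  qed
qed

section \<open>Stability of solutions\<close>

lemma C1_half_linearization:
  fixes z :: "'a::euclidean_space \<Rightarrow> real"
  assumes d: "\<And>x. (z has_derivative (\<lambda>h. k x \<bullet> h)) (at x)"
    and k: "\<And>x y. norm (k x - k y) \<le> C * sqrt (norm (x - y))"
  shows "\<bar>z y - z x - k x \<bullet> (y - x)\<bar> \<le> C * sqrt (norm (y - x)) * norm (y - x)"
proof (cases "y = x")
  case False
  have C: "0 \<le> C"
    using order_trans[OF norm_ge_zero k[of y x]] False by (simp add: zero_le_mult_iff)
  have "norm (z y - z x - k x \<bullet> (y - x)) \<le> norm (y - x) * (C * sqrt (norm (y - x)))"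
  proof -
    have on: "onorm ((\<lambda>h. k w \<bullet> h) - (\<lambda>h. k x \<bullet> h)) \<le> C * sqrt (norm (y - x))"
      if w: "w \<in> closed_segment x y" for w
    proof -
      have "norm (w - x) \<le> norm (y - x)" using segment_bound1[OF w] by (simp add: norm_minus_commute)
      then have "norm (k w - k x) \<le> C * sqrt (norm (y - x))"
        using C by (intro order_trans[OF k[of w x]] mult_left_mono) auto
      then show ?thesis
        unfolding fun_diff_def inner_diff_left[symmetric]
        using C by (intro onorm_bound) (auto intro!: order_trans[OF Cauchy_Schwarz_ineq2] mult_right_mono)
    qed
    have seg: "x + t *\<^sub>R (y - x) \<in> closed_segment x y" if "t \<in> {0..1}" for t
      using that by (auto simp: closed_segment_def algebra_simps intro!: exI[of _ t])
    show ?thesis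
      by (rule differentiable_bound_linearization[where S="closed_segment x y" and f=z and a=x and b=y
            and f'="\<lambda>x h. k x \<bullet> h" and ?x0.0=x])
         (auto intro: on seg has_derivative_at_withinI[OF d])
  qed
  then show ?thesis by (simp add: mult.commute)
qed simp

text \<open>With a common 1/2-Hoelder bound, a difference quotient of step t determines the gradient
  up to C sqrt t, uniformly in n. Convergence of the values therefore forces convergence of the
  gradients, for the whole sequence, and the linearisation estimate passes to the limit.\<close>

lemma C1_half_limit:
  fixes z :: "nat \<Rightarrow> 'a::euclidean_space \<Rightarrow> real"
  assumes d: "\<And>n x. (z n has_derivative (\<lambda>h. k n x \<bullet> h)) (at x)"
    and k: "\<And>n x y. norm (k n x - k n y) \<le> C * sqrt (norm (x - y))"
    and lim: "\<And>x. (\<lambda>n. z n x) \<longlonglongrightarrow> z0 x"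
  obtains k0 where "\<And>x. (\<lambda>n. k n x) \<longlonglongrightarrow> k0 x" "\<And>x. (z0 has_derivative (\<lambda>h. k0 x \<bullet> h)) (at x)"
    "\<And>x y. norm (k0 x - k0 y) \<le> C * sqrt (norm (x - y))"
proof -
  obtain b0 :: 'a where b0: "b0 \<in> Basis" using nonempty_Basis by blast
  have C: "0 \<le> C"
    using order_trans[OF norm_ge_zero k[of 0 b0 0]] b0 by simp
  note lin = C1_half_linearization[OF d k]
  have "convergent (\<lambda>n. k n x \<bullet> b)" if b: "b \<in> Basis" for x b
  proof (rule Cauchy_convergent, rule metric_CauchyI)
    fix e :: real assume e: "0 < e"
    \<comment> \<open>This step makes the linearisation error C sqrt t at most e / 4; C + 1 in place
      of C guards against C = 0.\<close>
    define t where "t = (e / 4 / (C + 1))\<^sup>2"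
    have t: "0 < t" using e C by (simp add: t_def)
    have sq: "sqrt t = e / 4 / (C + 1)" using e C by (simp add: t_def)
    have Ct: "C * sqrt t \<le> e / 4"
    proof -
      have "C * sqrt t \<le> (C + 1) * sqrt t" using t by (intro mult_right_mono) auto
      also have "\<dots> = e / 4"
      proof -
        have "r * (e / 4 / r) = e / 4" if "0 < r" for r using that by simp
        from this[of "C + 1"] show ?thesis using C by (simp only: sq)
      qed
      finally show ?thesis .
    qed
    have "Cauchy (\<lambda>n. z n (x + t *\<^sub>R b) - z n x)"
      by (rule LIMSEQ_imp_Cauchy[OF tendsto_diff[OF lim lim]])
    moreover have "0 < e * t / 4" using e t by simp
    ultimately obtain M where M: "\<And>m n. m \<ge> M \<Longrightarrow> n \<ge> M \<Longrightarrow>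
        dist (z m (x + t *\<^sub>R b) - z m x) (z n (x + t *\<^sub>R b) - z n x) < e * t / 4"
      by (meson metric_CauchyD)
    show "\<exists>M. \<forall>m\<ge>M. \<forall>n\<ge>M. dist (k m x \<bullet> b) (k n x \<bullet> b) < e"
    proof (intro exI allI impI)
      fix m n assume mn: "M \<le> m" "M \<le> n"
      have l: "\<bar>z j (x + t *\<^sub>R b) - z j x - t * (k j x \<bullet> b)\<bar> \<le> e / 4 * t" for j
      proof -
        have "\<bar>z j (x + t *\<^sub>R b) - z j x - k j x \<bullet> ((x + t *\<^sub>R b) - x)\<bar> \<le> C * sqrt t * t"
          using lin[of j "x + t *\<^sub>R b" x] b t by simp
        also have "\<dots> \<le> e / 4 * t" using Ct t by (intro mult_right_mono) auto
        finally show ?thesis by simp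
      qed
      have "\<bar>t * (k m x \<bullet> b) - t * (k n x \<bullet> b)\<bar> < 3 * (e * t / 4)"
        using l[of m] l[of n] M[OF mn] unfolding dist_real_def by linarith
      then have "t * \<bar>k m x \<bullet> b - k n x \<bullet> b\<bar> < t * (3 * e / 4)"
        using t by (simp add: right_diff_distrib[symmetric] abs_mult)
      then show "dist (k m x \<bullet> b) (k n x \<bullet> b) < e" using t e by (simp add: dist_real_def)
    qed
  qed
  then have cv: "\<exists>l. (\<lambda>n. k n x \<bullet> b) \<longlonglongrightarrow> l" if "b \<in> Basis" for x b
    using that by (auto simp: convergent_def)
  define k0 where "k0 x = (\<Sum>b\<in>Basis. lim (\<lambda>n. k n x \<bullet> b) *\<^sub>R b)" for x
  have klim: "(\<lambda>n. k n x) \<longlonglongrightarrow> k0 x" for x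
  proof -
    have "(\<lambda>n. \<Sum>b\<in>Basis. (k n x \<bullet> b) *\<^sub>R b) \<longlonglongrightarrow> k0 x"
      unfolding k0_def using cv[of _ x] by (intro tendsto_sum tendsto_scaleR tendsto_const) (auto dest: limI)
    then show ?thesis by (simp add: euclidean_representation)
  qed
  have kh: "norm (k0 x - k0 y) \<le> C * sqrt (norm (x - y))" for x y
    by (rule LIMSEQ_le_const2[OF tendsto_norm[OF tendsto_diff[OF klim klim]]]) (use k in auto)
  have l0: "\<bar>z0 y - z0 x - k0 x \<bullet> (y - x)\<bar> \<le> C * sqrt (norm (y - x)) * norm (y - x)" for x y
  proof (rule LIMSEQ_le_const2)
    show "(\<lambda>n. \<bar>z n y - z n x - k n x \<bullet> (y - x)\<bar>) \<longlonglongrightarrow> \<bar>z0 y - z0 x - k0 x \<bullet> (y - x)\<bar>"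
      by (intro tendsto_intros lim klim)
  qed (use lin in auto)
  have "(z0 has_derivative (\<lambda>h. k0 x \<bullet> h)) (at x)" for x
    unfolding has_derivative_iff_norm
  proof (intro conjI bounded_linear_inner_right)
    show "((\<lambda>y. norm (z0 y - z0 x - k0 x \<bullet> (y - x)) / norm (y - x)) \<longlongrightarrow> 0) (at x)"
    proof (rule Lim_null_comparison)
      have "((\<lambda>y. C * sqrt (norm (y - x))) \<longlongrightarrow> C * sqrt (norm (x - x))) (at x)"
        by (intro tendsto_intros)
      then show "((\<lambda>y. C * sqrt (norm (y - x))) \<longlongrightarrow> 0) (at x)" by simp
      show "\<forall>\<^sub>F y in at x. norm (norm (z0 y - z0 x - k0 x \<bullet> (y - x)) / norm (y - x)) \<le> C * sqrt (norm (y - x))"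
        unfolding eventually_at using l0[of _ x] by (intro exI[of _ 1]) (auto simp: divide_le_eq)
    qed
  qed
  then show ?thesis using klim kh by (intro that[of k0]) auto
qed

lemma has_derivative_inner_unique:
  assumes "(u has_derivative (\<lambda>h. a \<bullet> h)) (at x)" "(u has_derivative (\<lambda>h. b \<bullet> h)) (at x)"
  shows "a = (b::'a::euclidean_space)"
proof -
  have "(\<lambda>h. a \<bullet> h) = (\<lambda>h. b \<bullet> h)" by (rule has_derivative_unique[OF assms])
  then have "a \<bullet> h = b \<bullet> h" for h by metis
  then have "(a - b) \<bullet> (a - b) = 0" by (simp add: inner_diff_left)
  then show ?thesis by simp
qed

text \<open>Derivatives are determined by values on a neighbourhood. It is applied where a cutoff is
  constant, so that its gradient and Hessian vanish.\<close>

lemma twice_diff_local: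
  assumes u: "twice_diff u g H" and v: "twice_diff v k K" and S: "open S" "x \<in> S" and eq: "\<And>y. y \<in> S \<Longrightarrow> u y = v y"
  shows "g x = k x" "H x = K x"
proof -
  have 1: "g y = k y" if y: "y \<in> S" for y
  proof -
    have "(v has_derivative (\<lambda>h. g y \<bullet> h)) (at y)"
      by (rule has_derivative_transform_within_open[OF _ S(1) y eq]) (use u in \<open>auto simp: twice_diff_def\<close>)
    moreover have "(v has_derivative (\<lambda>h. k y \<bullet> h)) (at y)" using v by (auto simp: twice_diff_def)
    ultimately show ?thesis by (rule has_derivative_inner_unique)
  qed
  show "g x = k x" by (rule 1[OF S(2)])
  have "(k has_derivative H x) (at x)"
    by (rule has_derivative_transform_within_open[OF _ S 1]) (use u in \<open>auto simp: twice_diff_def\<close>)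
  moreover have "(k has_derivative K x) (at x)" using v by (auto simp: twice_diff_def)
  ultimately show "H x = K x" by (rule has_derivative_unique)
qed

lemma twice_diff_const: "twice_diff (\<lambda>_. c) (\<lambda>_. 0) (\<lambda>_ _. 0)"
  by (simp add: twice_diff_def)

text \<open>Comparison in both directions with l = 1 and m = 0. A bounded function known only to
  satisfy the equation is thereby represented as a Gaussian integral and inherits the estimates of
  the resolvent.\<close>

lemma resolvent_unique:
  fixes z :: "'a::euclidean_space \<Rightarrow> real"
  assumes z: "twice_diff z k K" and zb: "\<And>x. \<bar>z x\<bar> \<le> B" and G: "hoelder_loc G" and Gb: "\<And>x. \<bar>G x\<bar> \<le> M"
    and eq: "\<And>x. z x - lin_trace (K x) = G x"
  shows "z = resolvent 1 G"
proof -
  have Gc: "continuous_on UNIV G" by (rule hoelder_loc_continuous[OF G])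
  have r: "twice_diff (resolvent 1 G) (res_grad 1 G) (res_hess 1 G)"
    using resolvent_has_derivative[OF Gc Gb] res_grad_has_derivative[OF Gc Gb _ G] by (simp add: twice_diff_def)
  have req: "resolvent 1 G x - lin_trace (res_hess 1 G x) = G x" for x
    using res_equation[OF Gc Gb _ G, of 1 x] by (simp add: lin_trace_def)
  have rb: "\<bar>resolvent 1 G x\<bar> \<le> M * res_mass 1 0" for x by (rule resolvent_abs_le[OF Gc Gb]) simp
  have "z x \<le> resolvent 1 G x" for x
  proof (rule comparison[OF z r, where l=1 and m=0])
    show "z x - resolvent 1 G x \<le> B + M * res_mass 1 0" for x using zb[of x] rb[of x] by linarith
  qed (use eq req in auto)
  moreover have "resolvent 1 G x \<le> z x" for x
  proof (rule comparison[OF r z, where l=1 and m=0])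
    show "resolvent 1 G x - z x \<le> B + M * res_mass 1 0" for x using zb[of x] rb[of x] by linarith
  qed (use eq req in auto)
  ultimately show ?thesis by (intro ext antisym)
qed

lemma lin_trace_hoelder:
  fixes H :: "'a::euclidean_space \<Rightarrow> 'a \<Rightarrow> 'a"
  assumes "\<And>h. hoelder_loc (\<lambda>x. H x h)"
  shows "hoelder_loc (\<lambda>x. lin_trace (H x))"
proof -
  have "hoelder_loc (\<lambda>x. \<Sum>b\<in>S. H x b \<bullet> b)" if "finite S" for S
    using that by induction (auto intro!: hoelder_loc_const hoelder_loc_add hoelder_loc_inner assms)
  then show ?thesis by (simp add: lin_trace_def)
qed

text \<open>This is z - Laplacian z for z = \<eta> u, when Laplacian u = q - |g|, g is the gradient
  of u, and k and K are the gradient and Hessian of \<eta>.\<close>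

definition localized :: "('a::euclidean_space \<Rightarrow> real) \<Rightarrow> ('a \<Rightarrow> 'a) \<Rightarrow> ('a \<Rightarrow> 'a \<Rightarrow> 'a) \<Rightarrow> ('a \<Rightarrow> real) \<Rightarrow> ('a \<Rightarrow> real) \<Rightarrow> ('a \<Rightarrow> 'a) \<Rightarrow> 'a \<Rightarrow> real" where
  "localized \<eta> k K u q g x = \<eta> x * u x - \<eta> x * (q x - norm (g x)) - 2 * (k x \<bullet> g x) - u x * lin_trace (K x)"

text \<open>Multiplying by a cutoff turns each $u_n$ locally into a resolvent of a uniformly bounded function.
  Hence the gradients are uniformly Hoelder continuous and converge, so that the right-hand sides
  converge too, and the limit is the resolvent of a Hoelder continuous function.\<close>
theorem stability:
  fixes u :: "nat \<Rightarrow> 'a::euclidean_space \<Rightarrow> real"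
  assumes u: "\<And>n. C2 (u n) (g n) (H n)"
    and eq: "\<And>n x. lin_trace (H n x) + norm (g n x) = q n x"
    and bd: "\<And>R. \<exists>B. \<forall>n x. norm x \<le> R \<longrightarrow> \<bar>u n x\<bar> \<le> B \<and> \<bar>q n x\<bar> \<le> B"
    and qh: "\<And>n. hoelder_loc (q n)" and q0h: "hoelder_loc q0"
    and ulim: "\<And>x. (\<lambda>n. u n x) \<longlonglongrightarrow> u0 x" and qlim: "\<And>x. (\<lambda>n. q n x) \<longlonglongrightarrow> q0 x"
  obtains g0 H0 where "C2 u0 g0 H0" "\<And>x. lin_trace (H0 x) + norm (g0 x) = q0 x"
proof -
  have td: "twice_diff (u n) (g n) (H n)" for n using u[of n] by (simp add: C2_def)
  \<comment> \<open>Control on radius R + 1 leaves room for the unit balls of the interior gradient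
    bound around points of radius R.\<close>
  have Gbound: "\<exists>B. 0 \<le> B \<and> (\<forall>n x. norm x \<le> R \<longrightarrow> \<bar>u n x\<bar> \<le> B \<and> \<bar>q n x\<bar> \<le> B \<and> norm (g n x) \<le> B)" for R
  proof -
    obtain B where B: "\<And>n x. norm x \<le> R + 1 \<Longrightarrow> \<bar>u n x\<bar> \<le> B \<and> \<bar>q n x\<bar> \<le> B"
      using bd[of "R + 1"] by blast
    define L where "L = \<bar>B\<bar> + (8 * \<bar>B\<bar> + 1) * (DIM('a) + 1) + 16 * \<bar>B\<bar> + 1"
    have BL: "\<bar>B\<bar> \<le> L" by (simp add: L_def)
    have "norm (g n x) \<le> L" if x: "norm x \<le> R" for n x
      unfolding L_def
    proof (rule interior_gradient_bound[OF td[of n]])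
      fix y assume "norm (y - x) \<le> 1"
      then have "norm y \<le> R + 1" using x norm_triangle_sub[of y x] by linarith
      then show "\<bar>u n y\<bar> \<le> \<bar>B\<bar>" "\<bar>lin_trace (H n y) + norm (g n y)\<bar> \<le> \<bar>B\<bar>"
        using B[of y n] eq[of n y] by auto
    qed
    moreover have "\<bar>u n x\<bar> \<le> L \<and> \<bar>q n x\<bar> \<le> L" if x: "norm x \<le> R" for n x
      using B[of x n] x BL by auto
    ultimately show ?thesis using BL by (intro exI[of _ L]) auto
  qed
  have cut: "\<exists>\<eta> k K C. C2h \<eta> k K \<and> (\<forall>x. norm x \<le> R \<longrightarrow> \<eta> x = 1) \<and> (\<forall>x. 2 * R \<le> norm x \<longrightarrow> \<eta> x = 0) \<and>
     (\<forall>n. hoelder_loc (localized \<eta> k K (u n) (q n) (g n))) \<and>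
     (\<forall>n x. \<bar>localized \<eta> k K (u n) (q n) (g n) x\<bar> \<le> C) \<and>
     (\<forall>n. (\<lambda>x. \<eta> x * u n x) = resolvent 1 (localized \<eta> k K (u n) (q n) (g n)))"
    if R: "0 < R" for R
  proof -
    obtain \<eta> :: "'a \<Rightarrow> real" and k K where \<eta>: "C2h \<eta> k K" "\<And>x. norm x \<le> R \<Longrightarrow> \<eta> x = 1" "\<And>x. 2 * R \<le> norm x \<Longrightarrow> \<eta> x = 0"
      by (rule cutoff_exists[OF R]) blast
    have \<eta>t: "twice_diff \<eta> k K" and Kh: "\<And>h. hoelder_loc (\<lambda>x. K x h)" using \<eta>(1) by (auto simp: C2h_def)
    \<comment> \<open>The cutoff vanishes on the open exterior, hence so do its derivatives. The
      sphere of radius 2 R itself belongs to the closed ball, on which the compactness bounds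
      apply.\<close>
    have out: "k x = 0" "K x = (\<lambda>_. 0)" if "2 * R < norm x" for x
    proof -
      have o: "open {x::'a. 2 * R < norm x}" by (intro open_Collect_less continuous_intros)
      show "k x = 0" "K x = (\<lambda>_. 0)"
        using twice_diff_local[OF \<eta>t twice_diff_const[of 0] o, of x] that \<eta>(3) by auto
    qed
    define G where "G n = localized \<eta> k K (u n) (q n) (g n)" for n
    have hs: "hoelder_loc \<eta>" "hoelder_loc k" by (rule C2_hoelder[OF C2h_imp_C2[OF \<eta>(1)]])+
    have hu: "hoelder_loc (u n)" "hoelder_loc (g n)" for n by (rule C2_hoelder[OF u])+
    have Kth: "hoelder_loc (\<lambda>x. lin_trace (K x))" by (rule lin_trace_hoelder[OF Kh])
    have Gh: "hoelder_loc (G n)" for n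
      unfolding G_def localized_def[abs_def]
      by (intro hoelder_loc_diff hoelder_loc_mult hoelder_loc_inner hoelder_loc_norm hoelder_loc_const hs hu Kth qh)
    obtain B where B: "0 \<le> B" "\<And>n x. norm x \<le> 2 * R \<Longrightarrow> \<bar>u n x\<bar> \<le> B \<and> \<bar>q n x\<bar> \<le> B \<and> norm (g n x) \<le> B"
      using Gbound[of "2 * R"] by blast
    obtain E1 where E1: "0 \<le> E1" "\<And>x. norm x \<le> 2 * R \<Longrightarrow> norm (\<eta> x) \<le> E1"
      by (rule continuous_bounded_on_ball[OF hoelder_loc_continuous[OF hs(1)], of "2 * R"]) blast
    obtain E2 where E2: "0 \<le> E2" "\<And>x. norm x \<le> 2 * R \<Longrightarrow> norm (k x) \<le> E2"
      by (rule continuous_bounded_on_ball[OF hoelder_loc_continuous[OF hs(2)], of "2 * R"]) blast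
    obtain E3 where E3: "0 \<le> E3" "\<And>x. norm x \<le> 2 * R \<Longrightarrow> norm (lin_trace (K x)) \<le> E3"
      by (rule continuous_bounded_on_ball[OF hoelder_loc_continuous[OF Kth], of "2 * R"]) blast
    define C where "C = E1 * B + E1 * (2 * B) + 2 * (E2 * B) + B * E3"
    have C0: "0 \<le> C" using B(1) E1(1) E2(1) E3(1) by (simp add: C_def)
    have Gb: "\<bar>G n x\<bar> \<le> C" for n x
    proof (cases "norm x \<le> 2 * R")
      case True
      note b = B(2)[OF True, of n] and e = E1(2)[OF True] E2(2)[OF True] E3(2)[OF True]
      have "\<bar>\<eta> x * u n x\<bar> \<le> E1 * B" unfolding abs_mult using b e E1(1) by (intro mult_mono) auto
      moreover have "\<bar>\<eta> x * (q n x - norm (g n x))\<bar> \<le> E1 * (2 * B)"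
      proof -
        have "\<bar>q n x - norm (g n x)\<bar> \<le> 2 * B" using b norm_ge_zero[of "g n x"] by linarith
        then show ?thesis unfolding abs_mult using e E1(1) by (intro mult_mono) auto
      qed
      moreover have "\<bar>k x \<bullet> g n x\<bar> \<le> E2 * B"
        by (rule order_trans[OF Cauchy_Schwarz_ineq2]) (use b e E2(1) in \<open>auto intro: mult_mono\<close>)
      moreover have "\<bar>u n x * lin_trace (K x)\<bar> \<le> B * E3" unfolding abs_mult using b e B(1) by (intro mult_mono) auto
      ultimately show ?thesis unfolding G_def localized_def C_def by linarith
    next
      case False
      then show ?thesis using out[of x] \<eta>(3)[of x] C0 by (simp add: G_def localized_def lin_trace_def)
    qed
    have "(\<lambda>x. \<eta> x * u n x) = resolvent 1 (G n)" for n
    proof (rule resolvent_unique[OF twice_diff_mult[OF \<eta>t td[of n]] _ Gh Gb])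
      show "\<bar>\<eta> x * u n x\<bar> \<le> E1 * B" for x
      proof (cases "norm x \<le> 2 * R")
        case True
        then show ?thesis unfolding abs_mult using B(2)[OF True, of n] E1 by (intro mult_mono) auto
      next
        case False
        then show ?thesis using \<eta>(3)[of x] B(1) E1(1) by simp
      qed
      show "\<eta> x * u n x - lin_trace (\<lambda>h. \<eta> x *\<^sub>R H n x h + (k x \<bullet> h) *\<^sub>R g n x + (u n x *\<^sub>R K x h + (g n x \<bullet> h) *\<^sub>R k x)) = G n x" for x
      proof -
        have tr: "lin_trace (\<lambda>h. (a \<bullet> h) *\<^sub>R c) = a \<bullet> c" for a c :: 'a
          unfolding lin_trace_def by (subst euclidean_inner[of a c]) simp
        show ?thesis
          by (simp add: eq[of n x, symmetric] lin_trace_add lin_trace_scaleR tr G_def localized_def inner_commute[of "g n x" "k x"] algebra_simps)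
      qed
    qed
    then have "C2h \<eta> k K \<and> (\<forall>x. norm x \<le> R \<longrightarrow> \<eta> x = 1) \<and> (\<forall>x. 2 * R \<le> norm x \<longrightarrow> \<eta> x = 0) \<and>
      (\<forall>n. hoelder_loc (G n)) \<and> (\<forall>n x. \<bar>G n x\<bar> \<le> C) \<and> (\<forall>n. (\<lambda>x. \<eta> x * u n x) = resolvent 1 (G n))"
      using \<eta> Gh Gb by blast
    then show ?thesis unfolding G_def by blast
  qed
  \<comment> \<open>Where \<eta> = 1 the gradient of \<eta> u_n is that of u_n. The sources of all
    \<eta> u_n share the bound C, so their gradients share one 1/2-Hoelder constant and the limit
    lemma applies.\<close>
  have locgrad: "\<exists>k0. (\<forall>x. norm x < R \<longrightarrow> (\<lambda>n. g n x) \<longlonglongrightarrow> k0 x \<and> (u0 has_derivative (\<lambda>h. k0 x \<bullet> h)) (at x)) \<and> hoelder_loc k0"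
    if R: "0 < R" for R
  proof -
    obtain \<eta> k K C where \<eta>: "C2h \<eta> k K" "\<And>x. norm x \<le> R \<Longrightarrow> \<eta> x = 1"
      and G: "\<And>n. hoelder_loc (localized \<eta> k K (u n) (q n) (g n))"
        "\<And>n x. \<bar>localized \<eta> k K (u n) (q n) (g n) x\<bar> \<le> C"
        "\<And>n. (\<lambda>x. \<eta> x * u n x) = resolvent 1 (localized \<eta> k K (u n) (q n) (g n))"
      using cut[OF R] by blast
    define GG where "GG n = localized \<eta> k K (u n) (q n) (g n)" for n
    have Gh: "hoelder_loc (GG n)" and Gb: "\<bar>GG n x\<bar> \<le> C" and Gr: "(\<lambda>x. \<eta> x * u n x) = resolvent 1 (GG n)" for n x
      unfolding GG_def by (rule G(1), rule G(2), rule G(3))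
    have Gc: "continuous_on UNIV (GG n)" for n by (rule hoelder_loc_continuous[OF Gh])
    have \<eta>t: "twice_diff \<eta> k K" using \<eta>(1) by (simp add: C2h_def)
    have prod: "twice_diff (\<lambda>x. \<eta> x * u n x) (\<lambda>x. \<eta> x *\<^sub>R g n x + u n x *\<^sub>R k x)
      (\<lambda>x h. \<eta> x *\<^sub>R H n x h + (k x \<bullet> h) *\<^sub>R g n x + (u n x *\<^sub>R K x h + (g n x \<bullet> h) *\<^sub>R k x))" for n
      by (rule twice_diff_mult[OF \<eta>t td])
    have d: "((\<lambda>x. \<eta> x * u n x) has_derivative (\<lambda>h. res_grad 1 (GG n) x \<bullet> h)) (at x)" for n x
      unfolding Gr by (rule resolvent_has_derivative[OF Gc Gb]) simp
    have hh: "norm (res_grad 1 (GG n) x - res_grad 1 (GG n) y)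
        \<le> C * (sqrt (2 * grad_const TYPE('a) * hess_const TYPE('a)) * res_mass 1 (-3/2)) * sqrt (norm (x - y))" for n x y
      by (rule res_grad_hoelder_half[OF Gc Gb]) simp
    obtain k0 where k0: "\<And>x. (\<lambda>n. res_grad 1 (GG n) x) \<longlonglongrightarrow> k0 x"
      "\<And>x. ((\<lambda>x. \<eta> x * u0 x) has_derivative (\<lambda>h. k0 x \<bullet> h)) (at x)"
      "\<And>x y. norm (k0 x - k0 y) \<le> C * (sqrt (2 * grad_const TYPE('a) * hess_const TYPE('a)) * res_mass 1 (-3/2)) * sqrt (norm (x - y))"
      by (rule C1_half_limit[of "\<lambda>n x. \<eta> x * u n x" "\<lambda>n. res_grad 1 (GG n)", OF d hh, of "\<lambda>x. \<eta> x * u0 x"])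
         (auto intro!: tendsto_intros ulim)
    have "(\<lambda>n. g n x) \<longlonglongrightarrow> k0 x \<and> (u0 has_derivative (\<lambda>h. k0 x \<bullet> h)) (at x)" if x: "norm x < R" for x
    proof
      have xb: "x \<in> ball 0 R" using x by simp
      have "res_grad 1 (GG n) x = g n x" for n
      proof (rule has_derivative_inner_unique)
        show "(u n has_derivative (\<lambda>h. res_grad 1 (GG n) x \<bullet> h)) (at x)"
          by (rule has_derivative_transform_within_open[OF d open_ball xb]) (use \<eta>(2) in auto)
        show "(u n has_derivative (\<lambda>h. g n x \<bullet> h)) (at x)" using td[of n] by (simp add: twice_diff_def)
      qed
      then show "(\<lambda>n. g n x) \<longlonglongrightarrow> k0 x" using k0(1)[of x] by simp
      show "(u0 has_derivative (\<lambda>h. k0 x \<bullet> h)) (at x)"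
        by (rule has_derivative_transform_within_open[OF k0(2) open_ball xb]) (use \<eta>(2) in auto)
    qed
    moreover have "hoelder_loc k0"
    proof (rule hoelder_locI)
      fix R' :: real
      show "\<exists>a A. 0 < a \<and> a \<le> 1 \<and> 0 \<le> A \<and> (\<forall>x y. norm x \<le> R' \<longrightarrow> norm y \<le> R' \<longrightarrow> norm (k0 x - k0 y) \<le> A * norm (x - y) powr a)"
      proof (rule exI[of _ "1/2"], rule exI[of _ "\<bar>C\<bar> * (sqrt (2 * grad_const TYPE('a) * hess_const TYPE('a)) * res_mass 1 (-3/2))"], intro conjI allI impI)
        fix x y :: 'a
        have "C * (sqrt (2 * grad_const TYPE('a) * hess_const TYPE('a)) * res_mass 1 (-3/2)) * sqrt (norm (x - y))
          \<le> \<bar>C\<bar> * (sqrt (2 * grad_const TYPE('a) * hess_const TYPE('a)) * res_mass 1 (-3/2)) * sqrt (norm (x - y))"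
          using grad_const_nonneg[where 'a='a] hess_const_nonneg[where 'a='a] res_mass_nonneg[of 1 "-3/2"]
          by (intro mult_right_mono) auto
        then show "norm (k0 x - k0 y) \<le> \<bar>C\<bar> * (sqrt (2 * grad_const TYPE('a) * hess_const TYPE('a)) * res_mass 1 (-3/2)) * norm (x - y) powr (1/2)"
          using order_trans[OF k0(3)[of x y]] by (simp add: powr_half_sqrt)
      qed (use grad_const_nonneg[where 'a='a] hess_const_nonneg[where 'a='a] res_mass_nonneg[of 1 "-3/2"] in auto)
    qed
    ultimately show ?thesis by blast
  qed
  have "\<exists>v. (\<lambda>n. g n x) \<longlonglongrightarrow> v" for x
  proof -
    have R: "0 < norm x + 1" by (simp add: add_nonneg_pos)
    from locgrad[OF R] show ?thesis by (metis less_add_one)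
  qed
  then obtain g0 where g0: "\<And>x. (\<lambda>n. g n x) \<longlonglongrightarrow> g0 x" by metis
  have u0d: "(u0 has_derivative (\<lambda>h. g0 x \<bullet> h)) (at x)" for x
  proof -
    obtain k0 where k0: "\<And>y. norm y < norm x + 1 \<Longrightarrow> (\<lambda>n. g n y) \<longlonglongrightarrow> k0 y \<and> (u0 has_derivative (\<lambda>h. k0 y \<bullet> h)) (at y)"
      using locgrad[of "norm x + 1"] by (auto simp: add_nonneg_pos)
    then have "k0 x = g0 x" using LIMSEQ_unique[OF _ g0] by auto
    then show ?thesis using k0[of x] by auto
  qed
  have g0h: "hoelder_loc g0"
  proof (rule hoelder_locI)
    fix R :: real assume R: "0 < R"
    obtain k0 where k0: "\<And>y. norm y < R + 1 \<Longrightarrow> (\<lambda>n. g n y) \<longlonglongrightarrow> k0 y" "hoelder_loc k0"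
      using locgrad[of "R + 1"] R by auto
    obtain a A where aA: "0 < a" "a \<le> 1" "0 \<le> A"
      "\<And>x y. norm x \<le> R \<Longrightarrow> norm y \<le> R \<Longrightarrow> norm (k0 x - k0 y) \<le> A * norm (x - y) powr a"
      by (rule hoelder_locE[OF k0(2), of R]) blast
    have "k0 y = g0 y" if "norm y \<le> R" for y using k0(1)[of y] that LIMSEQ_unique[OF _ g0[of y]] by auto
    then show "\<exists>a A. 0 < a \<and> a \<le> 1 \<and> 0 \<le> A \<and> (\<forall>x y. norm x \<le> R \<longrightarrow> norm y \<le> R \<longrightarrow> norm (g0 x - g0 y) \<le> A * norm (x - y) powr a)"
      using aA by (intro exI[of _ a] exI[of _ A]) auto
  qed
  have u0h: "hoelder_loc u0"
    by (rule hoelder_loc_C1[OF u0d]) (intro continuous_intros hoelder_loc_continuous[OF g0h])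
  \<comment> \<open>Once the gradients converge, the localised sources converge boundedly to a
    Hoelder function G0, and the representation passes to the limit: \<eta> u0 is the resolvent of
    G0. The equation is read off where \<eta> = 1.\<close>
  have locsol: "\<exists>z k K. C2 z k K \<and> (\<forall>x. norm x < R \<longrightarrow> u0 x = z x \<and> lin_trace (K x) + norm (k x) = q0 x)" if R: "0 < R" for R
  proof -
    obtain \<eta> k K C where \<eta>: "C2h \<eta> k K" "\<And>x. norm x \<le> R \<Longrightarrow> \<eta> x = 1"
      and G: "\<And>n. hoelder_loc (localized \<eta> k K (u n) (q n) (g n))"
        "\<And>n x. \<bar>localized \<eta> k K (u n) (q n) (g n) x\<bar> \<le> C"
        "\<And>n. (\<lambda>x. \<eta> x * u n x) = resolvent 1 (localized \<eta> k K (u n) (q n) (g n))"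
      using cut[OF R] by blast
    define GG where "GG n = localized \<eta> k K (u n) (q n) (g n)" for n
    have Gh: "hoelder_loc (GG n)" and Gb: "\<bar>GG n x\<bar> \<le> C" and Gr: "(\<lambda>x. \<eta> x * u n x) = resolvent 1 (GG n)" for n x
      unfolding GG_def by (rule G(1), rule G(2), rule G(3))
    have Gc: "continuous_on UNIV (GG n)" for n by (rule hoelder_loc_continuous[OF Gh])
    have \<eta>t: "twice_diff \<eta> k K" and Kh: "\<And>h. hoelder_loc (\<lambda>x. K x h)" using \<eta>(1) by (auto simp: C2h_def)
    define G0 where "G0 = localized \<eta> k K u0 q0 g0"
    have Glim: "(\<lambda>n. GG n x) \<longlonglongrightarrow> G0 x" for x
      unfolding GG_def G0_def localized_def by (intro tendsto_intros ulim qlim g0)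
    have hs: "hoelder_loc \<eta>" "hoelder_loc k" by (rule C2_hoelder[OF C2h_imp_C2[OF \<eta>(1)]])+
    have G0h: "hoelder_loc G0"
      unfolding G0_def localized_def[abs_def]
      by (intro hoelder_loc_diff hoelder_loc_mult hoelder_loc_inner hoelder_loc_norm hoelder_loc_const hs u0h g0h q0h lin_trace_hoelder[OF Kh])
    have G0c: "continuous_on UNIV G0" by (rule hoelder_loc_continuous[OF G0h])
    have G0b: "\<bar>G0 x\<bar> \<le> C" for x
      by (rule LIMSEQ_le_const2[OF tendsto_rabs[OF Glim]]) (use Gb in auto)
    have "(\<lambda>n. resolvent 1 (GG n) x) \<longlonglongrightarrow> resolvent 1 G0 x" for x
      by (rule resolvent_tendsto[OF Gc Gb G0c G0b Glim]) simp
    moreover have "(\<lambda>n. resolvent 1 (GG n) x) \<longlonglongrightarrow> \<eta> x * u0 x" for x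
      unfolding Gr[symmetric] by (intro tendsto_intros ulim)
    ultimately have z: "resolvent 1 G0 x = \<eta> x * u0 x" for x using LIMSEQ_unique by blast
    have c2: "C2 (resolvent 1 G0) (res_grad 1 G0) (res_hess 1 G0)"
      unfolding C2_def twice_diff_def
      using resolvent_has_derivative[OF G0c G0b, of 1] res_grad_has_derivative[OF G0c G0b _ G0h, of 1] res_hess_continuous[OF G0c G0b _ G0h, of 1] by simp
    have "u0 x = resolvent 1 G0 x \<and> lin_trace (res_hess 1 G0 x) + norm (res_grad 1 G0 x) = q0 x" if x: "norm x < R" for x
    proof
      have xb: "x \<in> ball 0 R" using x by simp
      show ux: "u0 x = resolvent 1 G0 x" using z[of x] \<eta>(2)[of x] x by simp
      have "k x = 0" "K x = (\<lambda>_. 0)"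
        using twice_diff_local[OF \<eta>t twice_diff_const[of 1] open_ball xb] \<eta>(2) by auto
      then have G0x: "G0 x = u0 x - (q0 x - norm (g0 x))" using \<eta>(2)[of x] x by (simp add: G0_def localized_def lin_trace_def)
      have "res_grad 1 G0 x = g0 x"
      proof (rule has_derivative_inner_unique)
        show "(u0 has_derivative (\<lambda>h. res_grad 1 G0 x \<bullet> h)) (at x)"
        proof (rule has_derivative_transform_within_open[OF _ open_ball xb])
          show "(resolvent 1 G0 has_derivative (\<lambda>h. res_grad 1 G0 x \<bullet> h)) (at x)"
            using c2 by (simp add: C2_def twice_diff_def)
        qed (use z \<eta>(2) in auto)
      qed (rule u0d)
      moreover have "resolvent 1 G0 x - lin_trace (res_hess 1 G0 x) = G0 x"
        using res_equation[OF G0c G0b _ G0h, of 1 x] by (simp add: lin_trace_def)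
      ultimately show "lin_trace (res_hess 1 G0 x) + norm (res_grad 1 G0 x) = q0 x" using ux G0x by simp
    qed
    then show ?thesis using c2 by blast
  qed
  \<comment> \<open>Derivatives are unique, so on every ball this choice agrees with the Hessian of
    the local solution, which supplies its continuity and the equation.\<close>
  define H0 where "H0 x = (SOME D. (g0 has_derivative D) (at x))" for x
  have glue: "\<exists>z k K. C2 z k K \<and> (\<forall>x. norm x < R \<longrightarrow> g0 x = k x \<and> H0 x = K x \<and> (g0 has_derivative H0 x) (at x) \<and> lin_trace (K x) + norm (k x) = q0 x)"
    if R: "0 < R" for R
  proof -
    obtain z k K where z: "C2 z k K" "\<And>x. norm x < R \<Longrightarrow> u0 x = z x \<and> lin_trace (K x) + norm (k x) = q0 x"
      using locsol[OF R] by blast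
    have zt: "twice_diff z k K" using z(1) by (simp add: C2_def)
    have gk: "g0 x = k x" if x: "norm x < R" for x
    proof (rule has_derivative_inner_unique[OF u0d])
      show "(u0 has_derivative (\<lambda>h. k x \<bullet> h)) (at x)"
        by (rule has_derivative_transform_within_open[of z _ _ _ "ball 0 R"])
           (use zt z(2) x in \<open>auto simp: twice_diff_def\<close>)
    qed
    have gK: "(g0 has_derivative K x) (at x)" if x: "norm x < R" for x
      by (rule has_derivative_transform_within_open[of k _ _ _ "ball 0 R"])
         (use zt gk x in \<open>auto simp: twice_diff_def\<close>)
    have "(g0 has_derivative H0 x) (at x)" if x: "norm x < R" for x
      unfolding H0_def by (rule someI[of "\<lambda>D. (g0 has_derivative D) (at x)", OF gK[OF x]])
    moreover from this have "H0 x = K x" if x: "norm x < R" for x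
      using has_derivative_unique[OF _ gK[OF x]] x by blast
    ultimately show ?thesis using z gk by blast
  qed
  have c2: "C2 u0 g0 H0"
    unfolding C2_def twice_diff_def
  proof (intro conjI allI u0d)
    fix x
    show "(g0 has_derivative H0 x) (at x)"
    proof -
      have R: "0 < norm x + 1" by (simp add: add_nonneg_pos)
      from glue[OF R] show ?thesis by (metis less_add_one)
    qed
  next
    fix h
    have "isCont (\<lambda>x. H0 x h) x" for x
    proof -
      obtain z k K where z: "C2 z k K" "\<And>y. norm y < norm x + 1 \<Longrightarrow> H0 y = K y"
        using glue[of "norm x + 1"] by (auto simp: add_nonneg_pos)
      have "continuous_on UNIV (\<lambda>y. K y h)" using z(1) by (simp add: C2_def)
      then have "continuous_on (ball 0 (norm x + 1)) (\<lambda>y. K y h)" by (rule continuous_on_subset) auto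
      then have "continuous_on (ball 0 (norm x + 1)) (\<lambda>y. H0 y h)"
        by (rule continuous_on_eq) (use z(2) in auto)
      then show ?thesis by (simp add: continuous_on_eq_continuous_at)
    qed
    then show "continuous_on UNIV (\<lambda>x. H0 x h)" by (simp add: continuous_at_imp_continuous_on)
  qed
  moreover have "lin_trace (H0 x) + norm (g0 x) = q0 x" for x
    using glue[of "norm x + 1"] by (auto simp: add_nonneg_pos)
  ultimately show ?thesis by (rule that)
qed

section \<open>Monotone iteration\<close>

text \<open>The shift by $\lambda u$ makes the right-hand side monotone in $u$, so that the iterates decrease from
  the supersolution and stay above the subsolution.\<close>
theorem exists_between_sub_super:
  fixes P v w :: "'a::euclidean_space \<Rightarrow> real" and F :: "real \<Rightarrow> real"
  assumes Ph: "hoelder_loc P" and P0: "\<And>x. 0 \<le> P x" and Pb: "\<And>x. P x \<le> PM"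
    and Fm: "mono F" and FL: "\<And>s t. \<bar>F s - F t\<bar> \<le> K * \<bar>s - t\<bar>"
    and v: "twice_diff v gv Hv" and w: "twice_diff w gw Hw"
    and vb: "\<And>x. \<bar>v x\<bar> \<le> VB" and wb: "\<And>x. \<bar>w x\<bar> \<le> VB" and vw: "\<And>x. v x \<le> w x"
    and wh: "hoelder_loc w"
    and sub: "\<And>x. P x * F (v x) \<le> lin_trace (Hv x) + norm (gv x)"
    and super: "\<And>x. lin_trace (Hw x) + norm (gw x) \<le> P x * F (w x)"
  obtains u g H where "C2 u g H" "\<And>x. lin_trace (H x) + norm (g x) = P x * F (u x)"
    "\<And>x. v x \<le> u x" "\<And>x. u x \<le> w x"
proof -
  \<comment> \<open>\<open>PM * \<bar>K\<bar>\<close> makes l s - P x F s increasing in s; the last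
    summand yields grad_const sqrt (2 pi / l) \<le> 1/2 for the contraction; the 1 keeps l
    positive.\<close>
  define l where "l = PM * \<bar>K\<bar> + 1 + 8 * pi * (grad_const TYPE('a))\<^sup>2"
  have PM: "0 \<le> PM" using order_trans[OF P0 Pb[of 0]] .
  have l1: "PM * \<bar>K\<bar> \<le> l" "1 \<le> l" "8 * pi * (grad_const TYPE('a))\<^sup>2 \<le> l"
    using PM by (auto simp: l_def add_nonneg_pos intro!: add_nonneg_nonneg)
  have l: "0 < l" using l1 by linarith
  have small: "grad_const TYPE('a) * res_mass l (-1) \<le> 1 / 2"
  proof -
    have "grad_const TYPE('a) * res_mass l (-1) \<le> grad_const TYPE('a) * sqrt (2 * pi / l)"
      by (rule mult_left_mono[OF res_mass_minus_1_le[OF l] grad_const_nonneg])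
    also have "\<dots> \<le> 1 / 2"
    proof (rule power2_le_imp_le)
      show "(grad_const TYPE('a) * sqrt (2 * pi / l))\<^sup>2 \<le> (1 / 2)\<^sup>2"
        using l l1(3) by (simp add: power_mult_distrib power_divide divide_le_eq mult_ac)
    qed simp
    finally show ?thesis .
  qed
  define \<Phi> where "\<Phi> u x = l * u x - P x * F (u x)" for u x
  have FL': "\<bar>F s - F t\<bar> \<le> \<bar>K\<bar> * \<bar>s - t\<bar>" for s t
  proof -
    have "K * \<bar>s - t\<bar> \<le> \<bar>K\<bar> * \<bar>s - t\<bar>" by (intro mult_right_mono) auto
    then show ?thesis using FL[of s t] by linarith
  qed
  have Fh: "hoelder_loc F"
  proof (rule hoelder_locI_lipschitz, intro exI[of _ "\<bar>K\<bar>"] conjI allI impI)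
    fix s t :: real
    show "norm (F s - F t) \<le> \<bar>K\<bar> * norm (s - t)" using FL'[of s t] by simp
  qed simp
  have PF: "P x * (F s - F t) \<le> l * (s - t)" if st: "t \<le> s" for x s t
  proof -
    have "F s - F t \<le> \<bar>K\<bar> * (s - t)"
      using FL'[of s t] st by auto
    then have "P x * (F s - F t) \<le> P x * (\<bar>K\<bar> * (s - t))" using P0 by (intro mult_left_mono) auto
    also have "\<dots> \<le> PM * (\<bar>K\<bar> * (s - t))" using Pb st by (intro mult_right_mono) auto
    also have "\<dots> \<le> l * (s - t)" using mult_right_mono[OF l1(1), of "s - t"] st by (simp add: mult.assoc)
    finally show ?thesis .
  qed
  have \<Phi>mono: "\<Phi> a x \<le> \<Phi> b x" if "a x \<le> b x" for a b x
    using PF[OF that, of x] by (simp add: \<Phi>_def algebra_simps)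
  have step: "\<exists>b g H. C2 b g H \<and> (\<forall>x. l * b x - lin_trace (H x) - norm (g x) = \<Phi> a x) \<and> (\<forall>x. v x \<le> b x) \<and> (\<forall>x. b x \<le> a x)"
    if a: "twice_diff a ga Ha" "hoelder_loc a" "\<And>x. v x \<le> a x" "\<And>x. \<bar>a x\<bar> \<le> VB"
      and sup: "\<And>x. \<Phi> a x \<le> l * a x - lin_trace (Ha x) - norm (ga x)" for a ga Ha
  proof -
    have "hoelder_loc (\<Phi> a)"
      unfolding \<Phi>_def[abs_def] by (intro hoelder_loc_diff hoelder_loc_mult hoelder_loc_const a Ph hoelder_loc_compose[OF Fh])
    moreover have "\<bar>\<Phi> a x\<bar> \<le> l * VB + PM * (\<bar>F 0\<bar> + \<bar>K\<bar> * VB)" for x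
    proof -
      have "\<bar>F (a x) - F 0\<bar> \<le> \<bar>K\<bar> * \<bar>a x - 0\<bar>"
        by (rule FL')
      also have "\<dots> \<le> \<bar>K\<bar> * VB" using a(4) by (intro mult_left_mono) auto
      finally have "\<bar>F (a x)\<bar> \<le> \<bar>F 0\<bar> + \<bar>K\<bar> * VB" by linarith
      then have "\<bar>P x * F (a x)\<bar> \<le> PM * (\<bar>F 0\<bar> + \<bar>K\<bar> * VB)"
        unfolding abs_mult using P0[of x] Pb[of x] PM by (intro mult_mono) auto
      moreover have "\<bar>l * a x\<bar> \<le> l * VB" unfolding abs_mult using l a(4) by (intro mult_mono) auto
      ultimately show ?thesis unfolding \<Phi>_def by linarith
    qed
    ultimately obtain b g H B where b: "C2 b g H" "\<And>x. \<bar>b x\<bar> \<le> B" "\<And>x. l * b x - lin_trace (H x) - norm (g x) = \<Phi> a x"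
      by (rule nonlinear_resolvent[OF l small]) blast
    have bt: "twice_diff b g H" using b(1) by (simp add: C2_def)
    have "b x \<le> a x" for x
    proof (rule comparison[OF bt a(1) _ l, where m=1])
      show "b x - a x \<le> B + VB" for x using b(2)[of x] a(4)[of x] by linarith
    qed (use b(3) sup in auto)
    moreover have "v x \<le> b x" for x
    proof (rule comparison[OF v bt _ l, where m=1])
      show "v x - b x \<le> VB + B" for x using b(2)[of x] vb[of x] by linarith
      show "l * v x - lin_trace (Hv x) - 1 * norm (gv x) \<le> l * b x - lin_trace (H x) - 1 * norm (g x)" for x
        using \<Phi>mono[of v x a, OF a(3)[of x]] sub[of x] b(3)[of x] by (simp add: \<Phi>_def)
    qed simp
    ultimately show ?thesis using b by blast
  qed
  \<comment> \<open>Every iterate is a supersolution relative to its own right-hand side; as the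
    next iterate is smaller and \<Phi> is monotone, the property is inherited. Only
    \<open>twice_diff\<close> is demanded, because the first member is the barrier w.\<close>
  define Inv where "Inv a \<longleftrightarrow> (\<exists>ga Ha. twice_diff a ga Ha \<and> (\<forall>x. \<Phi> a x \<le> l * a x - lin_trace (Ha x) - norm (ga x)))
    \<and> hoelder_loc a \<and> (\<forall>x. v x \<le> a x \<and> a x \<le> w x)" for a
  define Step where "Step a b \<longleftrightarrow> (\<exists>g H. C2 b g H \<and> (\<forall>x. l * b x - lin_trace (H x) - norm (g x) = \<Phi> a x)) \<and> (\<forall>x. b x \<le> a x)" for a b
  have Invw: "Inv w"
    unfolding Inv_def
  proof (intro conjI exI[of _ gw] exI[of _ Hw] allI)
    show "\<Phi> w x \<le> l * w x - lin_trace (Hw x) - norm (gw x)" for x using super[of x] by (simp add: \<Phi>_def)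
  qed (use w wh vw in auto)
  have "\<exists>b. Inv b \<and> Step a b" if a: "Inv a" for a
  proof -
    obtain ga Ha where ga: "twice_diff a ga Ha" "\<And>x. \<Phi> a x \<le> l * a x - lin_trace (Ha x) - norm (ga x)"
      and ah: "hoelder_loc a" and av: "\<And>x. v x \<le> a x" "\<And>x. a x \<le> w x" using a unfolding Inv_def by blast
    have ab: "\<bar>a x\<bar> \<le> VB" for x using av[of x] vb[of x] wb[of x] by linarith
    obtain b g H where b: "C2 b g H" "\<And>x. l * b x - lin_trace (H x) - norm (g x) = \<Phi> a x" "\<And>x. v x \<le> b x" "\<And>x. b x \<le> a x"
      using step[OF ga(1) ah av(1) ab ga(2)] by blast
    have "Step a b" unfolding Step_def using b by blast
    moreover have "Inv b"
      unfolding Inv_def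
    proof (intro conjI exI[of _ g] exI[of _ H] allI)
      show "\<Phi> b x \<le> l * b x - lin_trace (H x) - norm (g x)" for x
        using \<Phi>mono[of b x a, OF b(4)[of x]] b(2)[of x] by simp
      show "b x \<le> w x" for x using b(4)[of x] av(2)[of x] by linarith
      show "hoelder_loc b" by (rule C2_hoelder(1)[OF b(1)])
    qed (use b in \<open>auto simp: C2_def\<close>)
    ultimately show ?thesis by blast
  qed
  then obtain U where U: "\<And>n. Inv (U n)" "\<And>n. Step (U n) (U (Suc n))"
    using dependent_nat_choice[of "\<lambda>_. Inv" "\<lambda>_. Step"] Invw by (metis (no_types, lifting))
  have Ub: "v x \<le> U n x" "U n x \<le> w x" "hoelder_loc (U n)" for n x using U(1)[of n] unfolding Inv_def by auto
  have "\<exists>g H. \<forall>n. C2 (U (Suc n)) (g n) (H n) \<and> (\<forall>x. l * U (Suc n) x - lin_trace (H n x) - norm (g n x) = \<Phi> (U n) x)"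
    using U(2) unfolding Step_def by metis
  then obtain g H where gH: "\<And>n. C2 (U (Suc n)) (g n) (H n)"
    "\<And>n x. l * U (Suc n) x - lin_trace (H n x) - norm (g n x) = \<Phi> (U n) x" by blast
  have dec: "U (Suc n) x \<le> U n x" for n x using U(2)[of n] unfolding Step_def by blast
  have "\<exists>L. (\<lambda>n. U n x) \<longlonglongrightarrow> L" for x
  proof -
    have "decseq (\<lambda>n. U n x)" using dec by (simp add: decseq_Suc_iff)
    then show ?thesis using decseq_convergent[of "\<lambda>n. U n x" "v x"] Ub by metis
  qed
  then obtain u where u: "\<And>x. (\<lambda>n. U n x) \<longlonglongrightarrow> u x" by metis
  define q where "q n x = l * U (Suc n) x - \<Phi> (U n) x" for n x
  have contF: "isCont F s" for s using hoelder_loc_continuous[OF Fh, of UNIV] by (simp add: continuous_on_eq_continuous_at)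
  have contP: "continuous_on UNIV P" by (rule hoelder_loc_continuous[OF Ph])
  have FB: "\<bar>F s\<bar> \<le> \<bar>F 0\<bar> + \<bar>K\<bar> * VB" if "\<bar>s\<bar> \<le> VB" for s
  proof -
    have "\<bar>F s - F 0\<bar> \<le> \<bar>K\<bar> * \<bar>s - 0\<bar>"
      by (rule FL')
    also have "\<dots> \<le> \<bar>K\<bar> * VB" using that by (intro mult_left_mono) auto
    finally show ?thesis by linarith
  qed
  have UB: "\<bar>U n x\<bar> \<le> VB" for n x using Ub(1)[of x n] Ub(2)[of n x] vb[of x] wb[of x] by linarith
  \<comment> \<open>The equation solved by \<open>U (Suc n)\<close> carries the defect l (U (Suc n)
    - U n), which disappears in the limit because consecutive iterates have the same limit.\<close>
  have qeq: "q n x = l * (U (Suc n) x - U n x) + P x * F (U n x)" for n x by (simp add: q_def \<Phi>_def algebra_simps)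
  have qb: "\<bar>q n x\<bar> \<le> l * (2 * VB) + PM * (\<bar>F 0\<bar> + \<bar>K\<bar> * VB)" for n x
  proof -
    have "\<bar>U (Suc n) x - U n x\<bar> \<le> 2 * VB" using UB[of n x] UB[of "Suc n" x] by linarith
    then have "\<bar>l * (U (Suc n) x - U n x)\<bar> \<le> l * (2 * VB)" unfolding abs_mult using l by (intro mult_mono) auto
    moreover have "\<bar>P x * F (U n x)\<bar> \<le> PM * (\<bar>F 0\<bar> + \<bar>K\<bar> * VB)"
      unfolding abs_mult using P0[of x] Pb[of x] PM FB[OF UB] by (intro mult_mono) auto
    ultimately show ?thesis unfolding qeq by linarith
  qed
  obtain D where D: "\<And>n x. \<bar>U (Suc n) x\<bar> \<le> D \<and> \<bar>q n x\<bar> \<le> D"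
  proof (rule that[of "VB + (l * (2 * VB) + PM * (\<bar>F 0\<bar> + \<bar>K\<bar> * VB))"])
    fix n x
    have "0 \<le> VB" using UB[of 0 0] by linarith
    moreover from this have "0 \<le> l * (2 * VB) + PM * (\<bar>F 0\<bar> + \<bar>K\<bar> * VB)" using l PM by simp
    ultimately show "\<bar>U (Suc n) x\<bar> \<le> VB + (l * (2 * VB) + PM * (\<bar>F 0\<bar> + \<bar>K\<bar> * VB)) \<and> \<bar>q n x\<bar> \<le> VB + (l * (2 * VB) + PM * (\<bar>F 0\<bar> + \<bar>K\<bar> * VB))"
      using UB[of "Suc n" x] qb[of n x] by linarith
  qed
  have td: "twice_diff (U (Suc n)) (g n) (H n)" for n using gH(1)[of n] by (simp add: C2_def)
  have eqn: "lin_trace (H n x) + norm (g n x) = q n x" for n x using gH(2)[of n x] by (simp add: q_def)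
  \<comment> \<open>The stability theorem asks for a Hoelder limit of the right-hand sides. The
    gradient bound, uniform in n and here also in space, gives a Lipschitz limit u, and P F(u) is
    then Hoelder.\<close>
  have ulip: "hoelder_loc u"
  proof (rule hoelder_locI_lipschitz, intro exI conjI allI impI)
    define L where "L = D + (8 * D + 1) * (DIM('a) + 1) + 16 * D + 1"
    have D0: "0 \<le> D" using D[of 0 0] by linarith
    show "0 \<le> L" using D0 by (simp add: L_def)
    fix x y :: 'a
    have gb: "norm (g n z) \<le> L" for n z
      unfolding L_def by (rule interior_gradient_bound[OF td]) (use D eqn in auto)
    have "norm (U (Suc n) x - U (Suc n) y) \<le> L * norm (x - y)" for n
    proof (rule differentiable_bound[of UNIV])
      show "(U (Suc n) has_derivative (\<lambda>h. g n z \<bullet> h)) (at z within UNIV)" for z using td[of n] by (simp add: twice_diff_def)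
      show "onorm (\<lambda>h. g n z \<bullet> h) \<le> L" for z
        using gb[of n z] \<open>0 \<le> L\<close> by (intro onorm_bound) (auto intro!: order_trans[OF Cauchy_Schwarz_ineq2] mult_right_mono)
    qed auto
    then show "norm (u x - u y) \<le> L * norm (x - y)"
      by (intro LIMSEQ_le_const2[OF tendsto_norm[OF tendsto_diff[OF LIMSEQ_Suc[OF u] LIMSEQ_Suc[OF u]]]]) auto
  qed
  obtain g0 H0 where sol: "C2 u g0 H0" "\<And>x. lin_trace (H0 x) + norm (g0 x) = P x * F (u x)"
  proof (rule stability[of "\<lambda>n. U (Suc n)" g H q "\<lambda>x. P x * F (u x)" u])
    show "\<exists>B. \<forall>n x. norm x \<le> R \<longrightarrow> \<bar>U (Suc n) x\<bar> \<le> B \<and> \<bar>q n x\<bar> \<le> B" for R using D by blast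
    show "hoelder_loc (q n)" for n
      unfolding qeq[abs_def] by (intro hoelder_loc_add hoelder_loc_diff hoelder_loc_mult hoelder_loc_const Ub(3) Ph hoelder_loc_compose[OF Fh])
    show "hoelder_loc (\<lambda>x. P x * F (u x))" by (intro hoelder_loc_mult Ph hoelder_loc_compose[OF Fh] ulip)
    show "(\<lambda>n. U (Suc n) x) \<longlonglongrightarrow> u x" for x by (rule LIMSEQ_Suc[OF u])
    show "(\<lambda>n. q n x) \<longlonglongrightarrow> P x * F (u x)" for x
    proof -
      have "(\<lambda>n. l * (U (Suc n) x - U n x) + P x * F (U n x)) \<longlonglongrightarrow> l * (u x - u x) + P x * F (u x)"
        by (intro tendsto_intros LIMSEQ_Suc[OF u] u isCont_tendsto_compose[OF contF u])
      then show ?thesis by (simp add: qeq)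
    qed
  qed (use gH(1) eqn in auto)
  show ?thesis
  proof (rule that[OF sol])
    show "v x \<le> u x" for x by (rule LIMSEQ_le_const[OF u]) (use Ub(1) in auto)
    show "u x \<le> w x" for x by (rule LIMSEQ_le_const2[OF u]) (use Ub(2) in auto)
  qed
qed

section \<open>Radial solutions\<close>

text \<open>The function $u(x) = G(|x|)$, $G$ being the indefinite integral of $K$, solves
  $\Delta u + |\nabla u| = q(|x|)$ in dimension $n$; the quotient $K(t)/t$, written as an integral over
  $[0,1]$, is continuous up to $t = 0$.\<close>
definition radK :: "nat \<Rightarrow> (real \<Rightarrow> real) \<Rightarrow> real \<Rightarrow> real" where
  "radK n q t = exp (- t) * t powr (1 - real n) * integral {0..t} (\<lambda>s. exp s * s ^ (n - 1) * q s)"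

definition radG :: "nat \<Rightarrow> (real \<Rightarrow> real) \<Rightarrow> real \<Rightarrow> real" where
  "radG n q r = integral {0..r} (radK n q)"

definition radk :: "nat \<Rightarrow> (real \<Rightarrow> real) \<Rightarrow> real \<Rightarrow> real" where
  "radk n q t = integral {0..1} (\<lambda>\<sigma>. exp (t * \<sigma> - t) * \<sigma> ^ (n - 1) * q (t * \<sigma>))"

lemma radK_0: "radK n q 0 = 0" by (simp add: radK_def)

lemma radG_0: "radG n q 0 = 0" by (simp add: radG_def)

lemma powr_one_minus_nat: "0 < t \<Longrightarrow> 1 \<le> n \<Longrightarrow> t powr (1 - real n) = 1 / t ^ (n - 1)"
proof -
  assume t: "0 < t" and n: "1 \<le> n"
  have "1 - real n = - real (n - 1)" using n by (simp add: of_nat_diff)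
  then show ?thesis using t by (simp only: powr_minus_divide powr_realpow)
qed

lemma continuous_on_half_line:
  fixes F :: "real \<Rightarrow> real"
  assumes "\<And>r. continuous_on {0..r} F"
  shows "continuous_on {0..} F"
proof -
  have "continuous (at x within {0..}) F" if "0 \<le> x" for x
  proof -
    have "continuous (at x within {0..x + 1}) F"
      using assms[of "x + 1"] that by (simp add: continuous_on_eq_continuous_within)
    moreover have "at x within {0..x + 1} = at x within {0..}"
      by (rule at_within_nhd[of _ "{..<x + 1}"]) auto
    ultimately show ?thesis by simp
  qed
  then show ?thesis by (simp add: continuous_on_eq_continuous_within)
qed

context
  fixes n :: nat and q :: "real \<Rightarrow> real"
  assumes n: "1 \<le> n" and q: "continuous_on {0..} q"
begin

lemma q_cont_Icc: "continuous_on {0..t} q"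
  by (rule continuous_on_subset[OF q]) auto

lemma radK_eq: "0 \<le> t \<Longrightarrow> radK n q t = t * radk n q t"
proof (cases "t = 0")
  case False
  assume "0 \<le> t"
  with False have t: "0 < t" by simp
  let ?f = "\<lambda>s. exp s * s ^ (n - 1) * q s"
  have "continuous_on {0..t} ?f" by (intro continuous_intros q_cont_Icc)
  from integrable_integral[OF integrable_continuous_real[OF this]]
  have "(?f has_integral integral {0..t} ?f) (cbox 0 t)" by (simp only: cbox_interval)
  from has_integral_affinity'[OF this t, of 0]
  have "((\<lambda>\<sigma>. ?f (t * \<sigma>)) has_integral integral {0..t} ?f / t) {0..1}"
    using t by (simp add: divide_inverse_commute)
  then have 1: "integral {0..1} (\<lambda>\<sigma>. ?f (t * \<sigma>)) = integral {0..t} ?f / t" by (rule integral_unique)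
  have "integral {0..1} (\<lambda>\<sigma>. ?f (t * \<sigma>)) = integral {0..1} (\<lambda>\<sigma>. (exp t * t ^ (n - 1)) * (exp (t * \<sigma> - t) * \<sigma> ^ (n - 1) * q (t * \<sigma>)))"
    by (rule integral_cong) (simp add: exp_diff power_mult_distrib)
  also have "\<dots> = exp t * t ^ (n - 1) * radk n q t" unfolding radk_def by (rule integral_mult_right)
  finally have "integral {0..t} ?f = t * (exp t * t ^ (n - 1) * radk n q t)" using 1 t by (simp add: field_simps)
  then show ?thesis using t n by (simp add: radK_def powr_one_minus_nat exp_minus field_simps)
qed (simp add: radK_def)

lemma radk_cont: "continuous_on {0..} (radk n q)"
proof -
  have "continuous_on ({0..} \<times> cbox 0 1) (\<lambda>(t, \<sigma>). exp (t * \<sigma> - t) * \<sigma> ^ (n - 1) * q (t * \<sigma>))"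
    unfolding case_prod_beta
    by (intro continuous_intros continuous_on_compose2[OF q]) auto
  from integral_continuous_on_param[OF this] show ?thesis by (simp add: radk_def[abs_def])
qed

lemma radk_0: "radk n q 0 = q 0 / n"
proof -
  have "((\<lambda>x. x ^ (n - 1)) has_integral (1 ^ n / n - 0 ^ n / n)) {0..1::real}"
  proof (rule fundamental_theorem_of_calculus)
    show "((\<lambda>x. x ^ n / n) has_vector_derivative x ^ (n - 1)) (at x within {0..1})" for x :: real
      using n by (auto intro!: derivative_eq_intros simp flip: has_real_derivative_iff_has_vector_derivative)
  qed simp
  then have "integral {0..1} (\<lambda>x. x ^ (n - 1)) = 1 / real n" using n by (simp add: integral_unique)
  then show ?thesis using integral_mult_left[of "{0..1}" "\<lambda>x. x ^ (n - 1)" "q 0"] by (simp add: radk_def)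
qed

lemma radK_cont: "continuous_on {0..} (radK n q)"
  by (rule continuous_on_eq[of _ "\<lambda>t. t * radk n q t"]) (auto intro!: continuous_intros radk_cont simp: radK_eq)

lemma radK_cont_Icc: "continuous_on {0..r} (radK n q)"
  by (rule continuous_on_subset[OF radK_cont]) auto

lemma radG_derivative: "0 < r \<Longrightarrow> (radG n q has_real_derivative radK n q r) (at r)"
  using integral_has_real_derivative[OF radK_cont_Icc[of "r + 1"], of r] at_within_Icc_at[of 0 r "r + 1"]
  by (simp add: radG_def[abs_def])

lemma radG_cont: "continuous_on {0..} (radG n q)"
  unfolding radG_def[abs_def]
  by (intro continuous_on_half_line indefinite_integral_continuous_1 integrable_continuous_real radK_cont_Icc)

text \<open>This is the radial form of the equation: for u = G(|x|) with G' = K the Laplacian is K'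
  + (n - 1) K / t, and |grad u| = K as soon as K is non-negative.\<close>

lemma radK_derivative:
  assumes t: "0 < t"
  shows "(radK n q has_real_derivative q t - radK n q t - (real n - 1) / t * radK n q t) (at t)"
proof -
  let ?f = "\<lambda>s. exp s * s ^ (n - 1) * q s"
  let ?I = "\<lambda>t. integral {0..t} ?f"
  have "continuous_on {0..t + 1} ?f" by (intro continuous_intros q_cont_Icc)
  from integral_has_real_derivative[OF this, of t]
  have I: "(?I has_real_derivative ?f t) (at t)" using t at_within_Icc_at[of 0 t "t + 1"] by simp
  have p: "((\<lambda>t. exp (- t) * t powr (1 - real n)) has_real_derivative
     - exp (- t) * t powr (1 - real n) + exp (- t) * ((1 - real n) * t powr (1 - real n) / t)) (at t)"
  proof -
    have e: "((\<lambda>t. exp (- t)) has_real_derivative - exp (- t)) (at t)" by (auto intro!: derivative_eq_intros)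
    show ?thesis
      by (rule DERIV_cong[OF DERIV_mult[OF e has_real_derivative_powr[OF t, of "1 - real n"]]])
         (use t in \<open>simp add: powr_diff powr_minus_divide\<close>)
  qed
  have d: "(radK n q has_real_derivative exp (- t) * t powr (1 - real n) * ?f t
      + (- exp (- t) * t powr (1 - real n) + exp (- t) * ((1 - real n) * t powr (1 - real n) / t)) * ?I t) (at t)"
    unfolding radK_def[abs_def] by (rule DERIV_cong[OF DERIV_mult[OF p I]]) simp
  have e1: "exp (- t) * t powr (1 - real n) * ?f t = q t"
    using t n by (simp add: powr_one_minus_nat exp_minus field_simps)
  have e2: "(- exp (- t) * t powr (1 - real n) + exp (- t) * ((1 - real n) * t powr (1 - real n) / t)) * ?I t
     = - radK n q t - (real n - 1) / t * radK n q t"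
    using t by (simp add: radK_def field_simps)
  show ?thesis by (rule DERIV_cong[OF d]) (unfold e1 e2, simp)
qed

lemma radK_integrable: "radK n q integrable_on {0..r}"
  by (rule integrable_continuous_real[OF radK_cont_Icc])

lemma weighted_integrable: "(\<lambda>s. exp s * s ^ (n - 1) * q s) integrable_on {0..r}"
  by (rule integrable_continuous_real) (intro continuous_intros q_cont_Icc)

end

section \<open>Monotonicity, linearity and moment bounds of the radial integrals\<close>

lemma radK_mono:
  assumes "1 \<le> n" "continuous_on {0..} q" "continuous_on {0..} q'" and le: "\<And>s. 0 \<le> s \<Longrightarrow> s \<le> t \<Longrightarrow> q s \<le> q' s"
  shows "radK n q t \<le> radK n q' t"
  unfolding radK_def
  by (intro mult_left_mono integral_le weighted_integrable assms) (auto intro!: mult_left_mono le)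

lemma radK_scale: "radK n (\<lambda>s. c * q s) t = c * radK n q t"
proof -
  have "integral {0..t} (\<lambda>s. exp s * s ^ (n - 1) * (c * q s)) = integral {0..t} (\<lambda>s. c * (exp s * s ^ (n - 1) * q s))"
    by (rule integral_cong) simp
  then show ?thesis by (simp add: radK_def)
qed

lemma radK_add:
  assumes "1 \<le> n" "continuous_on {0..} q" "continuous_on {0..} q'"
  shows "radK n (\<lambda>s. q s + q' s) t = radK n q t + radK n q' t"
proof -
  have "integral {0..t} (\<lambda>s. exp s * s ^ (n - 1) * (q s + q' s)) = integral {0..t} (\<lambda>s. exp s * s ^ (n - 1) * q s + exp s * s ^ (n - 1) * q' s)"
    by (rule integral_cong) (simp add: algebra_simps)
  also have "\<dots> = integral {0..t} (\<lambda>s. exp s * s ^ (n - 1) * q s) + integral {0..t} (\<lambda>s. exp s * s ^ (n - 1) * q' s)"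
    by (intro integral_add weighted_integrable assms)
  finally show ?thesis by (simp add: radK_def algebra_simps)
qed

lemma radG_add:
  assumes "1 \<le> n" "continuous_on {0..} q" "continuous_on {0..} q'"
  shows "radG n (\<lambda>s. q s + q' s) r = radG n q r + radG n q' r"
  unfolding radG_def radK_add[OF assms, abs_def]
  by (intro integral_add radK_integrable assms)

lemma radK_nonneg:
  assumes "1 \<le> n" "continuous_on {0..} q" "\<And>s. 0 \<le> s \<Longrightarrow> 0 \<le> q s"
  shows "0 \<le> radK n q t"
  using radK_mono[of n "\<lambda>_. 0" q t] assms by (auto simp: radK_def)

lemma radG_mono:
  assumes "1 \<le> n" "continuous_on {0..} q" "continuous_on {0..} q'" and le: "\<And>s. 0 \<le> s \<Longrightarrow> s \<le> r \<Longrightarrow> q s \<le> q' s"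
  shows "radG n q r \<le> radG n q' r"
  unfolding radG_def by (intro integral_le radK_integrable assms radK_mono) auto

lemma nonneg_derivative_imp_le:
  fixes D :: "real \<Rightarrow> real"
  assumes c: "continuous_on {0..} D" and d: "\<And>t. 0 < t \<Longrightarrow> (D has_real_derivative D' t) (at t)" and p: "\<And>t. 0 < t \<Longrightarrow> 0 \<le> D' t"
    and r: "0 \<le> a" "a \<le> r"
  shows "D a \<le> D r"
proof (rule DERIV_nonneg_imp_increasing_open[OF r(2)])
  show "\<exists>y. (D has_real_derivative y) (at x) \<and> 0 \<le> y" if "a < x" "x < r" for x
    using d[of x] p[of x] that r by auto
  show "continuous_on {a..r} D" by (rule continuous_on_subset[OF c]) (use r in auto)
qed

lemma radG_increasing:
  assumes n: "1 \<le> n" and q: "continuous_on {0..} q" "\<And>s. 0 \<le> s \<Longrightarrow> 0 \<le> q s" and r: "0 \<le> a" "a \<le> r"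
  shows "radG n q a \<le> radG n q r"
  by (rule nonneg_derivative_imp_le[OF radG_cont[OF n q(1)] radG_derivative[OF n q(1)] _ r])
     (auto intro: radK_nonneg n q)

lemma radG_nonneg:
  assumes n: "1 \<le> n" and q: "continuous_on {0..} q" "\<And>s. 0 \<le> s \<Longrightarrow> 0 \<le> q s" and r: "0 \<le> r"
  shows "0 \<le> radG n q r"
  using radG_increasing[OF n q order_refl r] by (simp add: radG_0)

text \<open>From (t K)' = t q - t K - (n - 2) K and K \<ge> 0 one gets (n - 2) K \<le> t q - (t K)',
  to be integrated. The quantity \<open>D\<close> is the deficit, with derivative t K / (n - 2)
  \<ge> 0. The factor 1 / (n - 2) here is that of \<Lambda>_N in the statement.\<close>

lemma radG_le_moment:
  assumes n: "3 \<le> n" and q: "continuous_on {0..} q" "\<And>s. 0 \<le> s \<Longrightarrow> 0 \<le> q s" and r: "0 \<le> r"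
  shows "radG n q r \<le> integral {0..r} (\<lambda>s. s * q s) / (real n - 2)"
proof -
  have n1: "1 \<le> n" using n by simp
  let ?J = "\<lambda>r. integral {0..r} (\<lambda>s. s * q s)"
  define D where "D r = (?J r - r * radK n q r) / (real n - 2) - radG n q r" for r
  have jc: "continuous_on {0..r} (\<lambda>s. s * q s)" for r
    by (intro continuous_intros q_cont_Icc[OF n1 q(1)])
  have jd: "(?J has_real_derivative t * q t) (at t)" if t: "0 < t" for t
    using integral_has_real_derivative[OF jc[of "t + 1"], of t] at_within_Icc_at[of 0 t "t + 1"] t by simp
  have "D 0 \<le> D r"
  proof (rule nonneg_derivative_imp_le[OF _ _ _ order_refl r])
    have "continuous_on {0..} ?J"
      by (intro continuous_on_half_line indefinite_integral_continuous_1 integrable_continuous_real jc)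
    then show "continuous_on {0..} D"
      unfolding D_def using n by (intro continuous_intros radK_cont[OF n1 q(1)] radG_cont[OF n1 q(1)]) auto
    fix t :: real assume t: "0 < t"
    have "(D has_real_derivative ((t * q t - (1 * radK n q t + (q t - radK n q t - (real n - 1) / t * radK n q t) * t)) / (real n - 2) - radK n q t)) (at t)"
      unfolding D_def[abs_def]
      by (rule DERIV_diff[OF DERIV_cdivide[OF DERIV_diff[OF jd[OF t] DERIV_mult[OF DERIV_ident radK_derivative[OF n1 q(1) t]]]] radG_derivative[OF n1 q(1) t]])
    moreover have "(t * q t - (1 * radK n q t + (q t - radK n q t - (real n - 1) / t * radK n q t) * t)) / (real n - 2) - radK n q t
        = t * radK n q t / (real n - 2)"
      using t n by (simp add: field_simps)
    ultimately show "(D has_real_derivative t * radK n q t / (real n - 2)) (at t)" by simp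
    show "0 \<le> t * radK n q t / (real n - 2)" using t n radK_nonneg[OF n1 q] by simp
  qed
  then have "radG n q r \<le> (?J r - r * radK n q r) / (real n - 2)" by (simp add: D_def radG_0 radK_0)
  also have "\<dots> \<le> ?J r / (real n - 2)" using n r radK_nonneg[OF n1 q] by (intro divide_right_mono) auto
  finally show ?thesis .
qed

text \<open>Away from the origin this is the chain rule. At the origin the field \<kappa>(|x|) x is
  differentiable merely because \<kappa> is continuous, with Hessian \<kappa>(0) times the identity
  and trace n \<kappa>(0) = q(0). Non-negativity of q gives |grad u| = K without absolute
  values.\<close>

theorem radial_twice_diff:
  fixes q :: "real \<Rightarrow> real"
  assumes q: "continuous_on {0..} q" "\<And>s. 0 \<le> s \<Longrightarrow> 0 \<le> q s"
  obtains H where "twice_diff (\<lambda>x::'a::euclidean_space. c + radG DIM('a) q (norm x)) (\<lambda>x. radk DIM('a) q (norm x) *\<^sub>R x) H"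
    "\<And>x. lin_trace (H x) + norm (radk DIM('a) q (norm x) *\<^sub>R x) = q (norm x)"
proof -
  let ?N = "DIM('a)"
  have n: "1 \<le> ?N" by (simp add: Suc_leI)
  define \<kappa> where "\<kappa> = radk ?N q"
  define \<kappa>' where "\<kappa>' r = ((q r - radK ?N q r - (real ?N - 1) / r * radK ?N q r) * r - radK ?N q r) / r\<^sup>2" for r
  define H where "H x h = (if x = 0 then \<kappa> 0 *\<^sub>R h else \<kappa> (norm x) *\<^sub>R h + ((h \<bullet> sgn x) * \<kappa>' (norm x)) *\<^sub>R x)" for x h :: 'a
  have K: "radK ?N q r = r * \<kappa> r" if "0 \<le> r" for r using radK_eq[OF n q(1) that] by (simp add: \<kappa>_def)
  have \<kappa>c: "continuous_on {0..} \<kappa>" unfolding \<kappa>_def by (rule radk_cont[OF n q(1)])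
  have \<kappa>d: "(\<kappa> has_real_derivative \<kappa>' r) (at r)" if r: "0 < r" for r
  proof -
    have "((\<lambda>r. radK ?N q r / r) has_real_derivative ((q r - radK ?N q r - (real ?N - 1) / r * radK ?N q r) * r - radK ?N q r * 1) / (r * r)) (at r)"
      using r by (intro DERIV_divide radK_derivative[OF n q(1)] DERIV_ident) auto
    then have "((\<lambda>r. radK ?N q r / r) has_real_derivative \<kappa>' r) (at r)" by (simp add: \<kappa>'_def power2_eq_square)
    then show ?thesis
      by (rule has_field_derivative_transform_within_open[of _ _ _ "{0<..}"]) (use r K in auto)
  qed
  have nl: "((\<lambda>x::'a. \<kappa> (norm x)) \<longlongrightarrow> \<kappa> 0) (at 0)"
  proof -
    have "continuous_on UNIV (\<lambda>x::'a. \<kappa> (norm x))"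
      by (rule continuous_on_compose2[OF \<kappa>c]) (auto intro!: continuous_intros)
    then have "isCont (\<lambda>x::'a. \<kappa> (norm x)) 0" by (simp add: continuous_on_eq_continuous_at)
    then show ?thesis by (simp add: isCont_def)
  qed
  have d1: "((\<lambda>x. c + radG ?N q (norm x)) has_derivative (\<lambda>h. (\<kappa> (norm x) *\<^sub>R x) \<bullet> h)) (at x)" for x :: 'a
  proof (cases "x = 0")
    case False
    have "(radG ?N q has_derivative (\<lambda>h. h * radK ?N q (norm x))) (at (norm x))"
      using radG_derivative[OF n q(1), of "norm x"] False by (simp add: has_field_derivative_def mult_commute_abs)
    from has_derivative_compose[OF has_derivative_norm[OF False] this]
    have "((\<lambda>x. c + radG ?N q (norm x)) has_derivative (\<lambda>h. 0 + (h \<bullet> sgn x) * radK ?N q (norm x))) (at x)"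
      by (intro has_derivative_add has_derivative_const)
    moreover have "0 + (h \<bullet> sgn x) * radK ?N q (norm x) = (\<kappa> (norm x) *\<^sub>R x) \<bullet> h" for h
      using False by (simp add: K sgn_div_norm inner_commute)
    ultimately show ?thesis by simp
  next
    case True
    obtain B where B: "0 \<le> B" "\<And>r. 0 \<le> r \<Longrightarrow> r \<le> 1 \<Longrightarrow> \<bar>\<kappa> r\<bar> \<le> B"
    proof -
      have "compact (\<kappa> ` {0..1})" by (intro compact_continuous_image continuous_on_subset[OF \<kappa>c]) auto
      then obtain B where "\<forall>y\<in>\<kappa> ` {0..1}. norm y \<le> B" using compact_imp_bounded bounded_iff by metis
      then show ?thesis by (intro that[of "\<bar>B\<bar>"]) force+
    qed
    \<comment> \<open>Near the origin |K(t)| \<le> B t, so G is of second order there and its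
      gradient at 0 is zero.\<close>
    have G: "\<bar>radG ?N q r\<bar> \<le> B * r * r" if r: "0 \<le> r" "r \<le> 1" for r
    proof -
      have "norm (integral {0..r} (radK ?N q)) \<le> integral {0..r} (\<lambda>_. B * r)"
      proof (rule integral_norm_bound_integral[OF radK_integrable[OF n q(1)]])
        fix t assume t: "t \<in> {0..r}"
        then have "norm (radK ?N q t) = t * \<bar>\<kappa> t\<bar>" by (simp add: K abs_mult)
        also have "\<dots> \<le> r * B" using t r B by (intro mult_mono) auto
        finally show "norm (radK ?N q t) \<le> B * r" by (simp add: mult.commute)
      qed auto
      then show ?thesis using r by (simp add: radG_def ac_simps)
    qed
    have "((\<lambda>y::'a. norm ((c + radG ?N q (norm y)) - (c + radG ?N q (norm (0::'a))) - 0) / norm (y - 0)) \<longlongrightarrow> 0) (at 0)"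
    proof (rule Lim_null_comparison)
      show "((\<lambda>y::'a. B * norm y) \<longlongrightarrow> 0) (at 0)" by (auto intro!: tendsto_eq_intros)
      show "\<forall>\<^sub>F y in at (0::'a). norm (norm ((c + radG ?N q (norm y)) - (c + radG ?N q (norm (0::'a))) - 0) / norm (y - 0)) \<le> B * norm y"
        unfolding eventually_at
      proof (intro exI[of _ 1] conjI ballI impI)
        fix y :: 'a assume "y \<noteq> 0 \<and> dist y 0 < 1"
        then show "norm (norm ((c + radG ?N q (norm y)) - (c + radG ?N q (norm (0::'a))) - 0) / norm (y - 0)) \<le> B * norm y"
          using G[of "norm y"] by (simp add: radG_0 divide_le_eq)
      qed simp
    qed
    then have "((\<lambda>x::'a. c + radG ?N q (norm x)) has_derivative (\<lambda>h. 0)) (at 0)"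
      by (simp add: has_derivative_iff_norm)
    then show ?thesis using True by simp
  qed
  have d2: "((\<lambda>x. \<kappa> (norm x) *\<^sub>R x) has_derivative H x) (at x)" for x :: 'a
  proof (cases "x = 0")
    case False
    have "(\<kappa> has_derivative (\<lambda>h. h * \<kappa>' (norm x))) (at (norm x))"
      using \<kappa>d[of "norm x"] False by (simp add: has_field_derivative_def mult_commute_abs)
    from has_derivative_scaleR[OF has_derivative_compose[OF has_derivative_norm[OF False] this] has_derivative_ident]
    show ?thesis using False by (simp add: H_def[abs_def])
  next
    case True
    have "((\<lambda>y::'a. norm (\<kappa> (norm y) *\<^sub>R y - \<kappa> (norm (0::'a)) *\<^sub>R 0 - \<kappa> 0 *\<^sub>R (y - 0)) / norm (y - 0)) \<longlongrightarrow> 0) (at 0)"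
    proof (rule Lim_null_comparison)
      have "((\<lambda>y::'a. \<bar>\<kappa> (norm y) - \<kappa> 0\<bar>) \<longlongrightarrow> \<bar>\<kappa> 0 - \<kappa> 0\<bar>) (at 0)" by (intro tendsto_intros nl)
      then show "((\<lambda>y::'a. \<bar>\<kappa> (norm y) - \<kappa> 0\<bar>) \<longlongrightarrow> 0) (at 0)" by simp
      show "\<forall>\<^sub>F y in at (0::'a). norm (norm (\<kappa> (norm y) *\<^sub>R y - \<kappa> (norm (0::'a)) *\<^sub>R 0 - \<kappa> 0 *\<^sub>R (y - 0)) / norm (y - 0)) \<le> \<bar>\<kappa> (norm y) - \<kappa> 0\<bar>"
        by (rule always_eventually) (simp add: scaleR_diff_left[symmetric])
    qed
    then have "((\<lambda>x::'a. \<kappa> (norm x) *\<^sub>R x) has_derivative (\<lambda>h. \<kappa> 0 *\<^sub>R h)) (at 0)"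
      unfolding has_derivative_iff_norm by (simp add: bounded_linear_scaleR_right)
    then show ?thesis using True by (simp add: H_def[abs_def])
  qed
  show ?thesis
  proof (rule that[of H])
    show "twice_diff (\<lambda>x::'a. c + radG ?N q (norm x)) (\<lambda>x. radk ?N q (norm x) *\<^sub>R x) H"
      using d1 d2 by (simp add: twice_diff_def \<kappa>_def)
    fix x :: 'a
    have Kn: "0 \<le> radK ?N q (norm x)" by (rule radK_nonneg[OF n q])
    show "lin_trace (H x) + norm (radk ?N q (norm x) *\<^sub>R x) = q (norm x)"
    proof (cases "x = 0")
      case True
      have "lin_trace (H 0) = real ?N * \<kappa> 0" by (simp add: lin_trace_def H_def)
      also have "\<dots> = q 0" using radk_0[OF n q(1)] n by (simp add: \<kappa>_def)
      finally show ?thesis using True by simp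
    next
      case False
      define r where "r = norm x"
      have r: "0 < r" using False by (simp add: r_def)
      have "norm (\<kappa> r *\<^sub>R x) = \<bar>radK ?N q r\<bar>" using r by (simp add: K abs_mult r_def mult.commute)
      then have nk: "norm (radk ?N q (norm x) *\<^sub>R x) = radK ?N q r" using Kn by (simp add: r_def \<kappa>_def)
      have "H x = (\<lambda>h. \<kappa> r *\<^sub>R h + \<kappa>' r *\<^sub>R ((h \<bullet> sgn x) *\<^sub>R x))"
        using False by (simp add: H_def fun_eq_iff r_def mult.commute)
      then have "lin_trace (H x) = \<kappa> r * real ?N + \<kappa>' r * lin_trace (\<lambda>h. (h \<bullet> sgn x) *\<^sub>R x)"
        by (simp add: lin_trace_def inner_add_left sum.distrib sum_distrib_left mult.assoc)
      also have "lin_trace (\<lambda>h. (h \<bullet> sgn x) *\<^sub>R x) = sgn x \<bullet> x"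
        unfolding lin_trace_def by (subst euclidean_inner[of "sgn x" x]) (simp add: inner_commute)
      also have "sgn x \<bullet> x = r" using False by (simp add: sgn_div_norm r_def dot_square_norm power2_eq_square)
      finally have "lin_trace (H x) = \<kappa> r * real ?N + \<kappa>' r * r" .
      moreover have "\<kappa> r = radK ?N q r / r" using r by (simp add: K)
      moreover have "\<kappa>' r * r = q r - radK ?N q r - (real ?N - 1) / r * radK ?N q r - radK ?N q r / r"
      proof -
        have "(X * r - k) / r\<^sup>2 * r = X - k / r" for X k using r by (simp add: field_simps power2_eq_square)
        then show ?thesis by (simp only: \<kappa>'_def)
      qed
      moreover have "(real ?N - 1) / r * radK ?N q r = radK ?N q r / r * real ?N - radK ?N q r / r"
        using r by (simp add: field_simps)
      ultimately have "lin_trace (H x) = q r - radK ?N q r" by simp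
      then show ?thesis using nk by (simp add: r_def)
    qed
  qed
qed

text \<open>Monotone iteration from below; the exponential barrier comes from $f(s) \le \Lambda s$.\<close>
theorem volterra_solution:
  fixes \<phi> f :: "real \<Rightarrow> real"
  assumes n: "1 \<le> n" and \<phi>: "continuous_on {0..} \<phi>" "\<And>s. 0 \<le> s \<Longrightarrow> 0 \<le> \<phi> s"
    and f: "continuous_on {0..} f" "mono_on {0..} f" "\<And>s. 0 \<le> s \<Longrightarrow> 0 \<le> f s" "\<And>s. 1 \<le> s \<Longrightarrow> f s \<le> \<Lambda> * s" and a: "1 \<le> a"
  obtains v where "continuous_on {0..} v" "\<And>r. 0 \<le> r \<Longrightarrow> v r = a + radG n (\<lambda>s. \<phi> s * f (v s)) r"
    "\<And>r. 0 \<le> r \<Longrightarrow> a \<le> v r" "\<And>r. 0 \<le> r \<Longrightarrow> v r \<le> a * exp (\<Lambda> * radG n \<phi> r)"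
proof -
  have L0: "0 \<le> \<Lambda>" using f(4)[of 1] f(3)[of 1] by simp
  define E where "E r = a * exp (\<Lambda> * radG n \<phi> r)" for r
  have Ec: "continuous_on {0..} E" unfolding E_def by (intro continuous_intros radG_cont[OF n \<phi>(1)])
  have E1: "1 \<le> E r" if "0 \<le> r" for r
  proof -
    have "1 * 1 \<le> a * exp (\<Lambda> * radG n \<phi> r)" using a L0 radG_nonneg[OF n \<phi> that] by (intro mult_mono) auto
    then show ?thesis by (simp add: E_def)
  qed
  have Emono: "E s \<le> E t" if "0 \<le> s" "s \<le> t" for s t
    unfolding E_def using a L0 radG_increasing[OF n \<phi> that] by (intro mult_left_mono) (auto intro: mult_left_mono)
  have \<phi>Ec: "continuous_on {0..} (\<lambda>s. \<Lambda> * (\<phi> s * E s))" by (intro continuous_intros \<phi>(1) Ec)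
  \<comment> \<open>E is a supersolution of the integral equation with f(s) replaced by \<Lambda> s:
    E' = \<Lambda> K[\<phi>] E, while K[\<Lambda> \<phi> E](t) \<le> \<Lambda> E(t) K[\<phi>](t)
    because E increases. So E minus G of its source is non-decreasing, starting from a.\<close>
  have GE: "a + radG n (\<lambda>s. \<Lambda> * (\<phi> s * E s)) r \<le> E r" if r: "0 \<le> r" for r
  proof -
    define D where "D r = E r - radG n (\<lambda>s. \<Lambda> * (\<phi> s * E s)) r" for r
    have "D 0 \<le> D r"
    proof (rule nonneg_derivative_imp_le[OF _ _ _ order_refl r])
      show "continuous_on {0..} D" unfolding D_def by (intro continuous_intros Ec radG_cont[OF n \<phi>Ec])
      fix t :: real assume t: "0 < t"
      have "(E has_real_derivative \<Lambda> * radK n \<phi> t * E t) (at t)"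
        unfolding E_def[abs_def] by (auto intro!: derivative_eq_intros radG_derivative[OF n \<phi>(1) t])
      then show "(D has_real_derivative (\<Lambda> * radK n \<phi> t * E t - radK n (\<lambda>s. \<Lambda> * (\<phi> s * E s)) t)) (at t)"
        unfolding D_def[abs_def] by (intro DERIV_diff radG_derivative[OF n \<phi>Ec t])
      have "radK n (\<lambda>s. \<Lambda> * (\<phi> s * E s)) t \<le> radK n (\<lambda>s. (\<Lambda> * E t) * \<phi> s) t"
      proof (rule radK_mono[OF n \<phi>Ec])
        fix s assume s: "0 \<le> s" "s \<le> t"
        have "\<phi> s * E s \<le> \<phi> s * E t" using Emono[OF s] \<phi>(2)[OF s(1)] by (intro mult_left_mono) auto
        then show "\<Lambda> * (\<phi> s * E s) \<le> \<Lambda> * E t * \<phi> s" using mult_left_mono[OF _ L0, of "\<phi> s * E s" "\<phi> s * E t"] by (simp add: ac_simps)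
      qed (intro continuous_intros \<phi>(1))
      also have "\<dots> = \<Lambda> * E t * radK n \<phi> t" by (rule radK_scale)
      finally show "0 \<le> \<Lambda> * radK n \<phi> t * E t - radK n (\<lambda>s. \<Lambda> * (\<phi> s * E s)) t" by (simp add: ac_simps)
    qed
    then show ?thesis by (simp add: D_def E_def radG_0)
  qed
  define V where "V = rec_nat (\<lambda>r. a) (\<lambda>_ v r. a + radG n (\<lambda>s. \<phi> s * f (v s)) r)"
  have V0: "V 0 = (\<lambda>r. a)" and VS: "V (Suc k) = (\<lambda>r. a + radG n (\<lambda>s. \<phi> s * f (V k s)) r)" for k
    by (simp_all add: V_def)
  have src: "continuous_on {0..} (\<lambda>s. \<phi> s * f (w s))" if w: "continuous_on {0..} w" "\<And>r. 0 \<le> r \<Longrightarrow> 0 \<le> w r" for w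
    by (intro continuous_intros \<phi>(1) continuous_on_compose2[OF f(1) w(1)]) (use w(2) in auto)
  have VI: "continuous_on {0..} (V k) \<and> (\<forall>r\<ge>0. a \<le> V k r \<and> V k r \<le> E r)" for k
  proof (induction k)
    case 0
    have "a \<le> E r" if "0 \<le> r" for r
      using mult_left_mono[of 1 "exp (\<Lambda> * radG n \<phi> r)" a] a L0 radG_nonneg[OF n \<phi> that] by (simp add: E_def)
    then show ?case by (simp add: V0)
  next
    case (Suc k)
    have w0: "0 \<le> V k r" if "0 \<le> r" for r using Suc.IH that a by force
    have c: "continuous_on {0..} (\<lambda>s. \<phi> s * f (V k s))" by (rule src) (use Suc w0 in auto)
    have p: "0 \<le> \<phi> s * f (V k s)" if "0 \<le> s" for s using \<phi>(2) f(3) w0 that by simp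
    have "radG n (\<lambda>s. \<phi> s * f (V k s)) r \<le> radG n (\<lambda>s. \<Lambda> * (\<phi> s * E s)) r" for r
    proof (rule radG_mono[OF n c \<phi>Ec])
      fix s assume s: "0 \<le> s" "s \<le> r"
      have v: "1 \<le> V k s" "V k s \<le> E s" using Suc.IH s a by force+
      have "f (V k s) \<le> \<Lambda> * V k s" by (rule f(4)[OF v(1)])
      also have "\<dots> \<le> \<Lambda> * E s" using v L0 by (intro mult_left_mono) auto
      finally have "\<phi> s * f (V k s) \<le> \<phi> s * (\<Lambda> * E s)" using \<phi>(2)[OF s(1)] by (intro mult_left_mono)
      then show "\<phi> s * f (V k s) \<le> \<Lambda> * (\<phi> s * E s)" by (simp add: ac_simps)
    qed
    then have "V (Suc k) r \<le> E r" if "0 \<le> r" for r using GE[OF that] unfolding VS by (smt (verit))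
    moreover have "a \<le> V (Suc k) r" if "0 \<le> r" for r using radG_nonneg[OF n c p that] by (simp add: VS)
    moreover have "continuous_on {0..} (V (Suc k))" unfolding VS by (intro continuous_intros radG_cont[OF n c])
    ultimately show ?case by blast
  qed
  have Vc: "continuous_on {0..} (V k)" and Va: "0 \<le> r \<Longrightarrow> a \<le> V k r" and VE: "0 \<le> r \<Longrightarrow> V k r \<le> E r" for k r
    using VI[of k] by auto
  have V0': "0 \<le> V k r" if "0 \<le> r" for k r using Va[OF that, of k] a by linarith
  have Sc: "continuous_on {0..} (\<lambda>s. \<phi> s * f (V k s))" for k by (rule src[OF Vc V0'])
  have Vmono: "V k r \<le> V (Suc k) r" if "0 \<le> r" for k r
    using that
  proof (induction k arbitrary: r)
    case 0 then show ?case using Va[of r 1] by (simp add: V0)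
  next
    case (Suc k)
    have "radG n (\<lambda>s. \<phi> s * f (V k s)) r \<le> radG n (\<lambda>s. \<phi> s * f (V (Suc k) s)) r"
    proof (rule radG_mono[OF n Sc Sc])
      fix s assume s: "0 \<le> s" "s \<le> r"
      show "\<phi> s * f (V k s) \<le> \<phi> s * f (V (Suc k) s)"
        using Suc.IH[OF s(1)] s V0' \<phi>(2) by (intro mult_left_mono mono_onD[OF f(2)]) auto
    qed
    then show ?case unfolding VS[of k] VS[of "Suc k"] by simp
  qed
  have "\<exists>L. (\<lambda>k. V k r) \<longlonglongrightarrow> L" if r: "0 \<le> r" for r
  proof -
    have "incseq (\<lambda>k. V k r)" using Vmono[OF r] by (simp add: incseq_Suc_iff)
    then show ?thesis using incseq_convergent[of "\<lambda>k. V k r" "E r"] VE[OF r] by metis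
  qed
  then obtain v where v: "\<And>r. 0 \<le> r \<Longrightarrow> (\<lambda>k. V k r) \<longlonglongrightarrow> v r" by metis
  have va: "a \<le> v r" if r: "0 \<le> r" for r by (rule LIMSEQ_le_const[OF v[OF r]]) (use Va[OF r] in auto)
  have vE: "v r \<le> E r" if r: "0 \<le> r" for r by (rule LIMSEQ_le_const2[OF v[OF r]]) (use VE[OF r] in auto)
  \<comment> \<open>Q dominates the sources of all iterates; Q and K[Q] are the majorants in the two
    passages to the limit, under the inner and the outer integral.\<close>
  define Q where "Q s = \<phi> s * f (E s)" for s
  have Qc: "continuous_on {0..} Q" unfolding Q_def by (rule src[OF Ec]) (use E1 in force)
  have SQ: "\<phi> s * f (V k s) \<le> Q s" if "0 \<le> s" for s k
    unfolding Q_def using VE[OF that, of k] V0'[OF that, of k] E1[OF that] \<phi>(2)[OF that]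
    by (intro mult_left_mono mono_onD[OF f(2)]) auto
  have S0: "0 \<le> \<phi> s * f (V k s)" if "0 \<le> s" for s k using \<phi>(2) f(3) V0' that by simp
  have KQ: "0 \<le> radK n (\<lambda>s. \<phi> s * f (V k s)) t" "radK n (\<lambda>s. \<phi> s * f (V k s)) t \<le> radK n Q t" for k t
    using radK_nonneg[OF n Sc S0] radK_mono[OF n Sc Qc, of t k] SQ by auto
  \<comment> \<open>Increments of the iterates are integrals of K, and these are bounded by K[Q] on
    bounded intervals. The common local Lipschitz constant survives the limit.\<close>
  have vc: "continuous_on {0..} v"
  proof -
    have loc: "continuous_on {0..R} v" for R
    proof -
      have "compact (radK n Q ` {0..R})"
        by (intro compact_continuous_image radK_cont_Icc[OF n Qc]) auto
      then obtain B0 where "\<forall>y\<in>radK n Q ` {0..R}. norm y \<le> B0" using compact_imp_bounded bounded_iff by metis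
      then have B: "radK n Q t \<le> \<bar>B0\<bar>" if "0 \<le> t" "t \<le> R" for t using that by force
      have lip: "\<bar>V (Suc k) y - V (Suc k) x\<bar> \<le> \<bar>B0\<bar> * (y - x)" if xy: "0 \<le> x" "x \<le> y" "y \<le> R" for k x y
      proof -
        let ?K = "radK n (\<lambda>s. \<phi> s * f (V k s))"
        have "integral {0..x} ?K + integral {x..y} ?K = integral {0..y} ?K"
          by (rule Henstock_Kurzweil_Integration.integral_combine) (use xy radK_integrable[OF n Sc] in auto)
        then have "V (Suc k) y - V (Suc k) x = integral {x..y} ?K" by (simp add: VS radG_def)
        moreover have "norm (integral {x..y} ?K) \<le> integral {x..y} (\<lambda>_. \<bar>B0\<bar>)"
        proof (rule integral_norm_bound_integral)
          show "?K integrable_on {x..y}"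
            by (rule integrable_continuous_real) (rule continuous_on_subset[OF radK_cont[OF n Sc]], use xy in auto)
          show "norm (?K t) \<le> \<bar>B0\<bar>" if "t \<in> {x..y}" for t using KQ[of k t] B[of t] that xy by auto
        qed auto
        ultimately show ?thesis using xy by (simp add: mult.commute)
      qed
      have lv: "\<bar>v y - v x\<bar> \<le> \<bar>B0\<bar> * (y - x)" if xy: "0 \<le> x" "x \<le> y" "y \<le> R" for x y
        by (rule LIMSEQ_le_const2[OF tendsto_rabs[OF tendsto_diff[OF LIMSEQ_Suc[OF v] LIMSEQ_Suc[OF v]]]])
           (use lip[OF xy] xy in auto)
      have "\<bar>B0\<bar>-lipschitz_on {0..R} v"
      proof (rule lipschitz_onI)
        fix x y assume "x \<in> {0..R}" "y \<in> {0..R}"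
        then show "dist (v x) (v y) \<le> \<bar>B0\<bar> * dist x y"
          using lv[of x y] lv[of y x] by (cases "x \<le> y") (auto simp: dist_real_def abs_minus_commute)
      qed simp
      then show ?thesis by (rule lipschitz_on_continuous_on)
    qed
    show ?thesis by (rule continuous_on_half_line[OF loc])
  qed
  have v0: "0 \<le> v r" if "0 \<le> r" for r using va[OF that] a by linarith
  have flim: "(\<lambda>k. \<phi> s * f (V k s)) \<longlonglongrightarrow> \<phi> s * f (v s)" if s: "0 \<le> s" for s
    by (intro tendsto_mult tendsto_const continuous_on_tendsto_compose[OF f(1) v[OF s]])
       (use v0 V0' s in auto)
  have Klim: "(\<lambda>k. radK n (\<lambda>s. \<phi> s * f (V k s)) t) \<longlonglongrightarrow> radK n (\<lambda>s. \<phi> s * f (v s)) t" for t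
  proof -
    have "(\<lambda>k. integral {0..t} (\<lambda>s. exp s * s ^ (n - 1) * (\<phi> s * f (V k s)))) \<longlonglongrightarrow> integral {0..t} (\<lambda>s. exp s * s ^ (n - 1) * (\<phi> s * f (v s)))"
    proof (rule dominated_convergence(2)[where h="\<lambda>s. exp s * s ^ (n - 1) * Q s"])
      show "(\<lambda>s. exp s * s ^ (n - 1) * (\<phi> s * f (V k s))) integrable_on {0..t}" for k by (rule weighted_integrable[OF n Sc])
      show "(\<lambda>s. exp s * s ^ (n - 1) * Q s) integrable_on {0..t}" by (rule weighted_integrable[OF n Qc])
      show "norm (exp s * s ^ (n - 1) * (\<phi> s * f (V k s))) \<le> exp s * s ^ (n - 1) * Q s" if "s \<in> {0..t}" for k s
      proof -
        have "norm (exp s * s ^ (n - 1) * (\<phi> s * f (V k s))) = exp s * s ^ (n - 1) * (\<phi> s * f (V k s))"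
          using S0[of s k] that by simp
        then show ?thesis using SQ[of s k] that by (auto intro: mult_left_mono)
      qed
      show "(\<lambda>k. exp s * s ^ (n - 1) * (\<phi> s * f (V k s))) \<longlonglongrightarrow> exp s * s ^ (n - 1) * (\<phi> s * f (v s))" if "s \<in> {0..t}" for s
        using that by (intro tendsto_mult_left flim) auto
    qed
    then show ?thesis unfolding radK_def by (intro tendsto_mult_left)
  qed
  have Glim: "(\<lambda>k. radG n (\<lambda>s. \<phi> s * f (V k s)) r) \<longlonglongrightarrow> radG n (\<lambda>s. \<phi> s * f (v s)) r" for r
    unfolding radG_def
    by (rule dominated_convergence(2)[where h="radK n Q"]) (use KQ Klim radK_integrable[OF n Sc] radK_integrable[OF n Qc] in auto)
  show ?thesis
  proof (rule that[OF vc])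
    fix r :: real assume r: "0 \<le> r"
    have "(\<lambda>k. V (Suc k) r) \<longlonglongrightarrow> a + radG n (\<lambda>s. \<phi> s * f (v s)) r"
      unfolding VS by (intro tendsto_intros Glim)
    then show "v r = a + radG n (\<lambda>s. \<phi> s * f (v s)) r" using LIMSEQ_unique[OF LIMSEQ_Suc[OF v[OF r]]] by auto
    show "a \<le> v r" by (rule va[OF r])
    show "v r \<le> a * exp (\<Lambda> * radG n \<phi> r)" using vE[OF r] by (simp add: E_def)
  qed
qed

section \<open>Half-line integrals, spherical extremes and approximation\<close>

lemma nn_integral_interval:
  fixes F :: "real \<Rightarrow> real"
  assumes c: "continuous_on {a..r} F" and p: "\<And>s. a \<le> s \<Longrightarrow> s \<le> r \<Longrightarrow> 0 \<le> F s"
  shows "(\<integral>\<^sup>+ s\<in>{a..r}. ennreal (F s) \<partial>lborel) = ennreal (integral {a..r} F)"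
proof -
  have i: "set_integrable lborel {a..r} F" by (rule borel_integrable_atLeastAtMost'[OF c])
  have "(\<integral>\<^sup>+ s\<in>{a..r}. ennreal (F s) \<partial>lborel) = (\<integral>\<^sup>+ s. ennreal (indicator {a..r} s *\<^sub>R F s) \<partial>lborel)"
    by (intro nn_integral_cong) (auto simp: indicator_def)
  also have "\<dots> = ennreal (\<integral>s. indicator {a..r} s *\<^sub>R F s \<partial>lborel)"
    using i p by (intro nn_integral_eq_integral) (auto simp: set_integrable_def indicator_def)
  also have "(\<integral>s. indicator {a..r} s *\<^sub>R F s \<partial>lborel) = integral {a..r} F"
    using set_borel_integral_eq_integral(2)[OF i] by (simp add: set_lebesgue_integral_def)
  finally show ?thesis .
qed

text \<open>Monotone convergence over the intervals from a to a + i. It turns both the hypothesis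
  and the criterion into boundedness of primitives, the form used everywhere else.\<close>

lemma nn_integral_half_line_finite_iff:
  fixes F :: "real \<Rightarrow> real"
  assumes c: "continuous_on {a..} F" and p: "\<And>s. a \<le> s \<Longrightarrow> 0 \<le> F s"
  shows "(\<integral>\<^sup>+ s\<in>{a..}. ennreal (F s) \<partial>lborel) < \<infinity> \<longleftrightarrow> (\<exists>M. \<forall>r\<ge>a. integral {a..r} F \<le> M)"
proof -
  have ci: "continuous_on {a..r} F" for r by (rule continuous_on_subset[OF c]) auto
  have ii: "0 \<le> integral {a..r} F" for r by (rule integral_nonneg[OF integrable_continuous_real[OF ci]]) (use p in auto)
  have eq: "(\<integral>\<^sup>+ s\<in>{a..r}. ennreal (F s) \<partial>lborel) = ennreal (integral {a..r} F)" for r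
    by (rule nn_integral_interval[OF ci p])
  show ?thesis
  proof
    assume fin: "(\<integral>\<^sup>+ s\<in>{a..}. ennreal (F s) \<partial>lborel) < \<infinity>"
    have "integral {a..r} F \<le> enn2real (\<integral>\<^sup>+ s\<in>{a..}. ennreal (F s) \<partial>lborel)" for r
    proof -
      have "ennreal (integral {a..r} F) \<le> (\<integral>\<^sup>+ s\<in>{a..}. ennreal (F s) \<partial>lborel)"
        unfolding eq[symmetric] by (intro nn_integral_mono) (auto simp: indicator_def)
      from enn2real_mono[OF this] fin show ?thesis using ii by simp
    qed
    then show "\<exists>M. \<forall>r\<ge>a. integral {a..r} F \<le> M" by blast
  next
    assume "\<exists>M. \<forall>r\<ge>a. integral {a..r} F \<le> M"
    then obtain M where M: "\<And>r. a \<le> r \<Longrightarrow> integral {a..r} F \<le> M" by blast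
    let ?f = "\<lambda>i::nat. \<lambda>s. ennreal (F s) * indicator {a..a + real i} s"
    have mi: "?f i \<in> borel_measurable lborel" for i
    proof -
      have "(\<lambda>s. ennreal (indicator {a..a + real i} s *\<^sub>R F s)) \<in> borel_measurable lborel"
        using borel_integrable_atLeastAtMost'[OF ci[of "a + real i"]] unfolding set_integrable_def by measurable
      then show ?thesis by (rule measurable_cong[THEN iffD1, rotated]) (auto simp: indicator_def)
    qed
    have "(SUP i. ?f i s) = ennreal (F s) * indicator {a..} s" for s
    proof (cases "a \<le> s")
      case True
      obtain i where i: "s \<le> a + real i" using real_arch_simple[of "s - a"] by (auto simp: algebra_simps)
      show ?thesis
      proof (rule antisym)
        show "(SUP i. ?f i s) \<le> ennreal (F s) * indicator {a..} s" by (rule SUP_least) (auto simp: indicator_def)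
        have "ennreal (F s) * indicator {a..} s = ?f i s" using True i by (simp add: indicator_def)
        also have "\<dots> \<le> (SUP i. ?f i s)" by (rule SUP_upper) simp
        finally show "ennreal (F s) * indicator {a..} s \<le> (SUP i. ?f i s)" .
      qed
    qed (simp add: indicator_def)
    then have "(\<integral>\<^sup>+ s\<in>{a..}. ennreal (F s) \<partial>lborel) = (\<integral>\<^sup>+ s. (SUP i. ?f i s) \<partial>lborel)" by simp
    also have "\<dots> = (SUP i. \<integral>\<^sup>+ s. ?f i s \<partial>lborel)"
      by (rule nn_integral_monotone_convergence_SUP[OF _ mi]) (auto simp: incseq_def le_fun_def indicator_def)
    also have "\<dots> \<le> ennreal M"
      unfolding eq by (rule SUP_least) (auto intro!: ennreal_leI M)
    also have "\<dots> < \<infinity>" by simp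
    finally show "(\<integral>\<^sup>+ s\<in>{a..}. ennreal (F s) \<partial>lborel) < \<infinity>" .
  qed
qed

text \<open>Points in the same direction on two spheres are as close as the radii, so uniform
  continuity of p on a larger ball compares the two suprema in both directions.\<close>

lemma continuous_on_Sup_sphere:
  fixes p :: "'a::euclidean_space \<Rightarrow> real"
  assumes p: "continuous_on UNIV p"
  shows "continuous_on {0..} (\<lambda>r. Sup (p ` sphere 0 r))"
proof -
  have bdd: "bdd_above (p ` sphere 0 r)" for r
    by (intro bounded_imp_bdd_above compact_imp_bounded compact_continuous_image continuous_on_subset[OF p]) auto
  show ?thesis
    unfolding continuous_on_iff
  proof (intro ballI allI impI)
    fix r e :: real assume r: "r \<in> {0..}" and e: "0 < e"
    have "uniformly_continuous_on (cball 0 (r + 1)) p"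
      by (intro compact_uniformly_continuous continuous_on_subset[OF p]) auto
    then obtain d where d: "0 < d" "\<And>x y. x \<in> cball 0 (r + 1) \<Longrightarrow> y \<in> cball 0 (r + 1) \<Longrightarrow> dist y x < d \<Longrightarrow> dist (p y) (p x) < e / 2"
      unfolding uniformly_continuous_on_def using e by (metis half_gt_zero)
    have main: "Sup (p ` sphere 0 s) \<le> Sup (p ` sphere 0 t) + e / 2"
      if st: "0 \<le> s" "0 \<le> t" "s \<le> r + 1" "t \<le> r + 1" "\<bar>s - t\<bar> < d" for s t
    proof (rule cSup_least)
      show "p ` sphere 0 s \<noteq> {}" using st by simp
      fix y assume "y \<in> p ` sphere 0 s"
      then obtain x where x: "norm x = s" "y = p x" by auto
      \<comment> \<open>At the origin the direction is not determined by x, and any unit vector will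
        do.\<close>
      obtain u :: 'a where u: "norm u = 1" "x = s *\<^sub>R u"
      proof (cases "x = 0")
        case True
        obtain b :: 'a where "b \<in> Basis" using nonempty_Basis by blast
        then show ?thesis using that[of b] x True by auto
      next
        case False
        have "norm x *\<^sub>R sgn x = x" using False by (simp add: sgn_div_norm)
        then show ?thesis using that[of "sgn x"] x False by (simp add: norm_sgn)
      qed
      have t: "norm (t *\<^sub>R u) = t" using u st by simp
      have "dist (p x) (p (t *\<^sub>R u)) < e / 2"
        using st x t u by (intro d(2)) (auto simp: dist_norm scaleR_diff_left[symmetric])
      moreover have "p (t *\<^sub>R u) \<le> Sup (p ` sphere 0 t)" using t by (intro cSup_upper bdd imageI) simp
      ultimately show "y \<le> Sup (p ` sphere 0 t) + e / 2" using x(2) unfolding dist_real_def by linarith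
    qed
    show "\<exists>d>0. \<forall>s\<in>{0..}. dist s r < d \<longrightarrow> dist (Sup (p ` sphere 0 s)) (Sup (p ` sphere 0 r)) < e"
    proof (intro exI[of _ "min d 1"] conjI ballI impI)
      fix s assume s: "s \<in> {0..}" "dist s r < min d 1"
      have "s \<le> r + 1" "\<bar>s - r\<bar> < d" "\<bar>r - s\<bar> < d" using s(2) by (auto simp: dist_real_def abs_less_iff)
      then show "dist (Sup (p ` sphere 0 s)) (Sup (p ` sphere 0 r)) < e"
        using main[of s r] main[of r s] s r e by (simp add: dist_real_def)
    qed (use d in auto)
  qed
qed

lemma continuous_on_Inf_sphere:
  fixes p :: "'a::euclidean_space \<Rightarrow> real"
  assumes p: "continuous_on UNIV p"
  shows "continuous_on {0..} (\<lambda>r. Inf (p ` sphere 0 r))"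
proof -
  have "continuous_on {0..} (\<lambda>r. - Sup ((\<lambda>x. - p x) ` sphere 0 r))"
    by (intro continuous_on_minus continuous_on_Sup_sphere p)
  then show ?thesis by (simp add: Inf_real_def image_image)
qed

lemma sphere_extremes:
  fixes p :: "'a::euclidean_space \<Rightarrow> real"
  assumes p: "continuous_on UNIV p"
  shows "p x \<le> Sup (p ` sphere 0 (norm x))" "Inf (p ` sphere 0 (norm x)) \<le> p x"
    "0 \<le> r \<Longrightarrow> Inf (p ` sphere 0 r) \<le> Sup (p ` sphere 0 r)"
proof -
  have b: "bounded (p ` sphere 0 r)" for r
    by (intro compact_imp_bounded compact_continuous_image continuous_on_subset[OF p]) auto
  show u: "p x \<le> Sup (p ` sphere 0 (norm x))" for x
    by (intro cSup_upper bounded_imp_bdd_above b imageI) auto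
  show l: "Inf (p ` sphere 0 (norm x)) \<le> p x" for x
    by (intro cInf_lower bounded_imp_bdd_below b imageI) auto
  show "Inf (p ` sphere 0 r) \<le> Sup (p ` sphere 0 r)" if r: "0 \<le> r"
  proof -
    obtain b :: 'a where "b \<in> Basis" using nonempty_Basis by blast
    then have "norm (r *\<^sub>R b) = r" using r by simp
    then show ?thesis using u[of "r *\<^sub>R b"] l[of "r *\<^sub>R b"] by simp
  qed
qed

text \<open>A one-sided moving average $k\int_{s-1/k}^{s} g$, written as a difference of antiderivatives.\<close>
lemma mono_lipschitz_approx:
  fixes g :: "real \<Rightarrow> real"
  assumes gc: "continuous_on UNIV g" and gm: "mono g" and g0: "\<And>s. 0 \<le> g s" and gB: "\<And>s. g s \<le> B" and k: "1 \<le> (k::real)"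
  obtains F K where "mono F" "\<And>s t. \<bar>F s - F t\<bar> \<le> K * \<bar>s - t\<bar>" "\<And>s. 0 \<le> s \<Longrightarrow> g (s - 1 / k) \<le> F s" "\<And>s. 0 \<le> s \<Longrightarrow> F s \<le> g s"
proof -
  \<comment> \<open>Any base point below -1 serves: for s \<ge> 0 and k \<ge> 1 the averages reach
    down to -1 at most.\<close>
  define \<Gamma> where "\<Gamma> s = integral {-2..s} g" for s
  have k1: "1 / k \<le> 1" "0 < 1 / k" using k by auto
  have \<Gamma>d: "(\<Gamma> has_real_derivative g s) (at s)" if s: "-2 < s" for s
    using integral_has_real_derivative[of "-2" "s + 1" g s] continuous_on_subset[OF gc, of "{-2..s+1}"]
      at_within_Icc_at[of "-2" s "s + 1"] s by (simp add: \<Gamma>_def[abs_def])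
  define F where "F s = k * (\<Gamma> (max 0 s) - \<Gamma> (max 0 s - 1 / k))" for s
  \<comment> \<open>The derivative of the moving average is k (g r - g (r - 1/k)). It is
    non-negative by monotonicity and at most k B by boundedness, which gives both the monotonicity
    and the Lipschitz constant of F.\<close>
  have incr: "0 \<le> F t - F s \<and> F t - F s \<le> k * B * (t - s)" if st: "0 \<le> s" "s \<le> t" for s t
  proof (cases "s = t")
    case False
    then have lt: "s < t" using st by simp
    let ?D = "\<lambda>r. k * (\<Gamma> r - \<Gamma> (r - 1 / k))"
    have D: "(?D has_real_derivative k * (g r - g (r - 1 / k))) (at r)" if r: "s \<le> r" for r
    proof -
      have r2: "-2 < r" "-2 < r - 1 / k" using r st k1 by linarith+
      have "((\<lambda>r. \<Gamma> (r - 1 / k)) has_real_derivative g (r - 1 / k) * 1) (at r)"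
        by (rule DERIV_chain2[where g="\<lambda>r. r - 1 / k" and x=r, OF \<Gamma>d[OF r2(2)]]) (auto intro!: derivative_eq_intros)
      then show ?thesis by (intro DERIV_cmult DERIV_diff \<Gamma>d[OF r2(1)]) simp
    qed
    from MVT2[OF lt, of ?D "\<lambda>r. k * (g r - g (r - 1 / k))"] D
    obtain z where z: "s < z" "z < t" "?D t - ?D s = (t - s) * (k * (g z - g (z - 1 / k)))" by auto
    have "g (z - 1 / k) \<le> g z" using k1 by (intro monoD[OF gm]) auto
    then have 1: "0 \<le> g z - g (z - 1 / k)" "g z - g (z - 1 / k) \<le> B" using gB[of z] g0[of "z - 1 / k"] by linarith+
    have "F t - F s = (t - s) * (k * (g z - g (z - 1 / k)))" using z st by (simp add: F_def)
    moreover have "0 \<le> (t - s) * (k * (g z - g (z - 1 / k)))" using lt k 1 by simp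
    moreover have "(t - s) * (k * (g z - g (z - 1 / k))) \<le> (t - s) * (k * B)" using lt k 1 by (intro mult_left_mono) auto
    ultimately show ?thesis by (simp add: ac_simps)
  qed simp
  have Fmax: "F s = F (max 0 s)" for s by (simp add: F_def)
  have mono: "mono F"
  proof (rule monoI)
    fix s t :: real assume "s \<le> t"
    then show "F s \<le> F t" using incr[of "max 0 s" "max 0 t"] Fmax[of s] Fmax[of t] by auto
  qed
  have B0: "0 \<le> B" using g0[of 0] gB[of 0] by linarith
  have lip1: "\<bar>F s - F t\<bar> \<le> k * B * \<bar>s - t\<bar>" if "s \<le> t" for s t
  proof -
    have "\<bar>F s - F t\<bar> \<le> k * B * (max 0 t - max 0 s)"
      using incr[of "max 0 s" "max 0 t"] that Fmax[of s] Fmax[of t] by auto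
    also have "\<dots> \<le> k * B * \<bar>s - t\<bar>" using k B0 that by (intro mult_left_mono) auto
    finally show ?thesis .
  qed
  have lip: "\<bar>F s - F t\<bar> \<le> k * B * \<bar>s - t\<bar>" for s t
    using lip1[of s t] lip1[of t s] by (cases "s \<le> t") (auto simp: abs_minus_commute)
  have btw: "g (s - 1 / k) \<le> F s \<and> F s \<le> g s" if s: "0 \<le> s" for s
  proof -
    have "s - 1 / k < s" using k1 by simp
    from MVT2[OF this, of \<Gamma> g] \<Gamma>d s k1
    obtain z where z: "s - 1 / k < z" "z < s" "\<Gamma> s - \<Gamma> (s - 1 / k) = (s - (s - 1 / k)) * g z" by auto
    have "F s = g z" using z s k by (simp add: F_def)
    then show ?thesis using z monoD[OF gm, of "s - 1 / k" z] monoD[OF gm, of z s] by auto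
  qed
  show ?thesis by (rule that[of F "k * B"]) (use mono lip btw in auto)
qed

text \<open>Diagonal selection on a countable dense set; the Lipschitz bound, uniform in n on balls,
  then carries the Cauchy property to every point.\<close>

lemma convergent_subsequence_locally_lipschitz:
  fixes u :: "nat \<Rightarrow> 'a::euclidean_space \<Rightarrow> real"
  assumes bd: "\<And>x. \<exists>B. \<forall>n. \<bar>u n x\<bar> \<le> B"
    and lip: "\<And>R. \<exists>L\<ge>0. \<forall>n x y. norm x \<le> R \<longrightarrow> norm y \<le> R \<longrightarrow> \<bar>u n x - u n y\<bar> \<le> L * norm (x - y)"
  obtains k v where "strict_mono (k :: nat \<Rightarrow> nat)" "\<And>x. (\<lambda>n. u (k n) x) \<longlonglongrightarrow> v x"
proof -
  obtain D :: "'a set" where D: "countable D" "\<And>X. open X \<Longrightarrow> X \<noteq> {} \<Longrightarrow> \<exists>d\<in>D. d \<in> X"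
    by (rule countable_dense_setE) blast
  obtain B where B: "\<And>n x. \<bar>u n x\<bar> \<le> B x" using bd by metis
  have B0: "0 \<le> B x" for x using order_trans[OF abs_ge_zero B[of 0 x]] .
  \<comment> \<open>Division by 1 + B x makes one bound serve for all points, as
    \<open>function_convergent_subsequence\<close> requires; it is undone for each point
    afterwards.\<close>
  define W where "W n x = u n x / (1 + B x)" for n x
  have nb: "norm (W n x) \<le> 1" if "x \<in> D" for n x using B[of n x] B0[of x] by (simp add: W_def divide_le_eq)
  obtain k where k: "strict_mono (k :: nat \<Rightarrow> nat)" "\<And>x. x \<in> D \<Longrightarrow> \<exists>l. (\<lambda>n. W (k n) x) \<longlonglongrightarrow> l"
    by (rule function_convergent_subsequence[of D W 1, OF D(1) nb]) blast+
  have kD: "\<exists>l. (\<lambda>n. u (k n) x) \<longlonglongrightarrow> l" if x: "x \<in> D" for x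
  proof -
    obtain l where l: "(\<lambda>n. W (k n) x) \<longlonglongrightarrow> l" using k(2)[OF x] by blast
    have "1 + B x \<noteq> 0" using B0[of x] by linarith
    then have "(1 + B x) * W n x = u n x" for n by (simp add: W_def)
    then have "(\<lambda>n. u (k n) x) \<longlonglongrightarrow> (1 + B x) * l" using tendsto_mult_left[OF l, of "1 + B x"] by simp
    then show ?thesis by blast
  qed
  have "convergent (\<lambda>n. u (k n) x)" for x
  proof (rule Cauchy_convergent, rule metric_CauchyI)
    fix e :: real assume e: "0 < e"
    obtain L where L: "0 \<le> L" "\<And>n x' y. norm x' \<le> norm x + 1 \<Longrightarrow> norm y \<le> norm x + 1 \<Longrightarrow> \<bar>u n x' - u n y\<bar> \<le> L * norm (x' - y)"
      using lip[of "norm x + 1"] by blast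
    define d where "d = min 1 (e / (4 * (L + 1)))"
    have d: "0 < d" "d \<le> 1" using e L by (auto simp: d_def)
    obtain y where y: "y \<in> D" "y \<in> ball x d" using D(2)[of "ball x d"] d by auto
    have yn: "norm (x - y) < d" using y by (simp add: dist_norm)
    then have "norm y \<le> norm x + 1" using norm_triangle_ineq3[of x y] d by linarith
    then have xy: "\<bar>u n x - u n y\<bar> \<le> e / 4" for n
    proof -
      assume "norm y \<le> norm x + 1"
      then have "\<bar>u n x - u n y\<bar> \<le> L * norm (x - y)" by (intro L) auto
      also have "\<dots> \<le> (L + 1) * (e / (4 * (L + 1)))"
        using yn L by (intro mult_mono) (auto simp: d_def)
      also have "\<dots> = e / 4" using L by (simp add: field_simps)
      finally show ?thesis .
    qed
    obtain l where "(\<lambda>n. u (k n) y) \<longlonglongrightarrow> l" using kD[OF y(1)] by blast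
    then have "Cauchy (\<lambda>n. u (k n) y)" by (rule LIMSEQ_imp_Cauchy)
    then obtain M where M: "\<And>m n. m \<ge> M \<Longrightarrow> n \<ge> M \<Longrightarrow> dist (u (k m) y) (u (k n) y) < e / 4"
      using e by (meson metric_CauchyD zero_less_divide_iff zero_less_numeral)
    show "\<exists>M. \<forall>m\<ge>M. \<forall>n\<ge>M. dist (u (k m) x) (u (k n) x) < e"
    proof (intro exI allI impI)
      fix m n assume "M \<le> m" "M \<le> n"
      then show "dist (u (k m) x) (u (k n) x) < e"
        using M[of m n] xy[of "k m"] xy[of "k n"] e unfolding dist_real_def by linarith
    qed
  qed
  then obtain v where "\<And>x. (\<lambda>n. u (k n) x) \<longlonglongrightarrow> v x" unfolding convergent_def by metis
  then show ?thesis using k(1) that by blast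
qed

lemma hoelder_loc_radial_cutoff: "hoelder_loc (\<lambda>x::'a::real_normed_vector. max 0 (min 1 (c - norm x)))"
proof (rule hoelder_locI_lipschitz, intro exI[of _ 1] conjI allI impI)
  fix x y :: 'a
  have "\<bar>max 0 (min 1 (c - norm x)) - max 0 (min 1 (c - norm y))\<bar> \<le> \<bar>norm x - norm y\<bar>"
    by (auto simp: max_def min_def abs_le_iff)
  also have "\<dots> \<le> norm (x - y)" by (rule norm_triangle_ineq3)
  finally show "norm (max 0 (min 1 (c - norm x)) - max 0 (min 1 (c - norm y))) \<le> 1 * norm (x - y)" by simp
qed simp

lemma hoelder_loc_of_loc_holder_UNIV:
  fixes p :: "'a::euclidean_space \<Rightarrow> real"
  assumes a: "0 < a" "a \<le> 1" and p: "loc_holder_on a UNIV p"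
  shows "hoelder_loc p"
proof (rule hoelder_locI)
  fix R :: real
  have "\<exists>C. \<forall>x\<in>cball 0 R. \<forall>y\<in>cball 0 R. \<bar>p x - p y\<bar> \<le> C * dist x y powr a"
    using p unfolding loc_holder_on_def by (auto dest!: spec[of _ "cball 0 R"])
  then obtain C where "\<forall>x\<in>cball 0 R. \<forall>y\<in>cball 0 R. \<bar>p x - p y\<bar> \<le> C * dist x y powr a" by blast
  then have C: "\<bar>p x - p y\<bar> \<le> C * dist x y powr a" if "norm x \<le> R" "norm y \<le> R" for x y using that by simp
  have "norm (p x - p y) \<le> \<bar>C\<bar> * norm (x - y) powr a" if "norm x \<le> R" "norm y \<le> R" for x y
  proof -
    have "C * dist x y powr a \<le> \<bar>C\<bar> * dist x y powr a" by (intro mult_right_mono) auto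
    then show ?thesis using C[OF that] by (simp add: dist_norm)
  qed
  then show "\<exists>a A. 0 < a \<and> a \<le> 1 \<and> 0 \<le> A \<and> (\<forall>x y. norm x \<le> R \<longrightarrow> norm y \<le> R \<longrightarrow> norm (p x - p y) \<le> A * norm (x - y) powr a)"
    using a by (intro exI[of _ a] exI[of _ "\<bar>C\<bar>"]) auto
qed

lemma hoelder_loc_extend:
  fixes f :: "real \<Rightarrow> real"
  assumes a: "0 < a" "a \<le> 1" and f: "loc_holder_on a {0..} f"
  shows "hoelder_loc (\<lambda>s. f (max 0 s))"
proof (rule hoelder_locI)
  fix R :: real
  have "\<exists>C. \<forall>x\<in>{0..R}. \<forall>y\<in>{0..R}. \<bar>f x - f y\<bar> \<le> C * dist x y powr a"
    using f unfolding loc_holder_on_def by (auto dest!: spec[of _ "{0..R}"])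
  then obtain C where "\<forall>x\<in>{0..R}. \<forall>y\<in>{0..R}. \<bar>f x - f y\<bar> \<le> C * dist x y powr a" by blast
  then have C: "\<bar>f x - f y\<bar> \<le> C * dist x y powr a" if "0 \<le> x" "x \<le> R" "0 \<le> y" "y \<le> R" for x y using that by simp
  have "norm (f (max 0 x) - f (max 0 y)) \<le> \<bar>C\<bar> * norm (x - y) powr a" if xy: "norm x \<le> R" "norm y \<le> R" for x y
  proof -
    have "\<bar>f (max 0 x) - f (max 0 y)\<bar> \<le> C * dist (max 0 x) (max 0 y) powr a"
      by (rule C) (use xy in auto)
    also have "\<dots> \<le> \<bar>C\<bar> * dist (max 0 x) (max 0 y) powr a" by (intro mult_right_mono) auto
    also have "\<dots> \<le> \<bar>C\<bar> * norm (x - y) powr a"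
      using a by (intro mult_left_mono powr_mono2) (auto simp: dist_real_def)
    finally show ?thesis by simp
  qed
  then show "\<exists>a A. 0 < a \<and> a \<le> 1 \<and> 0 \<le> A \<and> (\<forall>x y. norm x \<le> R \<longrightarrow> norm y \<le> R \<longrightarrow> norm (f (max 0 x) - f (max 0 y)) \<le> A * norm (x - y) powr a)"
    using a by (intro exI[of _ a] exI[of _ "\<bar>C\<bar>"]) auto
qed

section \<open>Existence and nonexistence of large solutions\<close>

definition sphere_max :: "('a::euclidean_space \<Rightarrow> real) \<Rightarrow> real \<Rightarrow> real" where
  "sphere_max p r = Sup (p ` sphere 0 r)"

definition sphere_min :: "('a::euclidean_space \<Rightarrow> real) \<Rightarrow> real \<Rightarrow> real" where
  "sphere_min p r = Inf (p ` sphere 0 r)"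

lemma radG_scale: "radG n (\<lambda>s. c * q s) r = c * radG n q r"
proof -
  have "radG n (\<lambda>s. c * q s) r = integral {0..r} (\<lambda>t. c * radK n q t)" by (simp add: radG_def radK_scale[abs_def])
  then show ?thesis by (simp add: radG_def)
qed

lemma locally_equi_lipschitz:
  fixes u :: "nat \<Rightarrow> 'a::euclidean_space \<Rightarrow> real"
  assumes td: "\<And>n. twice_diff (u n) (g n) (H n)"
    and bd: "\<And>R. \<exists>B. \<forall>n x. norm x \<le> R \<longrightarrow> \<bar>u n x\<bar> \<le> B \<and> \<bar>lin_trace (H n x) + norm (g n x)\<bar> \<le> B"
  shows "\<exists>L\<ge>0. \<forall>n x y. norm x \<le> R \<longrightarrow> norm y \<le> R \<longrightarrow> \<bar>u n x - u n y\<bar> \<le> L * norm (x - y)"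
proof -
  obtain B where B: "\<And>n x. norm x \<le> R + 1 \<Longrightarrow> \<bar>u n x\<bar> \<le> B \<and> \<bar>lin_trace (H n x) + norm (g n x)\<bar> \<le> B"
    using bd[of "R + 1"] by blast
  define L where "L = \<bar>B\<bar> + (8 * \<bar>B\<bar> + 1) * (DIM('a) + 1) + 16 * \<bar>B\<bar> + 1"
  have L0: "0 \<le> L" by (simp add: L_def)
  have gL: "norm (g n x) \<le> L" if x: "norm x \<le> R" for n x
    unfolding L_def
  proof (rule interior_gradient_bound[OF td[of n]])
    fix y assume "norm (y - x) \<le> 1"
    then have "norm y \<le> R + 1" using x norm_triangle_sub[of y x] by linarith
    then show "\<bar>u n y\<bar> \<le> \<bar>B\<bar>" "\<bar>lin_trace (H n y) + norm (g n y)\<bar> \<le> \<bar>B\<bar>"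
      using B[of y n] by auto
  qed
  have "\<bar>u n x - u n y\<bar> \<le> L * norm (x - y)" if xy: "norm x \<le> R" "norm y \<le> R" for n x y
  proof -
    have "norm (u n x - u n y) \<le> L * norm (x - y)"
    proof (rule differentiable_bound[of "cball 0 R"])
      show "(u n has_derivative (\<lambda>h. g n z \<bullet> h)) (at z within cball 0 R)" for z
        using td[of n] by (auto simp: twice_diff_def intro: has_derivative_at_withinI)
      show "onorm (\<lambda>h. g n z \<bullet> h) \<le> L" if "z \<in> cball 0 R" for z
        using gL[of z n] that L0 by (intro onorm_bound) (auto intro!: order_trans[OF Cauchy_Schwarz_ineq2] mult_right_mono)
    qed (use xy in auto)
    then show ?thesis by simp
  qed
  then show ?thesis using L0 by blast
qed

text \<open>The integrability hypothesis enters as a bound M on all partial integrals, and the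
  finite supremum as the linear bound f(s) \<le> \<Lambda> s for s \<ge> 1. The extension of f to
  negative arguments by its value at 0 makes it Hoelder on the whole line.\<close>

locale sublinear_problem =
  fixes p :: "'a::euclidean_space \<Rightarrow> real" and f :: "real \<Rightarrow> real" and \<Lambda> M :: real
  assumes N: "3 \<le> DIM('a)" and ph: "hoelder_loc p" and p0: "\<And>x. 0 \<le> p x"
    and fh: "hoelder_loc (\<lambda>s. f (max 0 s))" and fm: "mono_on {0..} f" and f0: "\<And>s. 0 \<le> s \<Longrightarrow> 0 \<le> f s"
    and fpos: "\<And>s. 0 < s \<Longrightarrow> 0 < f s" and fL: "\<And>s. 1 \<le> s \<Longrightarrow> f s \<le> \<Lambda> * s"
    and moment: "\<And>r. 0 \<le> r \<Longrightarrow> integral {0..r} (\<lambda>s. s * (sphere_max p s - sphere_min p s) *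
        exp (\<Lambda> / (real DIM('a) - 2) * integral {0..s} (\<lambda>t. t * sphere_min p t))) \<le> M"
begin

abbreviation "hi \<equiv> sphere_max p"
abbreviation "lo \<equiv> sphere_min p"

definition "\<mu> = \<Lambda> / (real DIM('a) - 2)"

definition "\<Psi> r = exp (\<mu> * integral {0..r} (\<lambda>t. t * lo t))"

text \<open>Bounds exp (\<Lambda> G[q]) for every q between 0 and \<open>hi\<close>: G[q] is at most
  the moment of lo + (hi - lo) over N - 2, where lo gives \<Psi> and the oscillation, whose moment
  is at most M, gives the constant factor.\<close>

definition "Vb r = \<Psi> r * exp (\<mu> * M)"

text \<open>The last summand bounds G[(hi - lo) f(v)]. Of the 2, one unit is the initial value of v
  and the other is the gap w \<ge> v + 1 reserved for the approximation of f.\<close>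

definition "top_shift = 2 + \<mu> * exp (\<mu> * M) * M"

lemma n1: "1 \<le> DIM('a)" using N by simp

lemma L0: "0 \<le> \<Lambda>" using fL[of 1] f0[of 1] by simp

lemma \<mu>0: "0 \<le> \<mu>" using L0 N by (simp add: \<mu>_def)

lemma pc: "continuous_on UNIV p" by (rule hoelder_loc_continuous[OF ph])

lemma hi_cont: "continuous_on {0..} hi" and lo_cont: "continuous_on {0..} lo"
  unfolding sphere_max_def sphere_min_def by (rule continuous_on_Sup_sphere[OF pc], rule continuous_on_Inf_sphere[OF pc])

lemma p_le_hi: "p x \<le> hi (norm x)" and lo_le_p: "lo (norm x) \<le> p x" and lo_le_hi: "0 \<le> r \<Longrightarrow> lo r \<le> hi r"
  unfolding sphere_max_def sphere_min_def using sphere_extremes[OF pc] by auto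

lemma lo_nonneg: assumes "0 \<le> r" shows "0 \<le> lo r"
  unfolding sphere_min_def using assms p0 by (intro cInf_greatest) auto

lemma hi_nonneg: "0 \<le> r \<Longrightarrow> 0 \<le> hi r"
  using lo_nonneg lo_le_hi order_trans by blast

lemma f_cont: "continuous_on {0..} f"
  by (rule continuous_on_eq[OF hoelder_loc_continuous[OF fh]]) simp

lemma lo_moment_mono: "0 \<le> r \<Longrightarrow> r \<le> r' \<Longrightarrow> integral {0..r} (\<lambda>t. t * lo t) \<le> integral {0..r'} (\<lambda>t. t * lo t)"
  by (intro integral_subset_le integrable_continuous_real continuous_intros q_cont_Icc[OF n1 lo_cont])
     (auto simp: lo_nonneg)

lemma \<Psi>_ge_1: "0 \<le> r \<Longrightarrow> 1 \<le> \<Psi> r"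
  using lo_moment_mono[of 0 r] \<mu>0 by (simp add: \<Psi>_def)

lemma \<Psi>_cont: "continuous_on {0..r} \<Psi>"
  unfolding \<Psi>_def
  by (intro continuous_intros indefinite_integral_continuous_1 integrable_continuous_real q_cont_Icc[OF n1 lo_cont])

lemma Vb_mono: "0 \<le> r \<Longrightarrow> r \<le> r' \<Longrightarrow> Vb r \<le> Vb r'"
  unfolding Vb_def \<Psi>_def using lo_moment_mono \<mu>0 by (intro mult_right_mono) (auto intro: mult_left_mono)

lemma moment': "0 \<le> r \<Longrightarrow> integral {0..r} (\<lambda>s. s * (hi s - lo s) * \<Psi> s) \<le> M"
  using moment by (simp add: \<Psi>_def \<mu>_def)

lemma weighted_osc_integrable: "(\<lambda>s. s * (hi s - lo s) * \<Psi> s) integrable_on {0..r}"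
  by (intro integrable_continuous_real continuous_intros q_cont_Icc[OF n1 hi_cont] q_cont_Icc[OF n1 lo_cont] \<Psi>_cont)

lemma osc_moment: assumes r: "0 \<le> r" shows "integral {0..r} (\<lambda>s. s * (hi s - lo s)) \<le> M"
proof -
  have "integral {0..r} (\<lambda>s. s * (hi s - lo s)) \<le> integral {0..r} (\<lambda>s. s * (hi s - lo s) * \<Psi> s)"
  proof (intro integral_le weighted_osc_integrable integrable_continuous_real continuous_intros q_cont_Icc[OF n1 hi_cont] q_cont_Icc[OF n1 lo_cont])
    fix s assume s: "s \<in> {0..r}"
    then have "s * (hi s - lo s) * 1 \<le> s * (hi s - lo s) * \<Psi> s"
      using \<Psi>_ge_1[of s] lo_le_hi[of s] by (intro mult_left_mono) auto
    then show "s * (hi s - lo s) \<le> s * (hi s - lo s) * \<Psi> s" by simp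
  qed
  then show ?thesis using moment'[OF r] by linarith
qed

lemma M0: "0 \<le> M" using osc_moment[of 0] by simp

lemma exp_radG_le_Vb:
  assumes q: "continuous_on {0..} q" "\<And>s. 0 \<le> s \<Longrightarrow> 0 \<le> q s" "\<And>s. 0 \<le> s \<Longrightarrow> q s \<le> hi s" and r: "0 \<le> r"
  shows "exp (\<Lambda> * radG DIM('a) q r) \<le> Vb r"
proof -
  have i: "(\<lambda>s. s * lo s) integrable_on {0..r}" "(\<lambda>s. s * (hi s - lo s)) integrable_on {0..r}" "(\<lambda>s. s * q s) integrable_on {0..r}"
    by (intro integrable_continuous_real continuous_intros q_cont_Icc[OF n1 lo_cont] q_cont_Icc[OF n1 hi_cont] q_cont_Icc[OF n1 lo_cont] q_cont_Icc[OF n1 q(1)])+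
  have "radG DIM('a) q r \<le> integral {0..r} (\<lambda>s. s * q s) / (real DIM('a) - 2)"
    by (rule radG_le_moment[OF N q(1,2) r])
  also have "integral {0..r} (\<lambda>s. s * q s) \<le> integral {0..r} (\<lambda>s. s * lo s + s * (hi s - lo s))"
    by (intro integral_le i integrable_add) (use q(3) in \<open>auto simp: algebra_simps intro!: mult_left_mono\<close>)
  also have "\<dots> = integral {0..r} (\<lambda>s. s * lo s) + integral {0..r} (\<lambda>s. s * (hi s - lo s))"
    by (rule integral_add[OF i(1,2)])
  also have "\<dots> \<le> integral {0..r} (\<lambda>s. s * lo s) + M" using osc_moment[OF r] by simp
  finally have "radG DIM('a) q r \<le> (integral {0..r} (\<lambda>s. s * lo s) + M) / (real DIM('a) - 2)"
    using N by (simp add: divide_right_mono)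
  from mult_left_mono[OF this L0] have "\<Lambda> * radG DIM('a) q r \<le> \<mu> * integral {0..r} (\<lambda>s. s * lo s) + \<mu> * M"
    by (simp add: \<mu>_def algebra_simps add_divide_distrib)
  then have "exp (\<Lambda> * radG DIM('a) q r) \<le> exp (\<mu> * integral {0..r} (\<lambda>s. s * lo s) + \<mu> * M)" by simp
  then show ?thesis by (simp add: Vb_def \<Psi>_def exp_add)
qed

text \<open>Since f(v) \<le> \<Lambda> v \<le> \<Lambda> Vb, the integrand left by the moment
  estimate is a constant times s h(s) \<Psi>(s): this is the use of the weighted integrability
  assumption.\<close>

lemma radG_osc_le:
  assumes q: "continuous_on {0..} q" "\<And>s. 0 \<le> s \<Longrightarrow> 0 \<le> q s" "\<And>s. 0 \<le> s \<Longrightarrow> q s \<le> hi s - lo s" and r: "0 \<le> r"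
    and v: "continuous_on {0..} v" "\<And>s. 0 \<le> s \<Longrightarrow> 1 \<le> v s" "\<And>s. 0 \<le> s \<Longrightarrow> v s \<le> Vb s"
  shows "radG DIM('a) (\<lambda>s. q s * f (v s)) r \<le> \<mu> * exp (\<mu> * M) * M"
proof -
  have v0: "0 \<le> v s" if "0 \<le> s" for s using v(2)[OF that] by linarith
  have c: "continuous_on {0..} (\<lambda>s. q s * f (v s))"
    by (intro continuous_intros q(1) continuous_on_compose2[OF f_cont v(1)]) (use v0 in auto)
  have nn: "0 \<le> q s * f (v s)" if "0 \<le> s" for s using q(2) f0 v0 that by simp
  have "radG DIM('a) (\<lambda>s. q s * f (v s)) r \<le> integral {0..r} (\<lambda>s. s * (q s * f (v s))) / (real DIM('a) - 2)"
    by (rule radG_le_moment[OF N c nn r])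
  also have "integral {0..r} (\<lambda>s. s * (q s * f (v s))) \<le> integral {0..r} (\<lambda>s. (\<Lambda> * exp (\<mu> * M)) * (s * (hi s - lo s) * \<Psi> s))"
  proof (intro integral_le integrable_on_mult_right weighted_osc_integrable)
    show "(\<lambda>s. s * (q s * f (v s))) integrable_on {0..r}"
      by (intro integrable_continuous_real continuous_on_mult continuous_on_id q_cont_Icc[OF n1 c])
    fix s assume "s \<in> {0..r}"
    then have s: "0 \<le> s" by simp
    have "f (v s) \<le> \<Lambda> * v s" by (rule fL[OF v(2)[OF s]])
    also have "\<dots> \<le> \<Lambda> * Vb s" by (intro mult_left_mono v(3)[OF s] L0)
    finally have "q s * f (v s) \<le> (hi s - lo s) * (\<Lambda> * Vb s)"
      using q(2,3)[OF s] f0[OF v0[OF s]] by (intro mult_mono) auto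
    then have "s * (q s * f (v s)) \<le> s * ((hi s - lo s) * (\<Lambda> * Vb s))" using s by (intro mult_left_mono)
    then show "s * (q s * f (v s)) \<le> (\<Lambda> * exp (\<mu> * M)) * (s * (hi s - lo s) * \<Psi> s)" by (simp add: Vb_def ac_simps)
  qed
  also have "\<dots> = (\<Lambda> * exp (\<mu> * M)) * integral {0..r} (\<lambda>s. s * (hi s - lo s) * \<Psi> s)" by (rule integral_mult_right)
  also have "\<dots> \<le> (\<Lambda> * exp (\<mu> * M)) * M" using moment'[OF r] L0 by (intro mult_left_mono) auto
  finally show ?thesis using N by (simp add: \<mu>_def divide_right_mono ac_simps)
qed

text \<open>The cutoff of p makes the barriers v and w bounded, and the approximation F of f is
  Lipschitz. As F \<le> f, v stays a subsolution; as F lags behind f by at most 1/k in the argument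
  and w \<ge> v + 1, w stays a supersolution. The bounds in the conclusion do not involve k, apart
  from the range of the lower one.\<close>

lemma truncated_problem:
  assumes k: "1 \<le> (k::real)"
  obtains u g H F where "C2 u g H"
    "\<And>x. lin_trace (H x) + norm (g x) = max 0 (min 1 (k + 1 - norm x)) * p x * F (u x)" "hoelder_loc F"
    "\<And>x. f (u x - 1 / k) \<le> F (u x)" "\<And>x. F (u x) \<le> f (u x)" "\<And>x. 1 \<le> u x"
    "\<And>x. norm x \<le> k \<Longrightarrow> 1 + f 1 * radG DIM('a) lo (norm x) \<le> u x" "\<And>x. u x \<le> top_shift + Vb (norm x)"
proof -
  let ?N = "DIM('a)"
  define \<theta> where "\<theta> r = max 0 (min 1 (k + 1 - r))" for r :: real
  have \<theta>: "0 \<le> \<theta> r" "\<theta> r \<le> 1" for r by (auto simp: \<theta>_def)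
  have \<theta>1: "\<theta> r = 1" if "r \<le> k" for r using that by (simp add: \<theta>_def)
  have \<theta>0: "\<theta> r = 0" if "k + 1 \<le> r" for r using that by (simp add: \<theta>_def)
  have \<theta>c: "continuous_on S \<theta>" for S unfolding \<theta>_def by (intro continuous_intros)
  define qh where "qh r = \<theta> r * hi r" for r
  define ql where "ql r = \<theta> r * lo r" for r
  define qd where "qd r = \<theta> r * (hi r - lo r)" for r
  have qc: "continuous_on {0..} qh" "continuous_on {0..} ql" "continuous_on {0..} qd"
    unfolding qh_def ql_def qd_def by (intro continuous_intros \<theta>c hi_cont lo_cont)+
  have q0: "0 \<le> qh s" "0 \<le> ql s" "0 \<le> qd s" if "0 \<le> s" for s
    using \<theta>(1)[of s] hi_nonneg[OF that] lo_nonneg[OF that] lo_le_hi[OF that] by (auto simp: qh_def ql_def qd_def)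
  have qhi: "qh s \<le> hi s" if "0 \<le> s" for s
    using mult_right_mono[OF \<theta>(2)[of s] hi_nonneg[OF that]] by (simp add: qh_def)
  have qdi: "qd s \<le> hi s - lo s" if "0 \<le> s" for s
    using mult_right_mono[OF \<theta>(2)[of s], of "hi s - lo s"] lo_le_hi[OF that] by (simp add: qd_def)
  obtain v where v: "continuous_on {0..} v" "\<And>r. 0 \<le> r \<Longrightarrow> v r = 1 + radG ?N (\<lambda>s. qh s * f (v s)) r"
    "\<And>r. 0 \<le> r \<Longrightarrow> 1 \<le> v r" "\<And>r. 0 \<le> r \<Longrightarrow> v r \<le> 1 * exp (\<Lambda> * radG ?N qh r)"
    by (rule volterra_solution[OF n1 qc(1) q0(1) f_cont fm f0 fL order_refl]) blast+
  have vV: "v r \<le> Vb r" if "0 \<le> r" for r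
    using v(4)[OF that] exp_radG_le_Vb[OF qc(1) q0(1) qhi that] by simp
  have v0: "0 \<le> v s" if "0 \<le> s" for s using v(3)[OF that] by linarith
  have fvc: "continuous_on {0..} (\<lambda>s. f (v s))" by (rule continuous_on_compose2[OF f_cont v(1)]) (use v0 in auto)
  define S1 where "S1 s = qh s * f (v s)" for s
  define S2 where "S2 s = ql s * f (v s)" for s
  define S3 where "S3 s = qd s * f (v s)" for s
  have Sc: "continuous_on {0..} S1" "continuous_on {0..} S2" "continuous_on {0..} S3"
    unfolding S1_def S2_def S3_def by (intro continuous_intros qc fvc)+
  have S0: "0 \<le> S1 s" "0 \<le> S2 s" "0 \<le> S3 s" if "0 \<le> s" for s
    using q0[OF that] f0[OF v0[OF that]] by (auto simp: S1_def S2_def S3_def)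
  have vS: "v r = 1 + radG ?N S1 r" if "0 \<le> r" for r using v(2)[OF that] by (simp add: S1_def[abs_def])
  have Ssum: "radG ?N S1 r = radG ?N S2 r + radG ?N S3 r" for r
  proof -
    have "S1 = (\<lambda>s. S2 s + S3 s)" by (auto simp: S1_def S2_def S3_def qh_def ql_def qd_def algebra_simps)
    then show ?thesis using radG_add[OF n1 Sc(2,3)] by simp
  qed
  define w where "w r = top_shift + radG ?N S2 r" for r
  have S3b: "radG ?N S3 r \<le> \<mu> * exp (\<mu> * M) * M" if "0 \<le> r" for r
    unfolding S3_def by (rule radG_osc_le[OF qc(3) q0(3) qdi that v(1,3) vV])
  have wv: "v r + 1 \<le> w r" if "0 \<le> r" for r
    using S3b[OF that] vS[OF that] Ssum[of r] by (simp add: w_def top_shift_def)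
  have wle: "w r \<le> top_shift + v r" if "0 \<le> r" for r
    using vS[OF that] Ssum[of r] radG_nonneg[OF n1 Sc(3) S0(3) that] by (simp add: w_def)
  \<comment> \<open>The cut-off source vanishes beyond k + 1, so its moment, and with it v and w, is
    bounded on the whole half-line.\<close>
  define Cq where "Cq = integral {0..k + 1} (\<lambda>s. s * qh s) / (real ?N - 2)"
  have sc: "continuous_on {0..r} (\<lambda>s. s * qh s)" for r by (intro continuous_intros q_cont_Icc[OF n1 qc(1)])
  have Gq: "radG ?N qh r \<le> Cq" if r: "0 \<le> r" for r
  proof -
    have "integral {0..r} (\<lambda>s. s * qh s) \<le> integral {0..k + 1} (\<lambda>s. s * qh s)"
    proof (cases "r \<le> k + 1")
      case True
      then show ?thesis using q0(1) by (intro integral_subset_le integrable_continuous_real sc) auto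
    next
      case False
      have "integral {0..k + 1} (\<lambda>s. s * qh s) + integral {k + 1..r} (\<lambda>s. s * qh s) = integral {0..r} (\<lambda>s. s * qh s)"
        by (rule Henstock_Kurzweil_Integration.integral_combine) (use False k integrable_continuous_real[OF sc] in auto)
      moreover have "integral {k + 1..r} (\<lambda>s. s * qh s) = integral {k + 1..r} (\<lambda>s. 0)"
        by (rule integral_cong) (simp add: qh_def \<theta>0)
      ultimately show ?thesis by simp
    qed
    then have "integral {0..r} (\<lambda>s. s * qh s) / (real ?N - 2) \<le> Cq"
      unfolding Cq_def by (rule divide_right_mono) (use N in simp)
    then show ?thesis using radG_le_moment[OF N qc(1) q0(1) r] by linarith
  qed
  define MX where "MX = top_shift + exp (\<Lambda> * Cq)"
  have shift: "2 \<le> top_shift" using \<mu>0 M0 by (simp add: top_shift_def)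
  have MX: "1 \<le> MX" using shift exp_gt_zero[of "\<Lambda> * Cq"] unfolding MX_def by linarith
  have vexp: "v r \<le> exp (\<Lambda> * Cq)" if "0 \<le> r" for r
    using v(4)[OF that] mult_left_mono[OF Gq[OF that] L0] by (auto intro: order_trans)
  have vM: "v r \<le> MX" if "0 \<le> r" for r using vexp[OF that] shift by (simp add: MX_def)
  have wM: "w r \<le> MX" if "0 \<le> r" for r using wle[OF that] vexp[OF that] by (simp add: MX_def)
  \<comment> \<open>Freezing f outside [0, MX] makes it bounded, so that its moving averages are
    globally Lipschitz. The values of v, w, u and u - 1/k stay inside this interval, where nothing
    changes.\<close>
  define gg where "gg s = f (max 0 (min MX s))" for s
  have ggf: "gg s = f s" if "0 \<le> s" "s \<le> MX" for s using that by (simp add: gg_def)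
  have ggm: "mono gg"
    unfolding gg_def by (intro monoI mono_onD[OF fm]) auto
  have ggc: "continuous_on UNIV gg"
    unfolding gg_def
    by (rule continuous_on_compose2[OF f_cont]) (auto intro!: continuous_intros)
  obtain F K where F: "mono F" "\<And>s t. \<bar>F s - F t\<bar> \<le> K * \<bar>s - t\<bar>" "\<And>s. 0 \<le> s \<Longrightarrow> gg (s - 1 / k) \<le> F s" "\<And>s. 0 \<le> s \<Longrightarrow> F s \<le> gg s"
  proof (rule mono_lipschitz_approx[OF ggc ggm _ _ k])
    show "0 \<le> gg s" for s unfolding gg_def by (rule f0) simp
    show "gg s \<le> f MX" for s unfolding gg_def by (rule mono_onD[OF fm]) (use MX in auto)
  qed blast
  have k1: "0 < 1 / k" "1 / k \<le> 1" using k by auto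
  define P where "P x = \<theta> (norm x) * p x" for x
  have Ph: "hoelder_loc P"
    unfolding P_def \<theta>_def by (intro hoelder_loc_mult hoelder_loc_radial_cutoff ph)
  have P0: "0 \<le> P x" for x using \<theta>(1)[of "norm x"] p0[of x] by (simp add: P_def)
  obtain PM where PM: "0 \<le> PM" "\<And>x. norm x \<le> k + 1 \<Longrightarrow> norm (P x) \<le> PM"
    by (rule continuous_bounded_on_ball[OF hoelder_loc_continuous[OF Ph], of "k + 1"]) blast
  have Pb: "P x \<le> PM" for x
    using PM(2)[of x] PM(1) \<theta>0[of "norm x"] by (cases "norm x \<le> k + 1") (auto simp: P_def)
  obtain Hv where Hv: "twice_diff (\<lambda>x::'a. 1 + radG ?N S1 (norm x)) (\<lambda>x. radk ?N S1 (norm x) *\<^sub>R x) Hv"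
    "\<And>x. lin_trace (Hv x) + norm (radk ?N S1 (norm x) *\<^sub>R x) = S1 (norm x)"
    by (rule radial_twice_diff[OF Sc(1) S0(1)]) blast+
  obtain Hw where Hw: "twice_diff (\<lambda>x::'a. top_shift + radG ?N S2 (norm x)) (\<lambda>x. radk ?N S2 (norm x) *\<^sub>R x) Hw"
    "\<And>x. lin_trace (Hw x) + norm (radk ?N S2 (norm x) *\<^sub>R x) = S2 (norm x)"
    by (rule radial_twice_diff[OF Sc(2) S0(2)]) blast+
  have ev: "(\<lambda>x::'a. 1 + radG ?N S1 (norm x)) = (\<lambda>x. v (norm x))" by (simp add: vS fun_eq_iff)
  have ew: "(\<lambda>x::'a. top_shift + radG ?N S2 (norm x)) = (\<lambda>x. w (norm x))" by (simp add: w_def fun_eq_iff)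
  have tv: "twice_diff (\<lambda>x::'a. v (norm x)) (\<lambda>x. radk ?N S1 (norm x) *\<^sub>R x) Hv" using Hv(1) unfolding ev .
  have tw: "twice_diff (\<lambda>x::'a. w (norm x)) (\<lambda>x. radk ?N S2 (norm x) *\<^sub>R x) Hw" using Hw(1) unfolding ew .
  have wh: "hoelder_loc (\<lambda>x::'a. w (norm x))"
  proof (rule hoelder_loc_C1)
    show "((\<lambda>x. w (norm x)) has_derivative (\<lambda>h. (radk ?N S2 (norm x) *\<^sub>R x) \<bullet> h)) (at x)" for x :: 'a
      using tw unfolding twice_diff_def by blast
    show "continuous_on UNIV (\<lambda>x::'a. (radk ?N S2 (norm x) *\<^sub>R x) \<bullet> h)" for h
      by (rule continuous_on_inner[OF twice_diff_continuous(2)[OF tw] continuous_on_const])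
  qed
  have w1: "2 \<le> w r" if "0 \<le> r" for r using wv[OF that] v(3)[OF that] by linarith
  obtain u g H where u: "C2 u g H" "\<And>x. lin_trace (H x) + norm (g x) = P x * F (u x)" "\<And>x. v (norm x) \<le> u x" "\<And>x. u x \<le> w (norm x)"
  proof (rule exists_between_sub_super[OF Ph P0 Pb F(1,2) tv tw, of MX])
    fix x :: 'a
    have r: "0 \<le> norm x" by simp
    show "\<bar>v (norm x)\<bar> \<le> MX" using vM[OF r] v(3)[OF r] by simp
    show "\<bar>w (norm x)\<bar> \<le> MX" using wM[OF r] w1[OF r] by simp
    show "v (norm x) \<le> w (norm x)" using wv[OF r] by simp
    show "P x * F (v (norm x)) \<le> lin_trace (Hv x) + norm (radk ?N S1 (norm x) *\<^sub>R x)"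
    proof -
      have "F (v (norm x)) \<le> f (v (norm x))" using F(4)[OF v0[OF r]] ggf[OF v0[OF r] vM[OF r]] by simp
      then have "P x * F (v (norm x)) \<le> P x * f (v (norm x))" using P0 by (intro mult_left_mono)
      also have "\<dots> \<le> qh (norm x) * f (v (norm x))"
        unfolding P_def qh_def by (intro mult_right_mono mult_left_mono p_le_hi \<theta> f0[OF v0[OF r]])
      finally show ?thesis using Hv(2)[of x] by (simp add: S1_def)
    qed
    \<comment> \<open>Here the gap is spent: w - 1/k \<ge> v, hence F(w) \<ge> f(v), although F
      averages f from below.\<close>
    show "lin_trace (Hw x) + norm (radk ?N S2 (norm x) *\<^sub>R x) \<le> P x * F (w (norm x))"
    proof -
      have "f (v (norm x)) = gg (v (norm x))" using ggf[OF v0[OF r] vM[OF r]] by simp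
      also have "\<dots> \<le> gg (w (norm x) - 1 / k)" using wv[OF r] k1 by (intro monoD[OF ggm]) linarith
      also have "\<dots> \<le> F (w (norm x))" using w1[OF r] by (intro F(3)) simp
      finally have "P x * f (v (norm x)) \<le> P x * F (w (norm x))" using P0 by (intro mult_left_mono)
      moreover have "ql (norm x) * f (v (norm x)) \<le> P x * f (v (norm x))"
        unfolding P_def ql_def by (intro mult_right_mono mult_left_mono lo_le_p \<theta> f0[OF v0[OF r]])
      ultimately show ?thesis using Hw(2)[of x] by (simp add: S2_def)
    qed
  qed (use wh in blast)+
  have u1: "1 \<le> u x" for x using u(3)[of x] v(3)[of "norm x"] by simp
  have uM: "u x \<le> MX" for x using u(4)[of x] wM[of "norm x"] by simp
  show ?thesis
  proof (rule that[OF u(1)])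
    show "lin_trace (H x) + norm (g x) = max 0 (min 1 (k + 1 - norm x)) * p x * F (u x)" for x
      using u(2)[of x] by (simp add: P_def \<theta>_def)
    show "hoelder_loc F"
    proof (rule hoelder_locI_lipschitz, intro exI[of _ "\<bar>K\<bar>"] conjI allI impI)
      fix s t :: real
      have "K * \<bar>s - t\<bar> \<le> \<bar>K\<bar> * \<bar>s - t\<bar>" by (intro mult_right_mono) auto
      then show "norm (F s - F t) \<le> \<bar>K\<bar> * norm (s - t)" using F(2)[of s t] by simp
    qed simp
    fix x
    have b: "0 \<le> u x - 1 / k" "u x - 1 / k \<le> MX" "0 \<le> u x" using u1[of x] uM[of x] k1 by linarith+
    show "f (u x - 1 / k) \<le> F (u x)" using F(3)[OF b(3)] ggf[OF b(1,2)] by simp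
    show "F (u x) \<le> f (u x)" using F(4)[OF b(3)] ggf[OF b(3) uM] by simp
    show "1 \<le> u x" by (rule u1)
    show "u x \<le> top_shift + Vb (norm x)" using u(4)[of x] wle[of "norm x"] vV[of "norm x"] by simp
    show "1 + f 1 * radG ?N lo (norm x) \<le> u x" if x: "norm x \<le> k"
    proof -
      \<comment> \<open>Up to radius k the cutoff equals 1, and v \<ge> 1 gives hi f(v) \<ge> f(1)
        lo. This lower bound does not depend on k and is what makes the limit large when G[lo] is
        unbounded.\<close>
      have "radG ?N (\<lambda>s. f 1 * lo s) (norm x) \<le> radG ?N S1 (norm x)"
      proof (rule radG_mono[OF n1 _ Sc(1)])
        show "continuous_on {0..} (\<lambda>s. f 1 * lo s)" by (intro continuous_intros lo_cont)
        fix s assume s: "0 \<le> s" "s \<le> norm x"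
        have "f 1 \<le> f (v s)" using v(3)[OF s(1)] by (intro mono_onD[OF fm]) auto
        then have "lo s * f 1 \<le> hi s * f (v s)"
          using lo_le_hi[OF s(1)] hi_nonneg[OF s(1)] f0[of 1] by (intro mult_mono) auto
        then show "f 1 * lo s \<le> S1 s" using \<theta>1[of s] s x by (simp add: S1_def qh_def mult.commute)
      qed
      then show ?thesis using u(3)[of x] vS[of "norm x"] by (simp add: radG_scale)
    qed
  qed
qed

text \<open>Compactness in k: the upper bound by Vb and the interior gradient bound make the
  truncated solutions locally bounded and equi-Lipschitz, a subsequence converges pointwise, and the
  stability theorem identifies the limit. Both lower bounds survive pointwise limits.\<close>

theorem solution_exists:
  obtains u g H where "C2 u g H" "\<And>x. lin_trace (H x) + norm (g x) = p x * f (u x)"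
    "\<And>x. 1 \<le> u x" "\<And>x. 1 + f 1 * radG DIM('a) lo (norm x) \<le> u x"
proof -
  \<comment> \<open>The index \<open>Suc n\<close> ensures k \<ge> 1, as the truncated problem
    requires.\<close>
  define \<theta> where "\<theta> n x = max 0 (min 1 (real (Suc n) + 1 - norm x))" for n and x :: 'a
  have "\<exists>u g H F. C2 u g H \<and> (\<forall>x. lin_trace (H x) + norm (g x) = \<theta> n x * p x * F (u x)) \<and> hoelder_loc F \<and>
     (\<forall>x. f (u x - 1 / real (Suc n)) \<le> F (u x) \<and> F (u x) \<le> f (u x) \<and> 1 \<le> u x \<and> u x \<le> top_shift + Vb (norm x)) \<and>
     (\<forall>x. norm x \<le> real (Suc n) \<longrightarrow> 1 + f 1 * radG DIM('a) lo (norm x) \<le> u x)" for n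
    by (rule truncated_problem[of "real (Suc n)"]) (unfold \<theta>_def, simp, blast)
  then obtain u g H F where u: "\<And>n. C2 (u n) (g n) (H n)" "\<And>n x. lin_trace (H n x) + norm (g n x) = \<theta> n x * p x * F n (u n x)"
    "\<And>n. hoelder_loc (F n)" "\<And>n x. f (u n x - 1 / real (Suc n)) \<le> F n (u n x)" "\<And>n x. F n (u n x) \<le> f (u n x)"
    "\<And>n x. 1 \<le> u n x" "\<And>n x. u n x \<le> top_shift + Vb (norm x)"
    "\<And>n x. norm x \<le> real (Suc n) \<Longrightarrow> 1 + f 1 * radG DIM('a) lo (norm x) \<le> u n x"
    by metis
  have td: "twice_diff (u n) (g n) (H n)" for n using u(1)[of n] by (simp add: C2_def)
  define q where "q n x = \<theta> n x * p x * F n (u n x)" for n x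
  have \<theta>: "0 \<le> \<theta> n x" "\<theta> n x \<le> 1" for n x by (auto simp: \<theta>_def)
  have F0: "0 \<le> F n (u n x)" for n x
  proof -
    have "1 / real (Suc n) \<le> 1" by simp
    then have "0 \<le> f (u n x - 1 / real (Suc n))" using u(6)[of n x] by (intro f0) linarith
    then show ?thesis using u(4)[of n x] by linarith
  qed
  have bd: "\<exists>B. \<forall>n x. norm x \<le> R \<longrightarrow> \<bar>u n x\<bar> \<le> B \<and> \<bar>q n x\<bar> \<le> B" for R
  proof -
    obtain PB where PB: "0 \<le> PB" "\<And>x. norm x \<le> R \<Longrightarrow> norm (p x) \<le> PB"
      by (rule continuous_bounded_on_ball[OF pc, of R]) blast
    define T where "T = top_shift + Vb R"
    have "\<bar>u n x\<bar> \<le> \<bar>T\<bar> + PB * f \<bar>T\<bar> \<and> \<bar>q n x\<bar> \<le> \<bar>T\<bar> + PB * f \<bar>T\<bar>" if x: "norm x \<le> R" for n x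
    proof -
      have uT: "u n x \<le> T" using u(7)[of n x] Vb_mono[OF norm_ge_zero x] by (simp add: T_def)
      have "F n (u n x) \<le> f (u n x)" by (rule u(5))
      also have "\<dots> \<le> f \<bar>T\<bar>" using uT u(6)[of n x] by (intro mono_onD[OF fm]) auto
      finally have FT: "F n (u n x) \<le> f \<bar>T\<bar>" .
      have "\<theta> n x * p x \<le> 1 * PB" using \<theta>[of n x] PB(2)[OF x] p0[of x] by (intro mult_mono) auto
      then have "q n x \<le> PB * f \<bar>T\<bar>" unfolding q_def using FT F0 PB(1) by (intro mult_mono) auto
      moreover have "0 \<le> q n x" unfolding q_def using \<theta>(1) p0 F0 by simp
      moreover have "0 \<le> PB * f \<bar>T\<bar>" using PB(1) f0[of "\<bar>T\<bar>"] by simp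
      ultimately show ?thesis using uT u(6)[of n x] by linarith
    qed
    then show ?thesis by blast
  qed
  have bd': "\<exists>B. \<forall>n x. norm x \<le> R \<longrightarrow> \<bar>u n x\<bar> \<le> B \<and> \<bar>lin_trace (H n x) + norm (g n x)\<bar> \<le> B" for R
    using bd[of R] by (simp add: u(2) q_def)
  note lip = locally_equi_lipschitz[OF td bd']
  obtain k v where k: "strict_mono (k :: nat \<Rightarrow> nat)" and v: "\<And>x. (\<lambda>n. u (k n) x) \<longlonglongrightarrow> v x"
  proof (rule convergent_subsequence_locally_lipschitz[of u])
    show "\<exists>B. \<forall>n. \<bar>u n x\<bar> \<le> B" for x using bd[of "norm x"] by blast
  qed (use lip in blast)+
  have v1: "1 \<le> v x" for x by (rule LIMSEQ_le_const[OF v]) (use u(6) in auto)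
  have vh: "hoelder_loc v"
  proof (rule hoelder_locI_lipschitz)
    fix R :: real
    obtain L where L: "0 \<le> L" "\<And>n x y. norm x \<le> R \<Longrightarrow> norm y \<le> R \<Longrightarrow> \<bar>u n x - u n y\<bar> \<le> L * norm (x - y)"
      using lip[of R] by blast
    have "norm (v x - v y) \<le> L * norm (x - y)" if "norm x \<le> R" "norm y \<le> R" for x y
      by (rule LIMSEQ_le_const2[OF tendsto_norm[OF tendsto_diff[OF v v]]]) (use L(2)[OF that] in auto)
    then show "\<exists>A\<ge>0. \<forall>x y. norm x \<le> R \<longrightarrow> norm y \<le> R \<longrightarrow> norm (v x - v y) \<le> A * norm (x - y)" using L(1) by blast
  qed
  \<comment> \<open>The approximate nonlinearity at u lies between f(u - 1/Suc (k n)) and f(u), so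
    continuity of f alone gives the limit; the functions F n need not converge as such.\<close>
  have qlim: "(\<lambda>n. q (k n) x) \<longlonglongrightarrow> p x * f (max 0 (v x))" for x
  proof -
    have ic: "isCont (\<lambda>s. f (max 0 s)) s" for s
      using hoelder_loc_continuous[OF fh, of UNIV] by (simp add: continuous_on_eq_continuous_at)
    have inv: "(\<lambda>n. 1 / real (Suc (k n))) \<longlonglongrightarrow> 0"
      using LIMSEQ_subseq_LIMSEQ[OF LIMSEQ_inverse_real_of_nat k] by (simp add: o_def inverse_eq_divide)
    have l1: "(\<lambda>n. f (max 0 (u (k n) x - 1 / real (Suc (k n))))) \<longlonglongrightarrow> f (max 0 (v x - 0))"
      by (intro isCont_tendsto_compose[OF ic] tendsto_diff v inv)
    have l2: "(\<lambda>n. f (max 0 (u (k n) x))) \<longlonglongrightarrow> f (max 0 (v x))" by (intro isCont_tendsto_compose[OF ic] v)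
    have "(\<lambda>n. F (k n) (u (k n) x)) \<longlonglongrightarrow> f (max 0 (v x))"
    proof (rule tendsto_sandwich[OF _ _ l1[simplified] l2])
      show "\<forall>\<^sub>F n in sequentially. f (max 0 (u (k n) x - 1 / (1 + real (k n)))) \<le> F (k n) (u (k n) x)"
      proof (rule always_eventually, rule allI)
        fix n
        have "1 / (1 + real (k n)) \<le> 1" by simp
        then have "max 0 (u (k n) x - 1 / (1 + real (k n))) = u (k n) x - 1 / (1 + real (k n))"
          using u(6)[of "k n" x] by (intro max_absorb2) linarith
        then show "f (max 0 (u (k n) x - 1 / (1 + real (k n)))) \<le> F (k n) (u (k n) x)" using u(4)[of "k n" x] by simp
      qed
      show "\<forall>\<^sub>F n in sequentially. F (k n) (u (k n) x) \<le> f (max 0 (u (k n) x))"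
      proof (rule always_eventually, rule allI)
        fix n
        have "max 0 (u (k n) x) = u (k n) x" using u(6)[of "k n" x] by simp
        then show "F (k n) (u (k n) x) \<le> f (max 0 (u (k n) x))" using u(5)[of "k n" x] by simp
      qed
    qed
    moreover have "(\<lambda>n. \<theta> (k n) x) \<longlonglongrightarrow> 1"
    proof (rule tendsto_eventually)
      obtain m :: nat where m: "norm x \<le> real m" using real_arch_simple by blast
      show "\<forall>\<^sub>F n in sequentially. \<theta> (k n) x = 1"
        unfolding eventually_sequentially
      proof (intro exI[of _ m] allI impI)
        fix n assume "m \<le> n"
        then have "m \<le> k n" using seq_suble[OF k, of n] by linarith
        then have "norm x \<le> real (k n)" using m by linarith
        then show "\<theta> (k n) x = 1" by (simp add: \<theta>_def)
      qed
    qed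
    ultimately have "(\<lambda>n. \<theta> (k n) x * p x * F (k n) (u (k n) x)) \<longlonglongrightarrow> 1 * p x * f (max 0 (v x))"
      by (intro tendsto_mult tendsto_const)
    then show ?thesis by (simp add: q_def)
  qed
  obtain g0 H0 where sol: "C2 v g0 H0" "\<And>x. lin_trace (H0 x) + norm (g0 x) = p x * f (max 0 (v x))"
  proof (rule stability[of "\<lambda>n. u (k n)" "\<lambda>n. g (k n)" "\<lambda>n. H (k n)" "\<lambda>n. q (k n)" "\<lambda>x. p x * f (max 0 (v x))" v])
    show "\<exists>B. \<forall>n x. norm x \<le> R \<longrightarrow> \<bar>u (k n) x\<bar> \<le> B \<and> \<bar>q (k n) x\<bar> \<le> B" for R using bd[of R] by blast
    show "hoelder_loc (q (k n))" for n
      unfolding q_def[abs_def] \<theta>_def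
      by (intro hoelder_loc_mult hoelder_loc_radial_cutoff ph hoelder_loc_compose[OF u(3)] C2_hoelder(1)[OF u(1)])
    show "hoelder_loc (\<lambda>x. p x * f (max 0 (v x)))" by (intro hoelder_loc_mult ph hoelder_loc_compose[OF fh] vh)
  qed (use u(1,2) v qlim in \<open>auto simp: q_def\<close>)
  show ?thesis
  proof (rule that[OF sol(1)])
    show "lin_trace (H0 x) + norm (g0 x) = p x * f (v x)" for x using sol(2)[of x] v1[of x] by simp
    show "1 \<le> v x" for x by (rule v1)
    fix x :: 'a
    obtain m :: nat where m: "norm x \<le> real m" using real_arch_simple by blast
    show "1 + f 1 * radG DIM('a) lo (norm x) \<le> v x"
    proof (rule LIMSEQ_le_const[OF v], intro exI[of _ m] allI impI)
      fix n assume "m \<le> n"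
      then have "m \<le> k n" using seq_suble[OF k, of n] by linarith
      then have "norm x \<le> real (Suc (k n))" using m by linarith
      then show "1 + f 1 * radG DIM('a) lo (norm x) \<le> u (k n) x" by (rule u(8))
    qed
  qed
qed

text \<open>If the radial integral is bounded, there is a bounded radial strict subsolution $w$ with
  $w(0) \ge u(0)$; the minimum of $u - w$ is then attained and contradicts the equation.\<close>
theorem no_large_solution:
  assumes u: "twice_diff u g H" and eq: "\<And>x. lin_trace (H x) + norm (g x) = p x * f (u x)"
    and up: "\<And>x. 0 < u x" and large: "filterlim u at_top at_infinity"
    and bdd: "\<And>r. 0 \<le> r \<Longrightarrow> radG DIM('a) lo r \<le> B"
  shows False
proof -
  let ?N = "DIM('a)"
  \<comment> \<open>With v(0) = a \<ge> u 0 the difference v - u is non-negative at the origin; far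
    out it is non-positive, because v is bounded and u is large, so its maximum is attained. The
    bound a \<ge> 1 is what the Volterra construction asks for.\<close>
  define a where "a = max 1 (u 0)"
  \<comment> \<open>The summand exp (- s) makes the final inequality strict even where
    \<open>hi\<close> vanishes. Its moment is at most 1, the origin of M + 1 below.\<close>
  define q where "q s = hi s + exp (- s)" for s
  define d where "d s = (hi s - lo s) + exp (- s)" for s
  have qc: "continuous_on {0..} q" "continuous_on {0..} d" unfolding q_def d_def by (intro continuous_intros hi_cont lo_cont)+
  have q0: "0 \<le> q s" "0 \<le> d s" if "0 \<le> s" for s
    using hi_nonneg[OF that] lo_le_hi[OF that] by (auto simp: q_def d_def add_nonneg_nonneg)
  obtain v where v: "continuous_on {0..} v" "\<And>r. 0 \<le> r \<Longrightarrow> v r = a + radG ?N (\<lambda>s. q s * f (v s)) r"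
    "\<And>r. 0 \<le> r \<Longrightarrow> a \<le> v r" "\<And>r. 0 \<le> r \<Longrightarrow> v r \<le> a * exp (\<Lambda> * radG ?N q r)"
    by (rule volterra_solution[OF n1 qc(1) q0(1) f_cont fm f0 fL, of a]) (auto simp: a_def)
  have v1: "1 \<le> v s" if "0 \<le> s" for s using v(3)[OF that] by (simp add: a_def)
  have Gq: "radG ?N q r \<le> B + (M + 1) / (real ?N - 2)" if r: "0 \<le> r" for r
  proof -
    have "q = (\<lambda>s. lo s + d s)" by (auto simp: q_def d_def)
    then have "radG ?N q r = radG ?N lo r + radG ?N d r" using radG_add[OF n1 lo_cont qc(2)] by simp
    moreover have "radG ?N d r \<le> (M + 1) / (real ?N - 2)"
    proof -
      have i: "(\<lambda>s. s * (hi s - lo s)) integrable_on {0..r}" "(\<lambda>s::real. s * exp (- s)) integrable_on {0..r}"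
        by (intro integrable_continuous_real continuous_intros q_cont_Icc[OF n1 hi_cont] q_cont_Icc[OF n1 lo_cont])+
      have "((\<lambda>s. s * exp (- s)) has_integral (- (r + 1) * exp (- r) - (- (0 + 1) * exp (- 0)))) {0..r}"
      proof (rule fundamental_theorem_of_calculus[OF r])
        show "((\<lambda>s. - (s + 1) * exp (- s)) has_vector_derivative s * exp (- s)) (at s within {0..r})" for s :: real
          unfolding has_real_derivative_iff_has_vector_derivative[symmetric]
          by (auto intro!: derivative_eq_intros simp: algebra_simps)
      qed
      then have "integral {0..r} (\<lambda>s. s * exp (- s)) = 1 - (r + 1) * exp (- r)" by (simp add: integral_unique algebra_simps)
      then have e: "integral {0..r} (\<lambda>s. s * exp (- s)) \<le> 1" using r by simp
      have "radG ?N d r \<le> integral {0..r} (\<lambda>s. s * d s) / (real ?N - 2)" by (rule radG_le_moment[OF N qc(2) q0(2) r])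
      also have "integral {0..r} (\<lambda>s. s * d s) = integral {0..r} (\<lambda>s. s * (hi s - lo s) + s * exp (- s))"
        by (rule integral_cong) (simp add: d_def algebra_simps)
      also have "\<dots> = integral {0..r} (\<lambda>s. s * (hi s - lo s)) + integral {0..r} (\<lambda>s. s * exp (- s))" by (rule integral_add[OF i])
      also have "\<dots> \<le> M + 1" using osc_moment[OF r] e by linarith
      finally show ?thesis using N by (simp add: divide_right_mono)
    qed
    ultimately show ?thesis using bdd[OF r] by linarith
  qed
  define W where "W = a * exp (\<Lambda> * (B + (M + 1) / (real ?N - 2)))"
  have a1: "1 \<le> a" by (simp add: a_def)
  have vW: "v r \<le> W" if r: "0 \<le> r" for r
  proof -
    have "a * exp (\<Lambda> * radG ?N q r) \<le> W"
      unfolding W_def using mult_left_mono[OF Gq[OF r] L0] a1 by (intro mult_left_mono) auto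
    then show ?thesis using v(4)[OF r] by linarith
  qed
  define S where "S s = q s * f (v s)" for s
  have v0: "0 \<le> v s" if "0 \<le> s" for s using v1[OF that] by linarith
  have Sc: "continuous_on {0..} S"
    unfolding S_def by (intro continuous_intros qc continuous_on_compose2[OF f_cont v(1)]) (use v0 in auto)
  have S0: "0 \<le> S s" if "0 \<le> s" for s using q0(1)[OF that] f0[OF v0[OF that]] by (simp add: S_def)
  obtain K where K: "twice_diff (\<lambda>x::'a. a + radG ?N S (norm x)) (\<lambda>x. radk ?N S (norm x) *\<^sub>R x) K"
    "\<And>x. lin_trace (K x) + norm (radk ?N S (norm x) *\<^sub>R x) = S (norm x)"
    by (rule radial_twice_diff[OF Sc S0]) blast+
  have vS: "v (norm x) = a + radG ?N S (norm x)" for x :: 'a using v(2)[of "norm x"] by (simp add: S_def[abs_def])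
  have tw: "twice_diff (\<lambda>x. v (norm x)) (\<lambda>x. radk ?N S (norm x) *\<^sub>R x) K" using K(1) by (simp add: vS)
  note td = twice_diff_diff[OF tw u]
  have "eventually (\<lambda>x. W \<le> u x) at_infinity" using large by (simp add: filterlim_at_top)
  then obtain R where R: "\<And>x. R \<le> norm x \<Longrightarrow> W \<le> u x" unfolding eventually_at_infinity by blast
  have c0: "0 \<le> v (norm (0::'a)) - u 0" using v(3)[of 0] by (simp add: a_def)
  obtain x0 where x0: "\<And>x. v (norm x) - u x \<le> v (norm x0) - u x0"
  proof (rule attains_max_outside[of "\<lambda>x. v (norm x) - u x" R 0])
    show "continuous_on UNIV (\<lambda>x. v (norm x) - u x)" by (rule twice_diff_continuous(1)[OF td])
    fix x :: 'a assume "R < norm x"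
    then show "v (norm x) - u x \<le> v (norm (0::'a)) - u 0" using R[of x] vW[of "norm x"] c0 by auto
  qed blast
  have le: "u x0 \<le> v (norm x0)" using x0[of 0] c0 by linarith
  \<comment> \<open>Equal gradients at the maximum cancel the first-order terms of the two
    equations, so only the Laplacians remain to be compared.\<close>
  have gr: "radk ?N S (norm x0) *\<^sub>R x0 = g x0" using twice_diff_max(1)[OF td x0] by simp
  have "lin_trace (K x0) - lin_trace (H x0) \<le> 0" using twice_diff_max(2)[OF td x0] by (simp add: lin_trace_diff)
  then have "S (norm x0) \<le> p x0 * f (u x0)" using K(2)[of x0] eq[of x0] gr by simp
  also have "\<dots> \<le> hi (norm x0) * f (v (norm x0))"
    using le up[of x0] p_le_hi[of x0] p0[of x0] hi_nonneg[of "norm x0"]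
    by (intro mult_mono mono_onD[OF fm] f0) auto
  also have "\<dots> < S (norm x0)"
  proof -
    have "0 < f (v (norm x0))" using v1[of "norm x0"] by (intro fpos) auto
    then show ?thesis by (simp add: S_def q_def algebra_simps)
  qed
  finally show False by simp
qed

end

text \<open>Matches the basis-free Laplacian of the estimates with the coordinate sum in
  \<open>classical_solution\<close>.\<close>

lemma lin_trace_vec: "lin_trace L = (\<Sum>i\<in>UNIV. L (axis i 1) $ i)" for L :: "real^'n \<Rightarrow> real^'n"
proof -
  have B: "(Basis :: (real^'n) set) = range (\<lambda>i. axis i 1)" by (auto simp: Basis_vec_def)
  have "inj (\<lambda>i::'n. axis i (1::real))" by (auto simp: inj_on_def axis_eq_axis)
  then show ?thesis by (simp add: lin_trace_def B sum.reindex cart_eq_inner_axis)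
qed

lemma weighted_oscillation_continuous:
  fixes p :: "'a::euclidean_space \<Rightarrow> real"
  assumes p: "continuous_on UNIV p"
  shows "continuous_on {0..} (\<lambda>s. s * (sphere_max p s - sphere_min p s) * exp (c * integral {0..s} (\<lambda>t. t * sphere_min p t)))"
proof -
  have c: "continuous_on {0..} (sphere_max p)" "continuous_on {0..} (sphere_min p)"
    unfolding sphere_max_def sphere_min_def by (rule continuous_on_Sup_sphere[OF p], rule continuous_on_Inf_sphere[OF p])
  have "continuous_on {0..} (\<lambda>s. integral {0..s} (\<lambda>t. t * sphere_min p t))"
    by (intro continuous_on_half_line indefinite_integral_continuous_1 integrable_continuous_real continuous_on_mult
        continuous_on_id continuous_on_subset[OF c(2)]) auto
  then show ?thesis by (intro continuous_intros c)
qed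

theorem theorem2:
  fixes p :: "real^'n \<Rightarrow> real" and f :: "real \<Rightarrow> real" and \<alpha> :: real
  assumes N3: "CARD('n) \<ge> 3"
    and alpha: "0 < \<alpha>" "\<alpha> < 1"
    and p_holder: "loc_holder_on \<alpha> UNIV p"
    and p_nonneg: "\<forall>x. p x \<ge> 0"
    and f_range: "\<forall>s\<ge>0. f s \<ge> 0"
    and f_mono: "mono_on {0..} f"
    and f_holder: "loc_holder_on \<alpha> {0..} f"
    and f0: "f 0 = 0"
    and f_pos: "\<forall>s>0. f s > 0"
    and Lambda_fin: "bdd_above {f s / s | s. s \<ge> 1}"
    and h_int: "let \<Lambda> = Sup {f s / s | s. s \<ge> 1};
                    \<Lambda>\<^sub>N = \<Lambda> / (real CARD('n) - 2);
                    \<phi> = (\<lambda>r. Sup (p ` sphere 0 r));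
                    \<psi> = (\<lambda>r. Inf (p ` sphere 0 r));
                    h = (\<lambda>r. \<phi> r - \<psi> r);
                    \<Psi> = (\<lambda>r. exp (\<Lambda>\<^sub>N * integral {0..r} (\<lambda>s. s * \<psi> s)))
                in (\<integral>\<^sup>+ r\<in>{0..}. ennreal (r * h r * \<Psi> r) \<partial>lborel) < \<infinity>"
  shows "(\<exists>u. positive_entire_large_solution p f u) \<longleftrightarrow>
         (let \<psi> = (\<lambda>r. Inf (p ` sphere 0 r))
          in (\<integral>\<^sup>+ t\<in>{1..}. ennreal (exp (- t) * t powr (1 - real CARD('n)) *
                  integral {0..t} (\<lambda>s. exp s * s ^ (CARD('n) - 1) * \<psi> s)) \<partial>lborel) = \<infinity>)"
proof -
  define \<Lambda> where "\<Lambda> = Sup {f s / s | s. s \<ge> 1}"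
  have D: "DIM(real^'n) = CARD('n)" by simp
  have fL: "f s \<le> \<Lambda> * s" if s: "1 \<le> s" for s
  proof -
    have "f s / s \<le> \<Lambda>" unfolding \<Lambda>_def by (rule cSup_upper[OF _ Lambda_fin]) (use s in blast)
    then show ?thesis using s by (simp add: divide_le_eq)
  qed
  have ph: "hoelder_loc p" by (rule hoelder_loc_of_loc_holder_UNIV[OF alpha(1) _ p_holder]) (use alpha in simp)
  have fh: "hoelder_loc (\<lambda>s. f (max 0 s))" by (rule hoelder_loc_extend[OF alpha(1) _ f_holder]) (use alpha in simp)
  have pc: "continuous_on UNIV p" by (rule hoelder_loc_continuous[OF ph])
  have osc: "0 \<le> sphere_max p s - sphere_min p s" if "0 \<le> s" for s
    unfolding sphere_max_def sphere_min_def using sphere_extremes(3)[OF pc that] by simp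
  have "(\<integral>\<^sup>+ r\<in>{0..}. ennreal (r * (sphere_max p r - sphere_min p r) *
      exp (\<Lambda> / (real CARD('n) - 2) * integral {0..r} (\<lambda>t. t * sphere_min p t))) \<partial>lborel) < \<infinity>"
    using h_int by (simp add: Let_def \<Lambda>_def sphere_max_def sphere_min_def)
  then obtain M where M: "\<And>r. 0 \<le> r \<Longrightarrow> integral {0..r} (\<lambda>s. s * (sphere_max p s - sphere_min p s) *
      exp (\<Lambda> / (real CARD('n) - 2) * integral {0..s} (\<lambda>t. t * sphere_min p t))) \<le> M"
    using osc by (subst (asm) nn_integral_half_line_finite_iff[OF weighted_oscillation_continuous[OF pc]]) auto
  interpret sublinear_problem p f \<Lambda> M
    by unfold_locales (use N3 ph fh p_nonneg f_range f_mono f_pos fL M in auto)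
  let ?G = "radG CARD('n) (sphere_min p)"
  have n1': "1 \<le> CARD('n)" using N3 by simp
  note Kc = radK_cont[OF n1' lo_cont]
  have K0: "0 \<le> radK CARD('n) (sphere_min p) t" for t by (rule radK_nonneg[OF n1' lo_cont lo_nonneg])
  \<comment> \<open>The criterion integrates from 1 while G starts at 0; the primitives differ by
    the constant \<open>?G 1\<close>, so they are bounded together.\<close>
  have split: "?G 1 + integral {1..r} (radK CARD('n) (sphere_min p)) = ?G r" if "1 \<le> r" for r
    unfolding radG_def
    by (rule Henstock_Kurzweil_Integration.integral_combine) (use that radK_integrable[OF n1' lo_cont] in auto)
  have incr: "?G s \<le> ?G r" if "0 \<le> s" "s \<le> r" for s r by (rule radG_increasing[OF n1' lo_cont lo_nonneg that])
  have "(\<integral>\<^sup>+ t\<in>{1..}. ennreal (radK CARD('n) (sphere_min p) t) \<partial>lborel) < \<infinity> \<longleftrightarrow>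
      (\<exists>B. \<forall>r\<ge>1. integral {1..r} (radK CARD('n) (sphere_min p)) \<le> B)"
    by (rule nn_integral_half_line_finite_iff) (use K0 continuous_on_subset[OF Kc, of "{1..}"] in auto)
  also have "\<dots> \<longleftrightarrow> (\<exists>B. \<forall>r\<ge>0. ?G r \<le> B)"
  proof
    assume "\<exists>B. \<forall>r\<ge>1. integral {1..r} (radK CARD('n) (sphere_min p)) \<le> B"
    then obtain B where B: "\<And>r. 1 \<le> r \<Longrightarrow> integral {1..r} (radK CARD('n) (sphere_min p)) \<le> B" by blast
    have "?G r \<le> ?G 1 + B" if r: "0 \<le> r" for r
      using incr[OF r, of "max 1 r"] split[of "max 1 r"] B[of "max 1 r"] by simp
    then show "\<exists>B. \<forall>r\<ge>0. ?G r \<le> B" by blast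
  next
    assume "\<exists>B. \<forall>r\<ge>0. ?G r \<le> B"
    then obtain B where B: "\<And>r. 0 \<le> r \<Longrightarrow> ?G r \<le> B" by blast
    have "integral {1..r} (radK CARD('n) (sphere_min p)) \<le> B - ?G 1" if r: "1 \<le> r" for r
      using split[OF r] B[of r] r by simp
    then show "\<exists>B. \<forall>r\<ge>1. integral {1..r} (radK CARD('n) (sphere_min p)) \<le> B" by blast
  qed
  finally have fin: "(\<integral>\<^sup>+ t\<in>{1..}. ennreal (radK CARD('n) (sphere_min p) t) \<partial>lborel) < \<infinity> \<longleftrightarrow> (\<exists>B. \<forall>r\<ge>0. ?G r \<le> B)" .
  have cond: "(\<integral>\<^sup>+ t\<in>{1..}. ennreal (exp (- t) * t powr (1 - real CARD('n)) *
      integral {0..t} (\<lambda>s. exp s * s ^ (CARD('n) - 1) * Inf (p ` sphere 0 s))) \<partial>lborel) = \<infinity> \<longleftrightarrow> \<not> (\<exists>B. \<forall>r\<ge>0. ?G r \<le> B)"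
  proof -
    have "X = \<infinity> \<longleftrightarrow> \<not> X < \<infinity>" for X :: ennreal by (simp add: less_top[symmetric])
    then show ?thesis using fin by (simp only: radK_def sphere_min_def)
  qed
  have "(\<exists>u. positive_entire_large_solution p f u) \<longleftrightarrow> \<not> (\<exists>B. \<forall>r\<ge>0. ?G r \<le> B)"
  proof
    assume "\<exists>u. positive_entire_large_solution p f u"
    then obtain u g H where u: "\<And>x. (u has_derivative (\<lambda>h. g x \<bullet> h)) (at x)" "\<And>x. (g has_derivative H x) (at x)"
      "\<And>x. (\<Sum>i\<in>UNIV. H x (axis i 1) $ i) + norm (g x) = p x * f (u x)" "\<And>x. u x > 0" "filterlim u at_top at_infinity"
      unfolding positive_entire_large_solution_def classical_solution_def by blast
    have td: "twice_diff u g H" using u(1,2) by (simp add: twice_diff_def)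
    show "\<not> (\<exists>B. \<forall>r\<ge>0. ?G r \<le> B)"
    proof
      assume "\<exists>B. \<forall>r\<ge>0. ?G r \<le> B"
      then obtain B where B: "\<And>r. 0 \<le> r \<Longrightarrow> ?G r \<le> B" by blast
      show False
        by (rule no_large_solution[OF td _ u(4,5), of B]) (use u(3) B in \<open>auto simp: lin_trace_vec\<close>)
    qed
  next
    assume nb: "\<not> (\<exists>B. \<forall>r\<ge>0. ?G r \<le> B)"
    obtain u g H where u: "C2 u g H" "\<And>x. lin_trace (H x) + norm (g x) = p x * f (u x)"
      "\<And>x. 1 \<le> u x" "\<And>x. 1 + f 1 * ?G (norm x) \<le> u x"
      by (rule solution_exists[unfolded D]) blast
    have "classical_solution p f u"
      unfolding classical_solution_def
    proof (intro exI[of _ g] exI[of _ H] conjI allI)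
      show "continuous_on UNIV (\<lambda>x. H x (axis j 1) $ i)" for i j
        using u(1) unfolding C2_def by (intro continuous_on_component) blast
    qed (use u(1,2) in \<open>auto simp: C2_def twice_diff_def lin_trace_vec\<close>)
    moreover have "0 < u x" for x using u(3)[of x] by linarith
    moreover have "filterlim u at_top at_infinity"
      unfolding filterlim_at_top
    proof
      fix Z :: real
      have f1: "0 < f 1" using f_pos by simp
      \<comment> \<open>Unboundedness supplies one radius at which f(1) G exceeds Z; monotonicity of
        G carries this to all larger radii, uniformly in the direction.\<close>
      obtain r where r: "0 \<le> r" "Z / f 1 < ?G r" using nb by (meson not_le)
      have "Z \<le> u x" if x: "r \<le> norm x" for x
      proof -
        have "Z < f 1 * ?G r" using r f1 by (simp add: divide_less_eq mult.commute)
        also have "\<dots> \<le> f 1 * ?G (norm x)" using incr[OF r(1) x] f1 by (intro mult_left_mono) auto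
        finally show ?thesis using u(4)[of x] by linarith
      qed
      then show "eventually (\<lambda>x. Z \<le> u x) at_infinity" unfolding eventually_at_infinity by blast
    qed
    ultimately show "\<exists>u. positive_entire_large_solution p f u"
      unfolding positive_entire_large_solution_def by blast
  qed
  then show ?thesis using cond by (simp add: Let_def)
qed

end
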